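(* Let $p=p(n)\in[0,1]$ satisfy $p\gg n^{-2/3}$, i.e. $p(n)\,n^{2/3}\to\infty$ as $n\to\infty$. Then there is a sequence $(\varepsilon_n)$ of positive reals with $\varepsilon_n\to 0$ (the $o(1)$ term) such that $G(n,n,p)$ asymptotically almost surely satisfies the following: every Hamiltonian subgraph $G'\subset G(n,n,p)$ with more than $(1+\varepsilon_n)n^2p/2$ edges is bipancyclic.
   Context: $G(n,n,p)$ is the random bipartite graph on $2n$ vertices with two fixed bipartition classes of $n$ vertices each, in which each pair of vertices from different classes forms an edge independently with probability $p$. "Asymptotically almost surely" (a.a.s.) means with probability tending to $1$ as $n\to\infty$. A Hamiltonian subgraph $G'$ of $G(n,n,p)$ is a subgraph on the full vertex set of $2n$ vertices that contains a cycle of length $2n$. A bipartite graph on $2n$ vertices is bipancyclic if it contains cycles of all even lengths from $4$ to $2n$. *)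

theory Defs
  imports "HOL-Probability.Probability"
begin

text \<open>
  A finite simple graph on a vertex set \<open>V\<close> is given by its set of edges, each edge being a
  two-element subset of \<open>V\<close>.  Subgraphs on the full vertex set are then subsets of the edge set.
\<close>

text \<open>
  A cycle is listed by its vertices in cyclic order, without repeating the first one at the end.
  Its length (number of vertices, equivalently of edges) is at least 3, so an edge traversed
  back and forth is not a cycle.
\<close>
definition is_cycle :: "'a set set \<Rightarrow> 'a list \<Rightarrow> bool" where
  "is_cycle E vs \<longleftrightarrow>
     3 \<le> length vs \<and> distinct vs \<and>
     (\<forall>i<length vs. {vs ! i, vs ! (Suc i mod length vs)} \<in> E)"

definition has_cycle_of_length :: "'a set set \<Rightarrow> nat \<Rightarrow> bool" where
  "has_cycle_of_length E k \<longleftrightarrow> (\<exists>vs. is_cycle E vs \<and> length vs = k)"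

definition hamiltonian :: "'a set \<Rightarrow> 'a set set \<Rightarrow> bool" where
  "hamiltonian V E \<longleftrightarrow> has_cycle_of_length E (card V)"

definition bipartite :: "'a set \<Rightarrow> 'a set set \<Rightarrow> bool" where
  "bipartite V E \<longleftrightarrow>
     (\<exists>A B. A \<union> B = V \<and> A \<inter> B = {} \<and> (\<forall>e\<in>E. \<exists>a\<in>A. \<exists>b\<in>B. e = {a, b}))"

definition bipancyclic :: "'a set \<Rightarrow> 'a set set \<Rightarrow> bool" where
  "bipancyclic V E \<longleftrightarrow>
     bipartite V E \<and>
     (\<forall>k. even k \<and> 4 \<le> k \<and> k \<le> card V \<longrightarrow> has_cycle_of_length E k)"

definition bip_vertices :: "nat \<Rightarrow> nat \<Rightarrow> (nat + nat) set" where
  "bip_vertices m n = {..<m} <+> {..<n}"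

definition complete_bip_edges :: "nat \<Rightarrow> nat \<Rightarrow> (nat + nat) set set" where
  "complete_bip_edges m n = {{Inl i, Inr j} |i j. i < m \<and> j < n}"

text \<open>
  The distribution of the edge set of the random bipartite graph \<open>G(m, n, q)\<close>: each edge of
  \<open>K\<^sub>m\<^sub>,\<^sub>n\<close> is kept by its own independent coin with success probability \<open>q\<close>.
  (\<open>bernoulli_pmf\<close> is meaningful for \<open>q\<close> in the unit interval only.)
\<close>
definition random_bip_graph :: "nat \<Rightarrow> nat \<Rightarrow> real \<Rightarrow> (nat + nat) set set pmf" where
  "random_bip_graph m n q =
     map_pmf (\<lambda>f. {e \<in> complete_bip_edges m n. f e})
       (Pi_pmf (complete_bip_edges m n) False (\<lambda>_. bernoulli_pmf q))"

text \<open>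
  \<open>aas \<Omega> P\<close>: the event \<open>P n\<close>, on the \<open>n\<close>-th probability space, holds asymptotically almost surely.
\<close>
definition aas :: "(nat \<Rightarrow> 'a pmf) \<Rightarrow> (nat \<Rightarrow> 'a \<Rightarrow> bool) \<Rightarrow> bool" where
  "aas \<Omega> P \<longleftrightarrow> (\<lambda>n. measure_pmf.prob (\<Omega> n) {x. P n x}) \<longlonglongrightarrow> 1"

end

(* Fix a Hamilton cycle C and an even length k < 2n. Bondy's argument shows that any set of more than
   half of the n^2 potential edges contains chords which together with C close up to a k-cycle; a
   Cauchy-Schwarz argument turns this into supersaturation. For k bounded away from 0 and 2n two chords
   give n^3 such configurations. For the remaining k one uses configurations of four chords, of which
   there are n^4 and which overlap like 4-cycles; this is where p >> n^(-2/3) is needed. A hypergraph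
   container theorem therefore yields, for every C and k, at most O(n^(4/3)) edges of a subgraph G'
   without k-cycle that determine a set of about n^2 / 2 potential edges containing G'. As n^(4/3) is
   small compared with n^2 p, and there are only exp(O(n log n)) choices of C, Chernoff's bound and a
   union bound show that no such G' has more than (1 + o(1)) n^2 p / 2 edges. *)

theory Submission
  imports Defs "HOL-Real_Asymp.Real_Asymp" "HOL-Number_Theory.Cong"
begin

section \<open>Hypergraph containers\<close>

text \<open>The subgraph G' is chosen after the random graph is seen, so no union bound can run over
  it. Only its fingerprint S is summed over: G' lies in G intersected with the container of S, and
  the size of that set is a sum of independent coins. An edge of an r-uniform hypergraph has degree
  at least 1, so D \<tau>^(r-1) cannot drop below 1; fingerprints have size of order \<tau> n^2.
  Pairs of chords allow D of order n and \<tau> = 1/n, but they depend on a shift whose range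
  shrinks as k approaches 4 or 2n. Quadruples indexed by two even and two odd positions have D of
  order n^2, and D \<tau>^3 of order 1 means \<tau> = n^(-2/3), which is the source of n^(4/3).
  Bondy's pigeonhole only yields quadruples in which two of the four indices coincide;
  Cauchy-Schwarz sets these indices free. The hypergraph depends on the Hamilton cycle, so the cycle
  is fixed before containers are built; its cost exp(O(n log n)) is below exp(n^(4/3)). All
  estimates hold for a constant error e, and a diagonal argument lets e tend to 0.\<close>

definition deg :: "'a set set \<Rightarrow> 'a set \<Rightarrow> nat" where
  "deg H T = card {e \<in> H. T \<subseteq> e}"

definition uniform_hypergraph :: "nat \<Rightarrow> 'a set \<Rightarrow> 'a set set \<Rightarrow> bool" where
  "uniform_hypergraph r V H \<longleftrightarrow> (\<forall>e\<in>H. e \<subseteq> V \<and> card e = r)"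

text \<open>\<open>D\<close> bounds the vertex degrees, and every further vertex of \<open>T\<close>
  must lower the bound by a factor \<open>\<tau>\<close>. Small \<open>\<tau>\<close> means
  well-spread edges and, later, short fingerprints.\<close>

definition degrees_bounded :: "'a set \<Rightarrow> 'a set set \<Rightarrow> real \<Rightarrow> real \<Rightarrow> bool" where
  "degrees_bounded V H D \<tau> \<longleftrightarrow>
     (\<forall>T. T \<subseteq> V \<and> T \<noteq> {} \<longrightarrow> real (deg H T) \<le> D * \<tau> ^ (card T - 1))"

definition independent :: "'a set set \<Rightarrow> 'a set \<Rightarrow> bool" where
  "independent H I \<longleftrightarrow> (\<forall>e\<in>H. \<not> e \<subseteq> I)"

lemma uniform_finite: "finite V \<Longrightarrow> uniform_hypergraph r V H \<Longrightarrow> finite H"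
  by (rule finite_subset[of _ "Pow V"]) (auto simp: uniform_hypergraph_def)

lemma deg_mono: "finite H' \<Longrightarrow> H \<subseteq> H' \<Longrightarrow> deg H T \<le> deg H' T"
  unfolding deg_def by (intro card_mono) auto

lemma degrees_boundedD:
  "degrees_bounded V H D \<tau> \<Longrightarrow> T \<subseteq> V \<Longrightarrow> T \<noteq> {} \<Longrightarrow> real (deg H T) \<le> D * \<tau> ^ (card T - 1)"
  by (simp add: degrees_bounded_def)

lemma degrees_bounded_subset:
  "degrees_bounded V H' D \<tau> \<Longrightarrow> finite H' \<Longrightarrow> H \<subseteq> H' \<Longrightarrow> degrees_bounded V H D \<tau>"
  unfolding degrees_bounded_def using deg_mono[of H' H]
  by (meson of_nat_mono order_trans)

lemma sum_card_incident:
  assumes "finite V" "finite H" "\<And>e. e \<in> H \<Longrightarrow> e \<subseteq> V"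
  shows "(\<Sum>v\<in>V. card {e \<in> H. v \<in> e}) = (\<Sum>e\<in>H. card e)"
proof -
  have "(\<Sum>v\<in>V. card {e \<in> H. v \<in> e}) = (\<Sum>v\<in>V. \<Sum>e\<in>H. if v \<in> e then 1 else 0)"
    using assms(2) by (intro sum.cong) (auto simp: sum.If_cases Int_def)
  also have "\<dots> = (\<Sum>e\<in>H. \<Sum>v\<in>V. if v \<in> e then 1 else 0)"
    by (rule sum.swap)
  also have "\<dots> = (\<Sum>e\<in>H. card e)"
    using assms(1,3) by (intro sum.cong) (auto simp: sum.If_cases Int_absorb1)
  finally show ?thesis .
qed

text \<open>
  One round of the container algorithm. The vertices are scanned in a fixed order; a vertex \<open>v\<close> of
  high degree that lies in the independent set \<open>I\<close> contributes its link to an auxiliary hypergraph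
  \<open>L\<close> of uniformity smaller by one, in which \<open>I\<close> stays independent; a vertex of high degree outside
  \<open>I\<close> is removed. Edges with a subset of excessive degree in \<open>L\<close> are ignored from then on.
\<close>

locale link_process =
  fixes V :: "'a set" and H :: "'a set set" and r :: nat and D \<tau> B \<eta> lim :: real
  assumes finV: "finite V"
    and unif: "uniform_hypergraph r V H"
    and degs: "degrees_bounded V H D \<tau>"
    and r2: "2 \<le> r" and D0: "0 < D" and tau0: "0 < \<tau>" and B1: "1 \<le> B" and eta0: "0 < \<eta>"
    and DB: "D * \<tau> ^ (r - 1) \<le> B"
begin

text \<open>The point at which \<open>T\<close> may gain no more edges in \<open>L\<close>: one
  further link can add D \<tau>^|T|. The factor \<open>B\<close> lowers the threshold so far that
  every edge of \<open>L\<close> is itself saturated.\<close>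

definition saturated :: "'a set set \<Rightarrow> 'a set \<Rightarrow> bool" where
  "saturated L T \<longleftrightarrow> T \<noteq> {} \<and> D * \<tau> ^ card T \<le> B * deg L T"

definition alive :: "'a set set \<Rightarrow> 'a set set" where
  "alive L = {e \<in> H. \<forall>T\<subseteq>e. \<not> saturated L T}"

text \<open>The cap \<open>lim\<close> freezes the process once \<open>L\<close> is large enough; it
  keeps \<open>L\<close>, and with it the number of picked vertices, bounded.\<close>

definition high :: "'a set set \<Rightarrow> 'a \<Rightarrow> bool" where
  "high L v \<longleftrightarrow> real (card L) < lim \<and> \<eta> * D < card {e \<in> alive L. v \<in> e}"

definition link :: "'a set set \<Rightarrow> 'a \<Rightarrow> 'a set set" where
  "link L v = (\<lambda>e. e - {v}) ` {e \<in> alive L. v \<in> e}"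

fun run :: "'a set \<Rightarrow> 'a list \<Rightarrow> 'a set set \<Rightarrow> 'a set set" where
  "run I [] L = L"
| "run I (v # vs) L = run I vs (if high L v \<and> v \<in> I then L \<union> link L v else L)"

fun picked :: "'a set \<Rightarrow> 'a list \<Rightarrow> 'a set set \<Rightarrow> 'a set" where
  "picked I [] L = {}"
| "picked I (v # vs) L =
    (if high L v \<and> v \<in> I then insert v (picked I vs (L \<union> link L v)) else picked I vs L)"

fun removed :: "'a set \<Rightarrow> 'a list \<Rightarrow> 'a set set \<Rightarrow> 'a set" where
  "removed I [] L = {}"
| "removed I (v # vs) L =
    (if high L v \<and> v \<in> I then removed I vs (L \<union> link L v)
     else if high L v then insert v (removed I vs L) else removed I vs L)"

section \<open>Invariants and counting for one round of the algorithm\<close>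

lemma finH: "finite H"
  using uniform_finite[OF finV unif] .

lemma edge_subset: "e \<in> H \<Longrightarrow> e \<subseteq> V" and card_edge: "e \<in> H \<Longrightarrow> card e = r"
  using unif by (auto simp: uniform_hypergraph_def)

lemma alive_subset: "alive L \<subseteq> H"
  by (auto simp: alive_def)

lemma finite_alive: "finite (alive L)"
  using finite_subset[OF alive_subset finH] .

lemma finite_link: "finite (link L v)"
  using finite_alive by (simp add: link_def)

lemma picked_subset: "picked I vs L \<subseteq> I \<inter> set vs"
  by (induction I vs L rule: picked.induct) auto

lemma high_incident:
  assumes "high L v"
  shows "v \<in> \<Union>H"
proof -
  have "0 < \<eta> * D" using eta0 D0 by simp
  hence "0 < card {e \<in> alive L. v \<in> e}" using assms by (auto simp: high_def)
  hence "{e \<in> alive L. v \<in> e} \<noteq> {}" by (metis card.empty less_irrefl)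
  thus ?thesis using alive_subset by blast
qed

lemma removed_subset: "removed I vs L \<subseteq> \<Union>H - I"
  using high_incident by (induction I vs L rule: removed.induct) (auto split: if_splits)

text \<open>Membership in \<open>I\<close> matters only at vertices of high degree. Those in
  \<open>I\<close> are picked and hence lie in \<open>J\<close>; the others lie outside
  \<open>J\<close>, a subset of \<open>I\<close>. So a run can be replayed from its picked
  set.\<close>

lemma run_cong:
  assumes "picked I vs L \<subseteq> J" "J \<subseteq> I"
  shows "run J vs L = run I vs L \<and> removed J vs L = removed I vs L"
  using assms
proof (induction I vs L rule: picked.induct)
  case (2 I v vs L)
  then show ?case by (cases "high L v"; cases "v \<in> I"; cases "v \<in> J") auto
qed auto

lemma run_increasing: "L \<subseteq> run I vs L"
  by (induction I vs L rule: run.induct) (auto split: if_splits)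

lemma finite_run: "finite L \<Longrightarrow> finite (run I vs L)"
  by (induction I vs L rule: run.induct) (auto simp: finite_link)

lemma alive_antimono:
  assumes "L \<subseteq> L'" "finite L'"
  shows "alive L' \<subseteq> alive L"
proof -
  have "saturated L' T" if "saturated L T" for T
  proof -
    have "B * deg L T \<le> B * deg L' T"
      using deg_mono[OF assms(2,1)] B1 by (intro mult_left_mono) auto
    thus ?thesis using that unfolding saturated_def by linarith
  qed
  thus ?thesis unfolding alive_def by blast
qed

text \<open>The degree clause is \<open>degrees_bounded\<close> for \<open>L\<close> with 2 D \<tau>
  in place of \<open>D\<close>, as the next round needs it. The last clause makes \<open>I\<close>
  independent in \<open>L\<close> if it is so in \<open>H\<close>.\<close>

definition good :: "'a set \<Rightarrow> 'a set set \<Rightarrow> bool" where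
  "good I L \<longleftrightarrow> uniform_hypergraph (r - 1) V L \<and>
     (\<forall>T. T \<subseteq> V \<and> T \<noteq> {} \<longrightarrow> real (deg L T) \<le> 2 * D * \<tau> ^ card T) \<and>
     (\<forall>f\<in>L. \<exists>v\<in>I. insert v f \<in> H)"

lemma good_empty: "good I {}"
  using D0 tau0 by (auto simp: good_def uniform_hypergraph_def deg_def)

lemma good_finite: "good I L \<Longrightarrow> finite L"
  using finV by (auto simp: good_def intro: uniform_finite)

lemma card_alive_incident_le: "real (card {e \<in> alive L. v \<in> e}) \<le> D"
proof (cases "v \<in> V")
  case True
  have "card {e \<in> alive L. v \<in> e} \<le> deg H {v}"
    unfolding deg_def using finH alive_subset by (intro card_mono) auto
  moreover have "real (deg H {v}) \<le> D"
    using degrees_boundedD[OF degs, of "{v}"] True by simp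
  ultimately show ?thesis by linarith
next
  case False
  hence "{e \<in> alive L. v \<in> e} = {}" using alive_subset edge_subset by blast
  thus ?thesis using D0 by (simp del: Collect_empty_eq)
qed

text \<open>Only sets \<open>T\<close> inside a new edge gain degree. Such a \<open>T\<close> lies
  in an alive edge, so it is unsaturated and has degree below D \<tau>^|T|; the link adds at most
  the degree of \<open>insert v T\<close> in \<open>H\<close>, again at most D \<tau>^|T|. Hence the
  factor 2.\<close>

lemma good_step:
  assumes g: "good I L" and vI: "v \<in> I"
  shows "good I (L \<union> link L v)"
proof -
  have finL: "finite L" using good_finite[OF g] .
  have lk: "f \<subseteq> V \<and> card f = r - 1 \<and> insert v f \<in> H" if f: "f \<in> link L v" for f
  proof -
    from f obtain e where e: "e \<in> alive L" "v \<in> e" "f = e - {v}" by (auto simp: link_def)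
    have eH: "e \<in> H" using e alive_subset by blast
    have "insert v f = e" using e by auto
    moreover have "card f = r - 1" using e(2,3) card_edge[OF eH] by simp
    moreover have "f \<subseteq> V" using e(3) edge_subset[OF eH] by blast
    ultimately show ?thesis using eH by simp
  qed
  have dg: "real (deg (L \<union> link L v) T) \<le> 2 * D * \<tau> ^ card T"
    if T: "T \<subseteq> V" "T \<noteq> {}" for T
  proof (cases "\<exists>f\<in>link L v. T \<subseteq> f")
    case False
    hence "deg (L \<union> link L v) T = deg L T"
      unfolding deg_def by (intro arg_cong[of _ _ card]) blast
    thus ?thesis using g T by (simp add: good_def)
  next
    case True
    then obtain e where e: "e \<in> alive L" "v \<in> e" "T \<subseteq> e - {v}" by (auto simp: link_def)
    have "\<not> saturated L T" using e unfolding alive_def by blast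
    hence "B * deg L T < D * \<tau> ^ card T" using T by (simp add: saturated_def)
    moreover have "real (deg L T) \<le> B * deg L T" using B1 by (simp add: mult_le_cancel_right1)
    ultimately have 1: "real (deg L T) \<le> D * \<tau> ^ card T" by linarith
    have "e \<in> H" using e(1) alive_subset by blast
    hence "v \<in> V" using edge_subset e(2) by blast
    have "v \<notin> T" using e(3) by blast
    have finT: "finite T" using finite_subset[OF T(1) finV] .
    have "{f \<in> link L v. T \<subseteq> f} \<subseteq> (\<lambda>e. e - {v}) ` {e \<in> H. insert v T \<subseteq> e}"
      using alive_subset[of L] by (auto simp: link_def)
    hence "card {f \<in> link L v. T \<subseteq> f} \<le> card ((\<lambda>e. e - {v}) ` {e \<in> H. insert v T \<subseteq> e})"
      using finH by (intro card_mono) auto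
    also have "\<dots> \<le> deg H (insert v T)" unfolding deg_def using finH by (intro card_image_le) auto
    finally have "real (card {f \<in> link L v. T \<subseteq> f}) \<le> deg H (insert v T)" by simp
    also have "\<dots> \<le> D * \<tau> ^ card T"
      using degrees_boundedD[OF degs, of "insert v T"] T \<open>v \<in> V\<close> \<open>v \<notin> T\<close> finT by simp
    finally have 2: "real (card {f \<in> link L v. T \<subseteq> f}) \<le> D * \<tau> ^ card T" .
    have "deg (L \<union> link L v) T \<le> deg L T + card {f \<in> link L v. T \<subseteq> f}"
    proof -
      have "{e \<in> L \<union> link L v. T \<subseteq> e} = {e \<in> L. T \<subseteq> e} \<union> {f \<in> link L v. T \<subseteq> f}" by auto
      thus ?thesis unfolding deg_def by (simp add: card_Un_le)
    qed
    thus ?thesis using 1 2 by linarith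
  qed
  show ?thesis unfolding good_def uniform_hypergraph_def
  proof (intro conjI ballI allI impI)
    fix f assume "f \<in> L \<union> link L v"
    thus "f \<subseteq> V" "card f = r - 1" "\<exists>v\<in>I. insert v f \<in> H"
      using lk g vI unfolding good_def uniform_hypergraph_def by (meson UnE)+
  qed (use dg in blast)
qed

lemma good_run: "good I L \<Longrightarrow> good I (run I vs L)"
  by (induction I vs L rule: run.induct) (auto simp: good_step)

text \<open>Links added at different times are disjoint: an edge of \<open>L\<close> has degree at
  least 1 in \<open>L\<close>, which by D \<tau>^(r-1) \<le> B saturates it, so no alive edge
  contains it.\<close>

lemma card_step:
  assumes g: "good I L"
  shows "card (L \<union> link L v) = card L + card {e \<in> alive L. v \<in> e}"
proof -
  have "L \<inter> link L v = {}"
  proof (rule ccontr)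
    assume "L \<inter> link L v \<noteq> {}"
    then obtain e where e: "e \<in> alive L" "v \<in> e" "e - {v} \<in> L" by (auto simp: link_def)
    have c: "card (e - {v}) = r - 1" using g e by (auto simp: good_def uniform_hypergraph_def)
    have "e - {v} \<in> {f \<in> L. e - {v} \<subseteq> f}" using e by auto
    hence "card {f \<in> L. e - {v} \<subseteq> f} > 0"
      using good_finite[OF g] by (subst card_gt_0_iff) auto
    hence "deg L (e - {v}) \<ge> 1" unfolding deg_def by linarith
    hence "B * 1 \<le> B * deg L (e - {v})" using B1 by (intro mult_left_mono) auto
    hence "D * \<tau> ^ (r - 1) \<le> B * deg L (e - {v})"
      using DB by linarith
    moreover have "e - {v} \<noteq> {}" using c r2 by fastforce
    ultimately have "saturated L (e - {v})" using c by (simp add: saturated_def)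
    thus False using e(1) by (auto simp: alive_def)
  qed
  moreover have "card (link L v) = card {e \<in> alive L. v \<in> e}"
    unfolding link_def by (intro card_image) (auto simp: inj_on_def)
  ultimately show ?thesis using good_finite[OF g] finite_link by (simp add: card_Un_disjoint)
qed

text \<open>Each picked vertex was high, so its link brought more than \<eta> D new edges; the size
  of \<open>L\<close> therefore bounds the fingerprint.\<close>

lemma card_picked:
  "good I L \<Longrightarrow> \<eta> * D * card (picked I vs L) + card L \<le> card (run I vs L)"
proof (induction I vs L rule: picked.induct)
  case (2 I v vs L)
  show ?case
  proof (cases "high L v \<and> v \<in> I")
    case True
    let ?L = "L \<union> link L v"
    have "good I ?L" using 2 True good_step by blast
    hence IH: "\<eta> * D * card (picked I vs ?L) + card ?L \<le> card (run I vs ?L)"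
      using 2 True by blast
    have "real (card (insert v (picked I vs ?L))) \<le> card (picked I vs ?L) + 1"
      using card_insert_le_m1[of "Suc (card (picked I vs ?L))" "picked I vs ?L" v] by simp
    hence "\<eta> * D * card (insert v (picked I vs ?L)) \<le> \<eta> * D * (card (picked I vs ?L) + 1)"
      using eta0 D0 by (intro mult_left_mono) auto
    moreover have "\<eta> * D < card {e \<in> alive L. v \<in> e}" using True by (auto simp: high_def)
    ultimately show ?thesis using IH True card_step[OF 2(3), of v] by (simp add: algebra_simps)
  next
    case False
    thus ?thesis using 2 by auto
  qed
qed auto

text \<open>The link that reaches \<open>lim\<close> may overshoot, but by no more than the maximum
  degree.\<close>

lemma card_run:
  "good I L \<Longrightarrow> real (card L) \<le> lim + D \<Longrightarrow> card (run I vs L) \<le> lim + D"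
proof (induction I vs L rule: run.induct)
  case (2 I v vs L)
  show ?case
  proof (cases "high L v \<and> v \<in> I")
    case True
    have "real (card (L \<union> link L v)) \<le> lim + D"
      using card_step[OF 2(2), of v] card_alive_incident_le[of L v] True by (auto simp: high_def)
    thus ?thesis using 2 True good_step by auto
  next
    case False
    thus ?thesis using 2 by auto
  qed
qed auto

text \<open>If the final \<open>L\<close> is below \<open>lim\<close>, the cap never acted, so a
  vertex neither picked nor removed had few alive edges when it was scanned; afterwards the alive
  edges only become fewer.\<close>

lemma unprocessed_low:
  assumes "finite L" "real (card (run I vs L)) < lim" "v \<in> set vs"
    "v \<notin> removed I vs L" "v \<notin> picked I vs L"
  shows "card {e \<in> alive (run I vs L). v \<in> e} \<le> \<eta> * D"
  using assms
proof (induction I vs L rule: picked.induct)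
  case (2 I w vs L)
  let ?L' = "if high L w \<and> w \<in> I then L \<union> link L w else L"
  have fin': "finite ?L'" using 2 finite_link by auto
  show ?case
  proof (cases "v \<in> set vs")
    case True
    thus ?thesis using 2 finite_link by (auto split: if_splits)
  next
    case False
    hence vw: "v = w" using 2 by auto
    have nh: "\<not> high L v" using 2 vw by (auto split: if_splits)
    have "card L \<le> card (run I (w # vs) L)"
      by (intro card_mono finite_run 2(3) run_increasing)
    hence "card {e \<in> alive L. v \<in> e} \<le> \<eta> * D" using nh 2(4) by (auto simp: high_def)
    moreover have "card {e \<in> alive (run I (w # vs) L). v \<in> e} \<le> card {e \<in> alive L. v \<in> e}"
      using alive_antimono[OF run_increasing finite_run[OF 2(3)], of I "w # vs"] finite_alive
      by (intro card_mono) auto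
    ultimately show ?thesis by linarith
  qed
qed auto

text \<open>A dead edge contains a saturated \<open>T\<close>, for which deg H T \<le> D
  \<tau>^(|T|-1) \<le> B deg L T / \<tau>. Summing deg L T over all \<open>T\<close> counts each
  edge of \<open>L\<close> once per subset, that is 2^(r-1) times.\<close>

lemma card_dead:
  assumes g: "good I L"
  shows "real (card H) - card (alive L) \<le> B * 2 ^ r * card L / \<tau>"
proof -
  have finL: "finite L" using good_finite[OF g] .
  let ?S = "{T \<in> Pow V. saturated L T}"
  have finS: "finite ?S" using finV by auto
  have "H - alive L \<subseteq> (\<Union>T\<in>?S. {e \<in> H. T \<subseteq> e})"
    using edge_subset unfolding alive_def by blast
  hence "card (H - alive L) \<le> card (\<Union>T\<in>?S. {e \<in> H. T \<subseteq> e})"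
    using finS finH by (intro card_mono) auto
  also have "\<dots> \<le> (\<Sum>T\<in>?S. deg H T)"
    unfolding deg_def by (intro card_UN_le finS)
  finally have "real (card (H - alive L)) \<le> (\<Sum>T\<in>?S. real (deg H T))"
    by (metis of_nat_le_iff of_nat_sum)
  also have "\<dots> \<le> (\<Sum>T\<in>?S. B * deg L T / \<tau>)"
  proof (rule sum_mono)
    fix T assume T: "T \<in> ?S"
    hence T': "T \<noteq> {}" "finite T" using finV by (auto simp: saturated_def intro: finite_subset)
    hence "card T > 0" by auto
    hence pw: "\<tau> ^ card T = \<tau> * \<tau> ^ (card T - 1)" by (cases "card T") auto
    have "deg H T \<le> D * \<tau> ^ (card T - 1)" using degrees_boundedD[OF degs] T T' by blast
    also have "\<dots> = D * \<tau> ^ card T / \<tau>" using tau0 pw by simp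
    also have "\<dots> \<le> B * deg L T / \<tau>" using T tau0 by (intro divide_right_mono) (auto simp: saturated_def)
    finally show "real (deg H T) \<le> B * deg L T / \<tau>" .
  qed
  also have "\<dots> = B / \<tau> * (\<Sum>T\<in>?S. real (deg L T))" by (simp add: sum_distrib_left)
  also have "\<dots> \<le> B / \<tau> * (\<Sum>T\<in>Pow V. real (deg L T))"
    using B1 tau0 finV by (intro mult_left_mono sum_mono2) auto
  also have "(\<Sum>T\<in>Pow V. real (deg L T)) = (\<Sum>T\<in>Pow V. \<Sum>f\<in>L. if T \<subseteq> f then 1 else 0)"
    using finL by (intro sum.cong) (auto simp: deg_def sum.If_cases Int_def)
  also have "\<dots> = (\<Sum>f\<in>L. \<Sum>T\<in>Pow V. if T \<subseteq> f then 1 else 0)" by (rule sum.swap)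
  also have "\<dots> = (\<Sum>f\<in>L. real (card (Pow f)))"
  proof (rule sum.cong[OF refl])
    fix f assume "f \<in> L"
    hence "f \<subseteq> V" using g by (auto simp: good_def uniform_hypergraph_def)
    hence "Pow V \<inter> {T. T \<subseteq> f} = Pow f" by auto
    thus "(\<Sum>T\<in>Pow V. if T \<subseteq> f then 1 else 0) = real (card (Pow f))"
      using finV by (simp add: sum.If_cases)
  qed
  also have "\<dots> = (\<Sum>f\<in>L. 2 ^ (r - 1))"
  proof (rule sum.cong[OF refl])
    fix f assume "f \<in> L"
    hence "f \<subseteq> V" "card f = r - 1" using g by (auto simp: good_def uniform_hypergraph_def)
    thus "real (card (Pow f)) = 2 ^ (r - 1)" using finV by (simp add: card_Pow finite_subset)
  qed
  also have "B / \<tau> * \<dots> \<le> B / \<tau> * (card L * 2 ^ r)"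
    using B1 tau0 by (intro mult_left_mono) (auto intro!: mult_left_mono power_increasing)
  finally have "card (H - alive L) \<le> B * 2 ^ r * card L / \<tau>" by (simp add: mult_ac)
  moreover have "card (H - alive L) = card H - card (alive L)"
    using alive_subset finite_alive by (simp add: card_Diff_subset)
  moreover have "card (alive L) \<le> card H" using alive_subset finH by (simp add: card_mono)
  ultimately show ?thesis by (simp add: of_nat_diff)
qed

end

text \<open>
  The value of \<open>f\<close> is the same on all sets between the fingerprint \<open>S0\<close> and \<open>I\<close>; this is what
  allows the fingerprints of successive rounds to be merged into their union.
\<close>
definition recovered :: "'a set \<Rightarrow> real \<Rightarrow> ('a set \<Rightarrow> 'b) \<Rightarrow> bool" where
  "recovered I s f \<longleftrightarrow> (\<exists>S0\<subseteq>I. real (card S0) \<le> s \<and> (\<forall>S. S0 \<subseteq> S \<and> S \<subseteq> I \<longrightarrow> f S = f I))"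

text \<open>\<open>f\<close> returns vertices to delete from the container, so that rounds can be
  composed. Locating them in \<Union>H ensures that a round run on the edges inside \<open>X\<close>
  deletes vertices of \<open>X\<close>.\<close>

definition fingerprints :: "'a set \<Rightarrow> 'a set set \<Rightarrow> ('a set \<Rightarrow> 'a set) \<Rightarrow> real \<Rightarrow> real \<Rightarrow> bool" where
  "fingerprints V H f s d \<longleftrightarrow>
     (\<forall>I\<subseteq>V. independent H I \<longrightarrow> recovered I s f \<and> f I \<subseteq> \<Union>H - I \<and> d \<le> card (f I))"

text \<open>Induction on the uniformity. If \<open>L\<close> stays below \<open>lim\<close>, few
  edges die, and as unprocessed vertices meet few alive edges, linearly many vertices must have been
  removed. If \<open>L\<close> reaches \<open>lim\<close>, it is a dense hypergraph of uniformity
  one less in which \<open>I\<close> is independent, and the induction hypothesis supplies the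
  deleted vertices.\<close>

lemma container_round:
  assumes "1 \<le> r"
  shows "\<forall>\<beta>>0. \<forall>B\<ge>1. \<exists>K>0::real. \<exists>\<delta>>0::real. \<exists>\<tau>0>0::real. \<forall>(V :: 'a set) H D \<tau>.
    finite V \<and> uniform_hypergraph r V H \<and> degrees_bounded V H D \<tau> \<and> 0 < D \<and> 0 < \<tau> \<and> \<tau> \<le> \<tau>0 \<and>
    1 \<le> \<tau> * card V \<and> D * \<tau> ^ (r - 1) \<le> B \<and> \<beta> * D * card V \<le> card H \<longrightarrow>
    (\<exists>f. fingerprints V H f (K * \<tau> * card V) (\<delta> * card V))"
  using assms
proof (induction r rule: nat_induct_at_least)
  case base
  show ?case
  proof (intro allI impI)
    fix \<beta> B :: real assume \<beta>: "0 < \<beta>" and "1 \<le> B"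
    \<comment> \<open>For uniformity 1 an independent set avoids every vertex that forms an edge:
      all of \<Union>H is deleted, with an empty fingerprint. One edge forces D \<ge> 1, so \<beta>
      D N edges are at least \<beta> N vertices.\<close>
    have "\<exists>f. fingerprints V H f (1 * \<tau> * card V) (\<beta> * card V)"
      if as: "finite V" "uniform_hypergraph 1 V H" "degrees_bounded V H D \<tau>" "0 < D" "0 < \<tau>"
        "1 \<le> \<tau> * card V" "\<beta> * D * card V \<le> card H"
      for V :: "'a set" and H D \<tau>
    proof (intro exI)
      have single: "\<exists>v\<in>V. e = {v}" if "e \<in> H" for e
        using as(2) that by (auto simp: uniform_hypergraph_def card_1_singleton_iff)
      have cN: "card V > 0" using as(6) by (cases "card V = 0") auto
      have finH: "finite H" using uniform_finite[OF as(1,2)] .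
      have "card H > 0" using as(4,7) \<beta> cN by (smt (verit) of_nat_0_less_iff mult_pos_pos)
      then obtain e where e: "e \<in> H" by (metis card.empty equals0I less_irrefl)
      then obtain v where v: "v \<in> V" "e = {v}" using single by blast
      have "deg H {v} > 0" unfolding deg_def using finH e v by (subst card_gt_0_iff) auto
      moreover have "real (deg H {v}) \<le> D" using degrees_boundedD[OF as(3), of "{v}"] v by simp
      ultimately have "1 \<le> D" by linarith
      have "(\<Union>H) = the_elem ` H" using single by (force simp: image_iff)
      moreover have "inj_on the_elem H" using single by (intro inj_onI) (metis the_elem_eq)
      ultimately have cU: "card (\<Union>H) = card H" by (simp add: card_image)
      have "\<beta> * 1 * card V \<le> \<beta> * D * card V"
        using \<open>1 \<le> D\<close> \<beta> by (intro mult_right_mono mult_left_mono) auto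
      hence "\<beta> * card V \<le> card (\<Union>H)" using as(7) cU by linarith
      moreover have "\<Union>H \<subseteq> \<Union>H - I" if "independent H I" for I
        using that single by (force simp: independent_def)
      ultimately show "fingerprints V H (\<lambda>_. \<Union>H) (1 * \<tau> * card V) (\<beta> * card V)"
        unfolding fingerprints_def recovered_def using as(5) by (auto intro!: exI[of _ "{}"])
    qed
    thus "\<exists>K>0::real. \<exists>\<delta>>0::real. \<exists>\<tau>0>0::real. \<forall>(V :: 'a set) H D \<tau>.
      finite V \<and> uniform_hypergraph 1 V H \<and> degrees_bounded V H D \<tau> \<and> 0 < D \<and> 0 < \<tau> \<and> \<tau> \<le> \<tau>0 \<and>
      1 \<le> \<tau> * card V \<and> D * \<tau> ^ (1 - 1) \<le> B \<and> \<beta> * D * card V \<le> card H \<longrightarrow>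
      (\<exists>f. fingerprints V H f (K * \<tau> * card V) (\<delta> * card V))"
      apply (rule_tac exI[of _ 1])
      apply (rule conjI[OF zero_less_one], rule_tac exI[of _ \<beta>])
      apply (rule conjI[OF \<beta>], rule_tac exI[of _ 1])
      by auto
  qed
next
  case (Suc r)
  show ?case
  proof (intro allI impI)
    fix \<beta> B :: real assume \<beta>: "0 < \<beta>" and B: "1 \<le> B"
    \<comment> \<open>With N = \<open>card V\<close>, \<open>\<gamma>\<close> makes B 2^(Suc r) lim
      / \<tau> equal to \<beta> D N / 2, so at most half of the guaranteed edges die;
      \<open>\<eta>\<close> limits the incidences at unprocessed vertices to \<beta> D N /
      8.\<close>
    define \<gamma> where "\<gamma> = \<beta> / (2 * B * 2 ^ Suc r)"
    define \<eta> where "\<eta> = \<beta> / 8"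
    have \<gamma>: "0 < \<gamma>" and \<eta>: "0 < \<eta>" using \<beta> B by (auto simp: \<gamma>_def \<eta>_def)
    \<comment> \<open>In the dense case \<open>L\<close> has at least lim = (\<gamma> / 2) (2 D
      \<tau>) N edges, and 2 D \<tau> \<tau>^(r-1) \<le> 2 B.\<close>
    from Suc.IH[rule_format, of "\<gamma> / 2" "2 * B"] \<gamma> B
    obtain K' \<delta>' \<tau>0' :: real where pos': "0 < K'" "0 < \<delta>'" "0 < \<tau>0'"
      and IH: "\<And>(V :: 'a set) H D \<tau>. finite V \<and> uniform_hypergraph r V H \<and> degrees_bounded V H D \<tau> \<and>
          0 < D \<and> 0 < \<tau> \<and> \<tau> \<le> \<tau>0' \<and> 1 \<le> \<tau> * card V \<and> D * \<tau> ^ (r - 1) \<le> 2 * B \<and>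
          \<gamma> / 2 * D * card V \<le> card H \<Longrightarrow>
          \<exists>f. fingerprints V H f (K' * \<tau> * card V) (\<delta>' * card V)"
      by auto
    define K1 where "K1 = (\<gamma> + 1) / \<eta>"
    have K1: "0 < K1" using \<gamma> \<eta> by (simp add: K1_def)
    have "\<exists>f. fingerprints V H f ((K1 + K') * \<tau> * card V) (min \<delta>' (\<beta> / 4) * card V)"
      if as: "finite V" "uniform_hypergraph (Suc r) V H" "degrees_bounded V H D \<tau>" "0 < D" "0 < \<tau>"
        "\<tau> \<le> min \<tau>0' (\<beta> / (8 * K1))" "1 \<le> \<tau> * card V" "D * \<tau> ^ r \<le> B" "\<beta> * D * card V \<le> card H"
      for V :: "'a set" and H D \<tau>
    proof -
      define lim where "lim = \<gamma> * \<tau> * D * card V"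
      interpret link_process V H "Suc r" D \<tau> B \<eta> lim
        by unfold_locales (use as \<eta> B Suc.hyps in auto)
      obtain vs where vs: "set vs = V" using as(1) finite_list by blast
      \<comment> \<open>The choice depends on \<open>L\<close> alone, so it is known to anyone who
        can replay the run; \<open>f\<close> below imitates the run with an arbitrary
        \<open>S\<close> in place of \<open>I\<close>.\<close>
      define g where "g L = (SOME f. fingerprints V L f (K' * \<tau> * card V) (\<delta>' * card V))" for L
      define f where "f S = (if real (card (run S vs {})) < lim then removed S vs {} else g (run S vs {}) S)" for S
      have "recovered I ((K1 + K') * \<tau> * card V) f \<and> f I \<subseteq> \<Union>H - I \<and>
          min \<delta>' (\<beta> / 4) * card V \<le> card (f I)"
        if I: "I \<subseteq> V" "independent H I" for I
      proof -
        define S1 where "S1 = picked I vs {}"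
        define R where "R = removed I vs {}"
        define L where "L = run I vs {}"
        have gL: "good I L" unfolding L_def by (intro good_run good_empty)
        have lim0: "0 \<le> lim" using \<gamma> as by (simp add: lim_def)
        have L_le: "card L \<le> lim + D"
          unfolding L_def by (rule card_run[OF good_empty]) (use lim0 as in simp)
        have "\<eta> * D * card S1 \<le> card L"
          using card_picked[OF good_empty, of I vs] by (simp add: S1_def L_def)
        also have "\<dots> \<le> lim + D" by (rule L_le)
        also have "\<dots> = D * (\<gamma> * (\<tau> * card V) + 1)" by (simp add: lim_def algebra_simps)
        \<comment> \<open>1 \<le> \<tau> N absorbs the overshoot of one link.\<close>
        also have "\<dots> \<le> D * (\<gamma> * (\<tau> * card V) + \<tau> * card V)"
          using as by (intro mult_left_mono) auto
        finally have "D * (\<eta> * card S1) \<le> D * ((\<gamma> + 1) * (\<tau> * card V))"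
          by (simp add: algebra_simps)
        hence "\<eta> * card S1 \<le> (\<gamma> + 1) * (\<tau> * card V)" using as(4) by simp
        hence S1_le: "card S1 \<le> K1 * \<tau> * card V"
          using \<eta> by (simp add: K1_def field_simps)
        have S1I: "S1 \<subseteq> I" using picked_subset[of I vs "{}"] by (auto simp: S1_def)
        have cong: "run S vs {} = L \<and> removed S vs {} = R" if "S1 \<subseteq> S" "S \<subseteq> I" for S
          using run_cong[of I vs "{}" S] that by (auto simp: S1_def L_def R_def)
        show ?thesis
        proof (cases "real (card L) < lim")
          case True
          have R: "R \<subseteq> \<Union>H - I" using removed_subset[of I vs "{}"] by (simp add: R_def)
          let ?d = "\<lambda>v. card {e \<in> alive L. v \<in> e}"
          have "\<beta> * D * card V - B * 2 ^ Suc r * lim / \<tau> \<le> real (card H) - B * 2 ^ Suc r * card L / \<tau>"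
            using True B as by (intro diff_mono divide_right_mono mult_left_mono) auto
          also have "\<dots> \<le> card (alive L)" using card_dead[OF gL] by simp
          also have "B * 2 ^ Suc r * lim / \<tau> = \<beta> * D * card V / 2"
            using as B by (simp add: lim_def \<gamma>_def)
          finally have "\<beta> * D * card V / 2 \<le> card (alive L)" by linarith
          also have "card (alive L) \<le> (\<Sum>e\<in>alive L. card e)"
          proof -
            have "card e \<ge> 1" if "e \<in> alive L" for e using that alive_subset[of L] card_edge[of e] by auto
            thus ?thesis using sum_mono[of "alive L" "\<lambda>_. 1" card] by simp
          qed
          also have "\<dots> = (\<Sum>v\<in>V. ?d v)"
            using as(1) finite_alive[of L] alive_subset[of L] edge_subset by (intro sum_card_incident[symmetric]) blast+
          also have "real \<dots> = (\<Sum>v\<in>V. real (?d v))" by simp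
          also have "\<dots> \<le> (\<Sum>v\<in>V. (if v \<in> R \<union> S1 then D else 0) + \<eta> * D)"
          proof (rule sum_mono)
            fix v assume v: "v \<in> V"
            show "real (?d v) \<le> (if v \<in> R \<union> S1 then D else 0) + \<eta> * D"
            proof (cases "v \<in> R \<union> S1")
              case True
              thus ?thesis using card_alive_incident_le[of L v] \<eta> as(4) by (simp add: add_increasing2)
            next
              case False
              thus ?thesis using unprocessed_low[of "{}" I vs v] True v vs
                by (simp add: L_def R_def S1_def)
            qed
          qed
          also have "\<dots> = card (R \<union> S1) * D + \<eta> * D * card V"
          proof -
            have "\<Union>H \<subseteq> V" using edge_subset by blast
            hence "V \<inter> {v. v \<in> R \<union> S1} = R \<union> S1" using R S1I I by auto
            thus ?thesis using as(1) by (simp add: sum.distrib sum.If_cases)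
          qed
          also have "\<dots> \<le> (real (card R) + K1 * \<tau> * card V) * D + \<eta> * D * card V"
          proof -
            have "card (R \<union> S1) \<le> card R + card S1" by (rule card_Un_le)
            hence "real (card (R \<union> S1)) \<le> card R + K1 * \<tau> * card V" using S1_le by linarith
            thus ?thesis using as(4) by (intro add_right_mono mult_right_mono) auto
          qed
          \<comment> \<open>The upper bound on \<open>\<tau>\<close> gives K1 \<tau> \<le> \<beta> /
            8. Of \<beta> / 2, picked and unprocessed vertices use at most \<beta> / 8 each, which
            leaves \<beta> / 4 for \<open>R\<close>.\<close>
          also have "\<dots> \<le> (real (card R) + \<beta> / 8 * card V) * D + \<eta> * D * card V"
          proof -
            have "K1 * \<tau> \<le> \<beta> / 8" using as(6) K1 by (simp add: field_simps)
            thus ?thesis using as(4) by (intro add_right_mono mult_right_mono add_left_mono) auto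
          qed
          finally have "D * (\<beta> / 4 * card V) \<le> D * card R" by (simp add: \<eta>_def algebra_simps)
          hence "\<beta> / 4 * card V \<le> card R" using as(4) by simp
          moreover have "min \<delta>' (\<beta> / 4) * card V \<le> \<beta> / 4 * card V" by (intro mult_right_mono) auto
          ultimately have "min \<delta>' (\<beta> / 4) * card V \<le> card R" by linarith
          moreover have "card S1 \<le> (K1 + K') * \<tau> * card V"
          proof -
            have "K1 * \<tau> * card V \<le> (K1 + K') * \<tau> * card V"
              using pos' as by (intro mult_right_mono) auto
            thus ?thesis using S1_le by linarith
          qed
          moreover have "f S = R" if "S1 \<subseteq> S" "S \<subseteq> I" for S
            using cong[OF that] True by (simp add: f_def)
          ultimately show ?thesis
            using S1I R unfolding recovered_def by auto
        next
          case False
          have "\<exists>f. fingerprints V L f (K' * \<tau> * card V) (\<delta>' * card V)"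
          proof (rule IH[of V L "2 * D * \<tau>"], intro conjI)
            show "uniform_hypergraph r V L" using gL by (simp add: good_def)
            show "degrees_bounded V L (2 * D * \<tau>) \<tau>"
              unfolding degrees_bounded_def
            proof (intro allI impI)
              fix T assume T: "T \<subseteq> V \<and> T \<noteq> {}"
              hence "finite T" using as(1) finite_subset by auto
              hence "card T > 0" using T by (simp add: card_gt_0_iff)
              hence "\<tau> ^ card T = \<tau> * \<tau> ^ (card T - 1)" by (cases "card T") auto
              moreover have "real (deg L T) \<le> 2 * D * \<tau> ^ card T" using gL T by (simp add: good_def)
              ultimately show "real (deg L T) \<le> 2 * D * \<tau> * \<tau> ^ (card T - 1)" by simp
            qed
            have "\<tau> ^ r = \<tau> * \<tau> ^ (r - 1)" using Suc.hyps by (cases r) auto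
            thus "2 * D * \<tau> * \<tau> ^ (r - 1) \<le> 2 * B" using as(8) by (simp add: mult_ac)
            show "\<gamma> / 2 * (2 * D * \<tau>) * card V \<le> card L" using False by (simp add: lim_def mult_ac)
          qed (use as in auto)
          hence "fingerprints V L (g L) (K' * \<tau> * card V) (\<delta>' * card V)"
            unfolding g_def by (rule someI_ex)
          moreover have "independent L I"
            unfolding independent_def
          proof (intro ballI notI)
            fix e assume e: "e \<in> L" "e \<subseteq> I"
            then obtain v where "v \<in> I" "insert v e \<in> H" using gL by (auto simp: good_def)
            thus False using I(2) e(2) by (auto simp: independent_def)
          qed
          ultimately have gI: "g L I \<subseteq> \<Union>L - I" "\<delta>' * card V \<le> card (g L I)"
            and "recovered I (K' * \<tau> * card V) (g L)"
            using I(1) unfolding fingerprints_def by blast+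
          then obtain S2 where S2: "S2 \<subseteq> I" "card S2 \<le> K' * \<tau> * card V"
            "\<And>S. S2 \<subseteq> S \<and> S \<subseteq> I \<Longrightarrow> g L S = g L I"
            unfolding recovered_def by blast
          have "card (S1 \<union> S2) \<le> card S1 + card S2" by (rule card_Un_le)
          hence "real (card (S1 \<union> S2)) \<le> (K1 + K') * \<tau> * card V"
            using S1_le S2(2) by (simp add: algebra_simps)
          moreover have fS: "f S = g L I" if "S1 \<union> S2 \<subseteq> S" "S \<subseteq> I" for S
            using that S2(3)[of S] cong[of S] False by (simp add: f_def)
          moreover have "f I = g L I" using fS[of I] S1I S2(1) by simp
          ultimately have "recovered I ((K1 + K') * \<tau> * card V) f"
            unfolding recovered_def using S1I S2(1) by (intro exI[of _ "S1 \<union> S2"]) auto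
          moreover have "min \<delta>' (\<beta> / 4) * card V \<le> \<delta>' * card V" by (intro mult_right_mono) auto
          moreover have "\<Union>L \<subseteq> \<Union>H" using gL unfolding good_def by blast
          ultimately show ?thesis using gI \<open>f I = g L I\<close> by auto
        qed
      qed
      thus ?thesis unfolding fingerprints_def by blast
    qed
    moreover have "0 < K1 + K'" "0 < min \<delta>' (\<beta> / 4)" "0 < min \<tau>0' (\<beta> / (8 * K1))"
      using K1 pos' \<beta> by auto
    ultimately show "\<exists>K>0::real. \<exists>\<delta>>0::real. \<exists>\<tau>0>0::real. \<forall>(V :: 'a set) H D \<tau>.
      finite V \<and> uniform_hypergraph (Suc r) V H \<and> degrees_bounded V H D \<tau> \<and> 0 < D \<and> 0 < \<tau> \<and> \<tau> \<le> \<tau>0 \<and>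
      1 \<le> \<tau> * card V \<and> D * \<tau> ^ (Suc r - 1) \<le> B \<and> \<beta> * D * card V \<le> card H \<longrightarrow>
      (\<exists>f. fingerprints V H f (K * \<tau> * card V) (\<delta> * card V))"
      apply (rule_tac exI[of _ "K1 + K'"])
      apply (rule conjI, assumption, rule_tac exI[of _ "min \<delta>' (\<beta> / 4)"])
      apply (rule conjI, assumption, rule_tac exI[of _ "min \<tau>0' (\<beta> / (8 * K1))"])
      apply (rule conjI, assumption)
      by auto
  qed
qed

text \<open>The order of quantifiers carries the content: one \<open>F\<close> serves all
  \<open>I\<close>, so there are at most as many containers as small sets \<open>S\<close>.\<close>

definition has_containers :: "'a set \<Rightarrow> ('a set \<Rightarrow> bool) \<Rightarrow> real \<Rightarrow> real \<Rightarrow> bool" where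
  "has_containers V P s a \<longleftrightarrow> (\<exists>F. \<forall>I\<subseteq>V. P I \<longrightarrow>
     (\<exists>S\<subseteq>I. real (card S) \<le> s \<and> I \<subseteq> F S \<and> F S \<subseteq> V \<and> real (card (F S)) \<le> a))"

lemma has_containers_mono:
  assumes "has_containers V P s a" "\<And>I. P' I \<Longrightarrow> P I" "s \<le> s'"
  shows "has_containers V P' s' a"
  using assms unfolding has_containers_def by (meson order_trans)

text \<open>As long as a container exceeds \<alpha> N, the edges inside it are numerous by
  supersaturation and inherit the degree bounds on the same vertex set. So another round with the
  same constants applies and deletes \<delta> N vertices; a bounded number of rounds
  suffices.\<close>

theorem hypergraph_container:
  fixes \<beta> B :: real
  assumes "1 \<le> r" "0 < \<beta>" "1 \<le> B"
  obtains K \<tau>0 :: real where "0 < K" "0 < \<tau>0"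
    "\<And>(V :: 'a set) H (D :: real) (\<tau> :: real) (\<alpha> :: real). finite V \<Longrightarrow> uniform_hypergraph r V H \<Longrightarrow> degrees_bounded V H D \<tau> \<Longrightarrow>
      0 < D \<Longrightarrow> 0 < \<tau> \<Longrightarrow> \<tau> \<le> \<tau>0 \<Longrightarrow> 1 \<le> \<tau> * card V \<Longrightarrow> D * \<tau> ^ (r - 1) \<le> B \<Longrightarrow>
      (\<And>X. X \<subseteq> V \<Longrightarrow> \<alpha> * card V \<le> card X \<Longrightarrow> \<beta> * D * card V \<le> card {e \<in> H. e \<subseteq> X}) \<Longrightarrow>
      has_containers V (independent H) (K * \<tau> * card V) (\<alpha> * card V)"
proof -
  from container_round[OF assms(1), rule_format, OF assms(2,3)]
  obtain K \<delta> \<tau>0 :: real where pos: "0 < K" "0 < \<delta>" "0 < \<tau>0"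
    and round: "\<And>(V :: 'a set) H D \<tau>. finite V \<and> uniform_hypergraph r V H \<and> degrees_bounded V H D \<tau> \<and>
          0 < D \<and> 0 < \<tau> \<and> \<tau> \<le> \<tau>0 \<and> 1 \<le> \<tau> * card V \<and> D * \<tau> ^ (r - 1) \<le> B \<and>
          \<beta> * D * card V \<le> card H \<Longrightarrow> \<exists>f. fingerprints V H f (K * \<tau> * card V) (\<delta> * card V)"
    by blast
  \<comment> \<open>More than 1/\<delta> rounds: N - m \<delta> N is then negative, and only the
    alternative \<alpha> N is left.\<close>
  define m where "m = nat \<lceil>1 / \<delta>\<rceil> + 1"
  have m: "1 < real m * \<delta>" "m \<ge> 1"
  proof -
    have "1 / \<delta> < real m" unfolding m_def by linarith
    thus "1 < real m * \<delta>" using pos(2) by (simp add: field_simps)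
  qed (simp add: m_def)
  have "has_containers V (independent H) (m * K * \<tau> * card V) (\<alpha> * card V)"
    if as: "finite V" "uniform_hypergraph r V H" "degrees_bounded V H D \<tau>" "0 < D" "0 < \<tau>"
      "\<tau> \<le> \<tau>0" "1 \<le> \<tau> * card V" "D * \<tau> ^ (r - 1) \<le> B"
      and sup: "\<And>X. X \<subseteq> V \<Longrightarrow> \<alpha> * card V \<le> card X \<Longrightarrow> \<beta> * D * card V \<le> card {e \<in> H. e \<subseteq> X}"
    for V :: "'a set" and H and D \<tau> \<alpha> :: real
  proof -
    define N where "N = real (card V)"
    have finH: "finite H" using uniform_finite[OF as(1,2)] .
    have N0: "0 < N" using as(5,7) by (cases "card V = 0") (auto simp: N_def)
    have iter: "\<exists>F. \<forall>I\<subseteq>V. independent H I \<longrightarrow> recovered I (t * (K * \<tau> * N)) F \<and>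
        I \<subseteq> F I \<and> F I \<subseteq> V \<and> (card (F I) \<le> \<alpha> * N \<or> card (F I) \<le> N - t * (\<delta> * N))" for t :: nat
    proof (induction t)
      case 0
      show ?case
        by (intro exI[of _ "\<lambda>_. V"] allI impI) (auto simp: N_def recovered_def)
    next
      case (Suc t)
      then obtain F where F: "\<And>I. I \<subseteq> V \<Longrightarrow> independent H I \<Longrightarrow> recovered I (t * (K * \<tau> * N)) F \<and>
        I \<subseteq> F I \<and> F I \<subseteq> V \<and> (card (F I) \<le> \<alpha> * N \<or> card (F I) \<le> N - t * (\<delta> * N))" by blast
      define g where "g X = (SOME f. fingerprints V {e \<in> H. e \<subseteq> X} f (K * \<tau> * N) (\<delta> * N))" for X
      \<comment> \<open>The function for the next round is chosen from the current container alone,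
        which the old fingerprint determines; so the union of the two fingerprints recovers the new
        container.\<close>
      define F' where "F' S = (if card (F S) \<le> \<alpha> * N then F S else F S - g (F S) S)" for S
      have ex: "\<exists>f. fingerprints V {e \<in> H. e \<subseteq> X} f (K * \<tau> * N) (\<delta> * N)"
        if X: "X \<subseteq> V" "\<not> card X \<le> \<alpha> * N" for X
        unfolding N_def
      proof (rule round[of V "{e \<in> H. e \<subseteq> X}" D], intro conjI)
        show "uniform_hypergraph r V {e \<in> H. e \<subseteq> X}" using as(2) by (simp add: uniform_hypergraph_def)
        show "degrees_bounded V {e \<in> H. e \<subseteq> X} D \<tau>"
          by (rule degrees_bounded_subset[OF as(3) finH]) auto
        show "\<beta> * D * card V \<le> card {e \<in> H. e \<subseteq> X}" using X by (intro sup) (auto simp: N_def)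
      qed (use as in auto)
      have g: "fingerprints V {e \<in> H. e \<subseteq> X} (g X) (K * \<tau> * N) (\<delta> * N)"
        if X: "X \<subseteq> V" "\<not> card X \<le> \<alpha> * N" for X
        using someI_ex[OF ex[OF X]] unfolding g_def .
      show ?case
      proof (intro exI[of _ F'] allI impI)
        fix I assume I: "I \<subseteq> V" "independent H I"
        have KN: "0 \<le> K * \<tau> * N" using pos as N0 by simp
        from F[OF I] have rec1: "recovered I (t * (K * \<tau> * N)) F"
          and FI: "I \<subseteq> F I" "F I \<subseteq> V" "card (F I) \<le> \<alpha> * N \<or> card (F I) \<le> N - t * (\<delta> * N)"
          by auto
        from rec1 obtain S1 where S1: "S1 \<subseteq> I" "card S1 \<le> t * (K * \<tau> * N)"
          "\<And>S. S1 \<subseteq> S \<Longrightarrow> S \<subseteq> I \<Longrightarrow> F S = F I"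
          unfolding recovered_def by metis
        show "recovered I (Suc t * (K * \<tau> * N)) F' \<and> I \<subseteq> F' I \<and> F' I \<subseteq> V \<and>
          (card (F' I) \<le> \<alpha> * N \<or> card (F' I) \<le> N - Suc t * (\<delta> * N))"
        proof (cases "card (F I) \<le> \<alpha> * N")
          case True
          have "recovered I (Suc t * (K * \<tau> * N)) F'"
            unfolding recovered_def
          proof (intro exI[of _ S1] conjI allI impI)
            show "real (card S1) \<le> Suc t * (K * \<tau> * N)" using S1(2) KN by (simp add: algebra_simps)
          next
            fix S assume "S1 \<subseteq> S \<and> S \<subseteq> I"
            hence "F S = F I" by (intro S1(3)) auto
            thus "F' S = F' I" using True unfolding F'_def by simp
          qed (rule S1(1))
          thus ?thesis using True FI by (simp add: F'_def)
        next
          case False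
          let ?H = "{e \<in> H. e \<subseteq> F I}"
          have "independent ?H I" using I(2) by (simp add: independent_def)
          hence gI: "g (F I) I \<subseteq> \<Union>?H - I" "\<delta> * N \<le> card (g (F I) I)"
            and "recovered I (K * \<tau> * N) (g (F I))"
            using g[OF FI(2) False] I(1) unfolding fingerprints_def by blast+
          then obtain S2 where S2: "S2 \<subseteq> I" "card S2 \<le> K * \<tau> * N"
            "\<And>S. S2 \<subseteq> S \<Longrightarrow> S \<subseteq> I \<Longrightarrow> g (F I) S = g (F I) I"
            unfolding recovered_def by metis
          have F'S: "F' S = F I - g (F I) I" if "S1 \<union> S2 \<subseteq> S" "S \<subseteq> I" for S
          proof -
            have sub: "S1 \<subseteq> S" "S2 \<subseteq> S" using that(1) by auto
            have "F S = F I" "g (F I) S = g (F I) I"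
              using S1(3)[OF sub(1) that(2)] S2(3)[OF sub(2) that(2)] .
            thus ?thesis using False unfolding F'_def by simp
          qed
          have F'I: "F' I = F I - g (F I) I" using F'S[of I] S1(1) S2(1) by simp
          have "card (S1 \<union> S2) \<le> card S1 + card S2" by (rule card_Un_le)
          hence cS: "real (card (S1 \<union> S2)) \<le> Suc t * (K * \<tau> * N)"
            using S1(2) S2(2) by (simp add: algebra_simps)
          have rec: "recovered I (Suc t * (K * \<tau> * N)) F'"
            unfolding recovered_def
          proof (intro exI[of _ "S1 \<union> S2"] conjI allI impI)
            fix S assume "S1 \<union> S2 \<subseteq> S \<and> S \<subseteq> I"
            thus "F' S = F' I" using F'S[of S] F'I by simp
          next
            show "S1 \<union> S2 \<subseteq> I" using S1(1) S2(1) by simp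
          qed (rule cS)
          have gF: "g (F I) I \<subseteq> F I" using gI(1) by blast
          have "card (F' I) = card (F I) - card (g (F I) I)"
            unfolding F'I using gF finite_subset[OF FI(2) as(1)] by (intro card_Diff_subset) (auto intro: finite_subset)
          moreover have "card (g (F I) I) \<le> card (F I)"
            using gF finite_subset[OF FI(2) as(1)] by (rule card_mono[rotated])
          ultimately have "real (card (F' I)) = real (card (F I)) - real (card (g (F I) I))"
            by (simp add: of_nat_diff)
          hence "card (F' I) \<le> N - Suc t * (\<delta> * N)"
            using FI(3) False gI(2) by (simp add: algebra_simps)
          thus ?thesis using rec FI gI(1) F'I by blast
        qed
      qed
    qed
    from iter[of m] obtain F where F: "\<And>I. I \<subseteq> V \<Longrightarrow> independent H I \<Longrightarrow>
      recovered I (m * (K * \<tau> * N)) F \<and> I \<subseteq> F I \<and> F I \<subseteq> V \<and>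
      (card (F I) \<le> \<alpha> * N \<or> card (F I) \<le> N - m * (\<delta> * N))" by blast
    have "N * 1 < N * (m * \<delta>)" using N0 m by (intro mult_strict_left_mono) auto
    hence neg: "N - m * (\<delta> * N) < 0" by (simp add: mult_ac)
    show ?thesis
      unfolding has_containers_def
    proof (intro exI[of _ F] allI impI)
      fix I assume "I \<subseteq> V" "independent H I"
      note FI = F[OF this]
      hence "recovered I (m * (K * \<tau> * N)) F" by (rule conjunct1)
      then obtain S where S: "S \<subseteq> I" "card S \<le> m * (K * \<tau> * N)" "F S = F I"
        unfolding recovered_def by (metis subset_refl)
      have "card (F I) \<le> \<alpha> * N" using FI neg by linarith
      moreover have "card S \<le> m * K * \<tau> * card V" using S(2) by (simp add: N_def mult_ac)
      ultimately show "\<exists>S\<subseteq>I. card S \<le> m * K * \<tau> * card V \<and> I \<subseteq> F S \<and> F S \<subseteq> V \<and> card (F S) \<le> \<alpha> * card V"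
        using S(1) FI unfolding N_def by (intro exI[of _ S] conjI; simp only: S(3))
    qed
  qed
  thus ?thesis using that[of "m * K" \<tau>0] pos m by auto
qed

section \<open>Containers and random subsets\<close>

definition random_subset :: "'a set \<Rightarrow> real \<Rightarrow> 'a set pmf" where
  "random_subset E q = map_pmf (\<lambda>f. {e \<in> E. f e}) (Pi_pmf E False (\<lambda>_. bernoulli_pmf q))"

lemma sum_Pow_power_card:
  fixes y :: real
  assumes "finite A"
  shows "(\<Sum>S\<in>Pow A. y ^ card S) = (1 + y) ^ card A"
  using prod_add[OF assms, of "\<lambda>_. y" "\<lambda>_. 1"] by (simp add: add.commute)

text \<open>Exponential Markov inequality for the coins in \<open>W\<close>, combined with the
  indicator of S \<subseteq> G. As \<open>S\<close> and \<open>W\<close> are disjoint, the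
  expectation factors over single coins with weights \<open>h\<close>. The factor q^|S| is what pays
  for the later sum over all \<open>S\<close>.\<close>

lemma random_subset_tail:
  fixes q l t :: real
  assumes "finite E" "0 \<le> q" "q \<le> 1" "0 \<le> l" "S \<subseteq> E" "W \<subseteq> E" "S \<inter> W = {}"
  shows "measure_pmf.prob (random_subset E q) {G. S \<subseteq> G \<and> t \<le> card (G \<inter> W)}
    \<le> q ^ card S * exp (q * (exp l - 1) * card W - l * t)"
proof -
  define h :: "'a \<Rightarrow> bool \<Rightarrow> real" where
    "h e b = (if e \<in> S then (if b then 1 else 0) else if e \<in> W then (if b then exp l else 1) else 1)" for e b
  let ?P = "Pi_pmf E False (\<lambda>_. bernoulli_pmf q)"
  let ?G = "\<lambda>f. {e \<in> E. f e}"
  have h0: "h e b \<ge> 0" for e b by (simp add: h_def)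
  have int_h: "integrable (measure_pmf ?P) (\<lambda>f. \<Prod>e\<in>E. h e (f e))"
    by (intro integrable_prod_Pi_pmf assms(1) integrable_measure_pmf_finite) simp
  have prod_h: "(\<Prod>e\<in>E. h e (f e)) = (if S \<subseteq> ?G f then exp l ^ card (?G f \<inter> W) else 0)" for f
  proof (cases "S \<subseteq> ?G f")
    case True
    have "(\<Prod>e\<in>E. h e (f e)) = (\<Prod>e\<in>E. if e \<in> ?G f \<inter> W then exp l else 1)"
      using True assms(7) by (intro prod.cong) (auto simp: h_def)
    also have "\<dots> = exp l ^ card (E \<inter> (?G f \<inter> W))"
      using assms(1) by (subst prod.If_cases) (auto intro!: arg_cong[where f = "\<lambda>A. exp l ^ card A"])
    also have "E \<inter> (?G f \<inter> W) = ?G f \<inter> W" by auto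
    finally show ?thesis using True by simp
  next
    case False
    then obtain e where "e \<in> S" "e \<in> E" "\<not> f e" using assms(5) by blast
    hence "h e (f e) = 0" "e \<in> E" by (auto simp: h_def)
    hence "(\<Prod>e\<in>E. h e (f e)) = 0" using assms(1) by (intro prod_zero) auto
    thus ?thesis using False by simp
  qed
  have "measure_pmf.prob (random_subset E q) {G. S \<subseteq> G \<and> t \<le> card (G \<inter> W)}
      = measure_pmf.prob ?P {f. S \<subseteq> ?G f \<and> t \<le> card (?G f \<inter> W)}"
    by (simp add: random_subset_def vimage_def)
  also have "\<dots> = measure_pmf.expectation ?P (indicator {f. S \<subseteq> ?G f \<and> t \<le> card (?G f \<inter> W)})"
    by simp
  also have "\<dots> \<le> measure_pmf.expectation ?P (\<lambda>f. exp (- l * t) * (\<Prod>e\<in>E. h e (f e)))"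
  proof (rule integral_mono)
    fix f
    show "indicator {f. S \<subseteq> ?G f \<and> t \<le> card (?G f \<inter> W)} f \<le> exp (- l * t) * (\<Prod>e\<in>E. h e (f e))"
    proof (cases "S \<subseteq> ?G f \<and> t \<le> card (?G f \<inter> W)")
      case True
      have "1 \<le> exp (- l * t + card (?G f \<inter> W) * l)"
        using mult_left_mono[OF conjunct2[OF True] assms(4)] by (simp add: mult.commute)
      also have "\<dots> = exp (- l * t) * exp l ^ card (?G f \<inter> W)"
        unfolding exp_add exp_of_nat_mult ..
      finally show ?thesis using True by (simp add: prod_h)
    qed (simp add: h0 prod_nonneg)
  next
    show "integrable ?P (indicat_real {f. S \<subseteq> ?G f \<and> t \<le> card (?G f \<inter> W)})"
      by (intro measure_pmf.integrable_const_bound[where B = 1]) (auto simp: indicator_def)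
  qed (use int_h in simp)
  also have "\<dots> = exp (- l * t) * (\<Prod>e\<in>E. measure_pmf.expectation (bernoulli_pmf q) (h e))"
    using h0 by (simp add: expectation_prod_Pi_pmf assms(1) integrable_measure_pmf_finite)
  also have "(\<Prod>e\<in>E. measure_pmf.expectation (bernoulli_pmf q) (h e))
      = (\<Prod>e\<in>E. (if e \<in> S then q else 1) * (if e \<in> W then 1 + q * (exp l - 1) else 1))"
    using assms by (intro prod.cong) (auto simp: h_def algebra_simps)
  also have "\<dots> = q ^ card S * (1 + q * (exp l - 1)) ^ card W"
    using assms by (simp add: prod.distrib prod.If_cases Int_absorb1)
  also have "\<dots> \<le> q ^ card S * exp (q * (exp l - 1) * card W)"
  proof -
    have "(1 + q * (exp l - 1)) ^ card W \<le> exp (q * (exp l - 1)) ^ card W"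
      using assms by (intro power_mono) auto
    thus ?thesis using assms by (intro mult_left_mono) (auto simp: exp_of_nat_mult[symmetric] mult_ac)
  qed
  finally show ?thesis by (simp add: exp_diff exp_minus divide_inverse mult_ac)
qed

text \<open>Union bound over fingerprints. For |S| \<le> s and x \<le> 1 the weight x^(|S| - s) is
  at least 1, so the sum over small \<open>S\<close> is at most x^(-s) (1 + x q)^|E|; this replaces
  estimates of binomial coefficients. Removing \<open>S\<close> from its container, to keep the
  coins disjoint, lowers the threshold to t - s.\<close>

lemma random_subset_containers:
  fixes q l x s t \<alpha> :: real
  assumes "finite E" "0 \<le> q" "q \<le> 1" "0 \<le> l" "0 < x" "x \<le> 1"
  shows "measure_pmf.prob (random_subset E q)
      {G. \<exists>S\<subseteq>G. card S \<le> s \<and> F S \<subseteq> E \<and> card (F S) \<le> \<alpha> * card E \<and> t \<le> card (G \<inter> F S)}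
    \<le> exp (s * ln (1 / x) + x * q * card E + q * (exp l - 1) * \<alpha> * card E - l * (t - s))"
    (is "measure_pmf.prob ?M ?A \<le> _")
proof -
  let ?I = "{S \<in> Pow E. card S \<le> s \<and> F S \<subseteq> E \<and> card (F S) \<le> \<alpha> * card E}"
  let ?B = "\<lambda>S. {G. S \<subseteq> G \<and> t - s \<le> card (G \<inter> (F S - S))}"
  let ?c = "exp (q * (exp l - 1) * \<alpha> * card E - l * (t - s))"
  have fin: "finite ?I" using assms(1) by auto
  have supp: "set_pmf ?M \<subseteq> Pow E" by (auto simp: random_subset_def)
  have "measure_pmf.prob ?M ?A = measure_pmf.prob ?M (?A \<inter> set_pmf ?M)"
    by (simp add: measure_Int_set_pmf)
  also have "\<dots> \<le> measure_pmf.prob ?M (\<Union>S\<in>?I. ?B S)"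
  proof (intro measure_pmf.finite_measure_mono subsetI)
    fix G assume "G \<in> ?A \<inter> set_pmf ?M"
    then obtain S where S: "S \<subseteq> G" "card S \<le> s" "F S \<subseteq> E" "card (F S) \<le> \<alpha> * card E"
      "t \<le> card (G \<inter> F S)" "G \<subseteq> E" using supp by auto
    have fS: "finite S" "finite (F S)" using S assms(1) by (meson finite_subset subset_trans)+
    have "card (G \<inter> F S) \<le> card ((G \<inter> (F S - S)) \<union> S)" using fS by (intro card_mono) auto
    also have "\<dots> \<le> card (G \<inter> (F S - S)) + card S" by (rule card_Un_le)
    finally have "t - s \<le> card (G \<inter> (F S - S))" using S(2,5) by linarith
    thus "G \<in> (\<Union>S\<in>?I. ?B S)" using S by auto
  qed simp
  also have "\<dots> \<le> (\<Sum>S\<in>?I. measure_pmf.prob ?M (?B S))"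
    by (intro measure_pmf.finite_measure_subadditive_finite fin) auto
  also have "\<dots> \<le> (\<Sum>S\<in>?I. x powr (- s) * (x * q) ^ card S * ?c)"
  proof (rule sum_mono)
    fix S assume S: "S \<in> ?I"
    have "measure_pmf.prob ?M (?B S) \<le> q ^ card S * exp (q * (exp l - 1) * card (F S - S) - l * (t - s))"
      using S assms by (intro random_subset_tail) auto
    also have "\<dots> \<le> q ^ card S * ?c"
    proof -
      have "finite (F S)" using S assms(1) by (auto intro: finite_subset)
      hence "card (F S - S) \<le> card (F S)" by (intro card_mono) auto
      hence "real (card (F S - S)) \<le> \<alpha> * card E" using S by (simp add: order_trans[rotated])
      hence "q * (exp l - 1) * card (F S - S) \<le> q * (exp l - 1) * (\<alpha> * card E)"
        using assms by (intro mult_left_mono) auto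
      thus ?thesis using assms by (intro mult_left_mono) (auto simp: mult.assoc)
    qed
    also have "\<dots> \<le> x powr (- s) * (x * q) ^ card S * ?c"
    proof -
      have "x powr s \<le> x powr card S" using S assms by (intro powr_mono') auto
      hence "1 \<le> x powr (- s) * x ^ card S"
        using assms by (simp add: powr_realpow powr_minus field_simps)
      hence "1 * q ^ card S \<le> x powr (- s) * x ^ card S * q ^ card S"
        using assms by (intro mult_right_mono) auto
      from mult_right_mono[OF this, of ?c] show ?thesis by (simp add: power_mult_distrib mult.assoc)
    qed
    finally show "measure_pmf.prob ?M (?B S) \<le> x powr (- s) * (x * q) ^ card S * ?c" .
  qed
  also have "\<dots> \<le> (\<Sum>S\<in>Pow E. x powr (- s) * (x * q) ^ card S * ?c)"
    using assms by (intro sum_mono2) auto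
  also have "\<dots> = x powr (- s) * (1 + x * q) ^ card E * ?c"
    using sum_Pow_power_card[OF assms(1), of "x * q"] by (simp flip: sum_distrib_left sum_distrib_right)
  also have "\<dots> \<le> x powr (- s) * exp (x * q * card E) * ?c"
  proof -
    have "(1 + x * q) ^ card E \<le> exp (x * q) ^ card E" using assms by (intro power_mono) auto
    also have "\<dots> = exp (x * q * card E)" by (simp add: exp_of_nat_mult[symmetric] mult_ac)
    finally show ?thesis by (intro mult_right_mono mult_left_mono) auto
  qed
  also have "x powr (- s) = exp (s * ln (1 / x))"
    using assms by (simp add: powr_def ln_div)
  finally show ?thesis by (simp add: exp_add[symmetric] add_ac add_diff_eq)
qed

text \<open>With l = e/8, the Chernoff exponent of a container of size (1/2 + e/4) N against the
  threshold (1 + e) N q / 2 is at most -(e^2/64) q N. The choice x = e^2/128 gives back half of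
  this; all other terms are of order \<open>s\<close>.\<close>

lemma union_bound_exponent:
  fixes e q s N l :: real
  assumes "0 < e" "e \<le> 1" "0 \<le> q" "0 \<le> N" "0 \<le> s"
  defines "l \<equiv> e / 8"
  shows "s * ln (1 / (e\<^sup>2 / 128)) + e\<^sup>2 / 128 * q * N + q * (exp l - 1) * (1/2 + e/4) * N
      - l * ((1 + e) * N * q / 2 - s)
    \<le> s * (ln (128 / e\<^sup>2) + 1) - e\<^sup>2 / 128 * q * N"
proof -
  have "exp l \<le> 1 + l + l\<^sup>2" using assms by (intro exp_bound) auto
  hence "(exp l - 1) * (1/2 + e/4) \<le> (l + l\<^sup>2) * (1/2 + e/4)" using assms by (intro mult_right_mono) auto
  also have "\<dots> = l * (1/2 + e/4 + l * (1/2 + e/4))" by algebra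
  also have "\<dots> \<le> l * (1/2 + e/4 + l)"
    using assms by (intro mult_left_mono add_left_mono) (auto simp: field_simps)
  also have "\<dots> = l * (1 + e) / 2 - e\<^sup>2 / 64" by (simp add: l_def algebra_simps power2_eq_square)
  finally have "q * N * ((exp l - 1) * (1/2 + e/4)) \<le> q * N * (l * (1 + e) / 2 - e\<^sup>2 / 64)"
    using assms by (intro mult_left_mono) auto
  also have "\<dots> = q * N * (l * (1 + e) / 2) - q * N * (e\<^sup>2 / 64)" by (rule right_diff_distrib)
  finally have "q * N * ((exp l - 1) * (1/2 + e/4)) \<le> q * N * (l * (1 + e) / 2) - q * N * (e\<^sup>2 / 64)" .
  moreover have "q * (exp l - 1) * (1/2 + e/4) * N = q * N * ((exp l - 1) * (1/2 + e/4))"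
    by (simp only: mult_ac)
  moreover have "l * ((1 + e) * N * q / 2 - s) = q * N * (l * (1 + e) / 2) - l * s"
    by (simp add: right_diff_distrib mult_ac)
  moreover have "e\<^sup>2 / 128 * q * N = q * N * (e\<^sup>2 / 64) / 2" by simp
  moreover have "s * (ln (128 / e\<^sup>2) + 1) = s * ln (1 / (e\<^sup>2 / 128)) + s"
    by (simp add: algebra_simps)
  moreover have "l * s \<le> 1 * s" using assms by (intro mult_right_mono) auto
  ultimately show ?thesis by linarith
qed

text \<open>c p n^2 = (c p n^(2/3)) n^(4/3) eventually exceeds (|C| + 2) n^(4/3). One of the two
  spare copies of n^(4/3) absorbs the factor (2n)^(2n+1), the other gives the decay.\<close>

lemma union_bound_tendsto_0:
  fixes p :: "nat \<Rightarrow> real" and c C :: real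
  assumes "filterlim (\<lambda>n. p n * real n powr (2/3)) at_top sequentially" "0 < c"
  shows "(\<lambda>n. real ((2 * n) ^ (2 * n) * (2 * n)) * exp (C * real n powr (4/3) - c * p n * (real n)\<^sup>2)) \<longlonglongrightarrow> 0"
proof (rule tendsto_sandwich[of "\<lambda>_. 0" _ _ "\<lambda>n. exp (- (real n powr (4/3)))"])
  show "\<forall>\<^sub>F n in sequentially. (0::real) \<le> real ((2 * n) ^ (2 * n) * (2 * n)) *
      exp (C * real n powr (4/3) - c * p n * (real n)\<^sup>2)" by simp
  have "\<forall>\<^sub>F n in sequentially. (\<bar>C\<bar> + 2) / c \<le> p n * real n powr (2/3)"
    using assms(1) by (simp add: filterlim_at_top)
  moreover have "\<forall>\<^sub>F n in sequentially. (2 * real n + 1) * ln (2 * real n) \<le> real n powr (4/3)"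
    by real_asymp
  ultimately show "\<forall>\<^sub>F n in sequentially. real ((2 * n) ^ (2 * n) * (2 * n)) *
      exp (C * real n powr (4/3) - c * p n * (real n)\<^sup>2) \<le> exp (- (real n powr (4/3)))"
    using eventually_gt_at_top[of 0]
  proof eventually_elim
    case (elim n)
    let ?m = "real n powr (4/3)"
    have n2: "(real n)\<^sup>2 = real n powr (2/3) * ?m" 
    proof -
      have "real n powr (2/3) * ?m = real n powr 2" unfolding powr_add[symmetric] by simp
      thus ?thesis using elim by simp
    qed
    have "\<bar>C\<bar> + 2 \<le> c * (p n * real n powr (2/3))"
      using elim assms(2) by (simp add: field_simps)
    hence "(\<bar>C\<bar> + 2) * ?m \<le> c * (p n * real n powr (2/3)) * ?m" by (intro mult_right_mono) auto
    also have "\<dots> = c * p n * (real n)\<^sup>2" unfolding n2 by (simp only: mult_ac)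
    finally have "(\<bar>C\<bar> + 2) * ?m \<le> c * p n * (real n)\<^sup>2" .
    moreover have "C * ?m \<le> \<bar>C\<bar> * ?m" by (intro mult_right_mono) auto
    ultimately have *: "C * ?m - c * p n * (real n)\<^sup>2 \<le> - 2 * ?m" by (simp add: algebra_simps)
    have "real ((2 * n) ^ (2 * n) * (2 * n)) = (2 * real n) ^ (2 * n + 1)" by simp
    also have "\<dots> = (2 * real n) powr real (2 * n + 1)"
      by (rule powr_realpow[symmetric]) (use elim in simp)
    also have "\<dots> = exp ((2 * real n + 1) * ln (2 * real n))"
      using elim unfolding powr_def by simp
    also have "\<dots> \<le> exp ?m" using elim by simp
    finally have "real ((2 * n) ^ (2 * n) * (2 * n)) * exp (C * ?m - c * p n * (real n)\<^sup>2) \<le> exp ?m * exp (- 2 * ?m)"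
      using * by (intro mult_mono) auto
    also have "\<dots> = exp (- ?m)" by (simp flip: exp_add)
    finally show ?case .
  qed
  show "(\<lambda>n. exp (- (real n powr (4/3)))) \<longlonglongrightarrow> 0" by real_asymp
qed simp

text \<open>At n the error is 1/(j + 1) for the largest j \<le> n whose threshold \<open>m j\<close>
  has been passed. Every j qualifies eventually, so the error tends to 0, while the probability
  stays above one minus the error.\<close>

lemma diagonal_null_sequence:
  fixes Q :: "nat \<Rightarrow> real \<Rightarrow> real"
  assumes lim: "\<And>e. 0 < e \<Longrightarrow> e \<le> 1 \<Longrightarrow> (\<lambda>n. Q n e) \<longlonglongrightarrow> 1"
    and le1: "\<And>n e. Q n e \<le> 1"
  shows "\<exists>\<epsilon>. (\<forall>n. 0 < \<epsilon> n) \<and> \<epsilon> \<longlonglongrightarrow> 0 \<and> (\<lambda>n. Q n (\<epsilon> n)) \<longlonglongrightarrow> 1"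
proof -
  define u where "u j = inverse (real (Suc j))" for j
  have u: "0 < u j" "u j \<le> 1" for j by (auto simp: u_def field_simps)
  have u0: "u \<longlonglongrightarrow> 0" unfolding u_def by (rule LIMSEQ_inverse_real_of_nat)
  have "\<forall>j. \<exists>m. \<forall>n\<ge>m. 1 - u j < Q n (u j)"
    using order_tendstoD(1)[OF lim[OF u], of "1 - u _"] u by (auto simp: eventually_sequentially)
  then obtain m where m: "\<And>j n. m j \<le> n \<Longrightarrow> 1 - u j < Q n (u j)" by metis
  define J where "J n = {j. j \<le> n \<and> m j \<le> n}" for n
  define k where "k n = (if J n = {} then 0 else Max (J n))" for n
  have finJ: "finite (J n)" for n by (auto simp: J_def)
  have kJ: "j \<le> k n" "k n \<in> J n" if "j \<in> J n" for j n
    using that finJ[of n] Max_in[OF finJ[of n]] by (auto simp: k_def)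
  have k_top: "filterlim k at_top sequentially"
    unfolding filterlim_at_top
  proof
    fix j
    show "\<forall>\<^sub>F n in sequentially. j \<le> k n"
      using eventually_ge_at_top[of "max j (m j)"]
      by eventually_elim (auto intro!: kJ simp: J_def)
  qed
  have uk: "(\<lambda>n. u (k n)) \<longlonglongrightarrow> 0" by (rule filterlim_compose[OF u0 k_top])
  have "(\<lambda>n. Q n (u (k n))) \<longlonglongrightarrow> 1"
  proof (rule tendsto_sandwich[of "\<lambda>n. 1 - u (k n)" _ _ "\<lambda>_. 1"])
    show "\<forall>\<^sub>F n in sequentially. 1 - u (k n) \<le> Q n (u (k n))"
      using eventually_ge_at_top[of "m 0"]
    proof eventually_elim
      case (elim n)
      hence "k n \<in> J n" using kJ(2)[of 0 n] by (auto simp: J_def)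
      thus ?case using m[of "k n" n] by (auto simp: J_def)
    qed
    show "(\<lambda>n. 1 - u (k n)) \<longlonglongrightarrow> 1" using tendsto_diff[OF tendsto_const uk, of 1] by simp
  qed (use le1 in auto)
  thus ?thesis using uk u by (intro exI[of _ "\<lambda>n. u (k n)"]) auto
qed

section \<open>Four-uniform hypergraphs of 4-cycle patterns\<close>

lemma card_le_fibers:
  assumes "finite A" "finite B" "f ` A \<subseteq> B" "\<And>b. b \<in> B \<Longrightarrow> card {a \<in> A. f a = b} \<le> k"
  shows "card A \<le> k * card B"
proof -
  have "A = (\<Union>b\<in>B. {a \<in> A. f a = b})" using assms(3) by auto
  hence "card A \<le> (\<Sum>b\<in>B. card {a \<in> A. f a = b})" using card_UN_le[OF assms(2)] by metis
  also have "\<dots> \<le> (\<Sum>b\<in>B. k)" by (intro sum_mono assms(4))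
  finally show ?thesis by (simp add: mult.commute)
qed

text \<open>
  With \<open>\<alpha> j j'\<close> and \<open>\<beta> j j'\<close> counting the admissible \<open>i\<close> and \<open>i'\<close>, both are at least the number
  \<open>\<gamma> j j'\<close> of indices satisfying all four conditions at once, so the Cauchy-Schwarz inequality
  applied to \<open>\<gamma>\<close> bounds the sum of \<open>\<alpha> j j' * \<beta> j j'\<close> from below.
\<close>
lemma count_quadruples:
  fixes A B C D :: "'i \<Rightarrow> 'j \<Rightarrow> bool"
  assumes "finite I" "finite J"
  shows "(\<Sum>i\<in>I. real (card {j \<in> J. A i j \<and> B i j}) * card {j \<in> J. C i j \<and> D i j})\<^sup>2
    \<le> (real (card J))\<^sup>2 *
      card {(i, i', j, j'). i \<in> I \<and> i' \<in> I \<and> j \<in> J \<and> j' \<in> J \<and> A i j \<and> B i' j \<and> C i' j' \<and> D i j'}"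
proof -
  define \<alpha> where "\<alpha> = (\<lambda>(j, j'). {i \<in> I. A i j \<and> D i j'})"
  define \<beta> where "\<beta> = (\<lambda>(j, j'). {i \<in> I. B i j \<and> C i j'})"
  define \<gamma> where "\<gamma> = (\<lambda>(j, j'). {i \<in> I. A i j \<and> B i j \<and> C i j' \<and> D i j'})"
  define T where "T = {(i, i', j, j'). i \<in> I \<and> i' \<in> I \<and> j \<in> J \<and> j' \<in> J \<and> A i j \<and> B i' j \<and> C i' j' \<and> D i j'}"
  have finJ: "finite (J \<times> J)" using assms by simp
  have "bij_betw (\<lambda>(j, i, i'). (i, i', fst j, snd j)) (SIGMA j:J \<times> J. \<alpha> j \<times> \<beta> j) T"
    by (rule bij_betw_byWitness[where f' = "\<lambda>(i, i', j, j'). ((j, j'), i, i')"])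
       (auto simp: \<alpha>_def \<beta>_def T_def)
  hence "card T = card (SIGMA j:J \<times> J. \<alpha> j \<times> \<beta> j)" by (simp add: bij_betw_same_card)
  also have "\<dots> = (\<Sum>j\<in>J \<times> J. card (\<alpha> j) * card (\<beta> j))"
    using assms by (subst card_SigmaI) (auto simp: card_cartesian_product \<alpha>_def \<beta>_def)
  finally have T: "card T = (\<Sum>j\<in>J \<times> J. card (\<alpha> j) * card (\<beta> j))" .
  have "bij_betw (\<lambda>(i, j, j'). ((j, j'), i))
      (SIGMA i:I. {j \<in> J. A i j \<and> B i j} \<times> {j \<in> J. C i j \<and> D i j}) (SIGMA j:J \<times> J. \<gamma> j)"
    by (rule bij_betw_byWitness[where f' = "\<lambda>((j, j'), i). (i, j, j')"]) (auto simp: \<gamma>_def)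
  hence "card (SIGMA i:I. {j \<in> J. A i j \<and> B i j} \<times> {j \<in> J. C i j \<and> D i j}) = card (SIGMA j:J \<times> J. \<gamma> j)"
    by (rule bij_betw_same_card)
  moreover have "card (SIGMA j:J \<times> J. \<gamma> j) = (\<Sum>j\<in>J \<times> J. card (\<gamma> j))"
    using assms by (intro card_SigmaI) (auto simp: \<gamma>_def)
  moreover have "card (SIGMA i:I. {j \<in> J. A i j \<and> B i j} \<times> {j \<in> J. C i j \<and> D i j}) =
      (\<Sum>i\<in>I. card {j \<in> J. A i j \<and> B i j} * card {j \<in> J. C i j \<and> D i j})"
    using assms by (subst card_SigmaI) (auto simp: card_cartesian_product)
  ultimately have "(\<Sum>i\<in>I. card {j \<in> J. A i j \<and> B i j} * card {j \<in> J. C i j \<and> D i j}) =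
      (\<Sum>j\<in>J \<times> J. card (\<gamma> j))" by linarith
  from arg_cong[OF this, of real]
  have "(\<Sum>i\<in>I. real (card {j \<in> J. A i j \<and> B i j}) * card {j \<in> J. C i j \<and> D i j}) =
      (\<Sum>j\<in>J \<times> J. real (card (\<gamma> j)))" by simp
  moreover have "(\<Sum>j\<in>J \<times> J. real (card (\<gamma> j)))\<^sup>2 \<le> (\<Sum>j\<in>J \<times> J. (real (card (\<gamma> j)))\<^sup>2) * card (J \<times> J)"
    by (rule sum_squared_le_sum_of_squares)
  moreover have "(\<Sum>j\<in>J \<times> J. (real (card (\<gamma> j)))\<^sup>2) \<le> (\<Sum>j\<in>J \<times> J. real (card (\<alpha> j) * card (\<beta> j)))"
  proof (rule sum_mono)
    fix j
    have "card (\<gamma> j) \<le> card (\<alpha> j)" "card (\<gamma> j) \<le> card (\<beta> j)"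
      using assms by (auto simp: \<alpha>_def \<beta>_def \<gamma>_def split: prod.splits intro!: card_mono)
    hence "card (\<gamma> j) * card (\<gamma> j) \<le> card (\<alpha> j) * card (\<beta> j)" by (rule mult_le_mono)
    thus "(real (card (\<gamma> j)))\<^sup>2 \<le> real (card (\<alpha> j) * card (\<beta> j))"
      unfolding power2_eq_square of_nat_mult[symmetric] of_nat_le_iff .
  qed
  hence "(\<Sum>j\<in>J \<times> J. (real (card (\<gamma> j)))\<^sup>2) * card (J \<times> J) \<le> real (card T) * card (J \<times> J)"
    unfolding T of_nat_sum by (intro mult_right_mono) auto
  ultimately have "(\<Sum>i\<in>I. real (card {j \<in> J. A i j \<and> B i j}) * card {j \<in> J. C i j \<and> D i j})\<^sup>2
      \<le> (real (card J))\<^sup>2 * card T"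
    by (simp add: card_cartesian_product power2_eq_square mult_ac)
  thus ?thesis unfolding T_def .
qed

text \<open>
  Hypergraphs whose edges are incidence patterns of a 4-cycle \<open>i j i' j'\<close>: the four slots are
  indexed by its four edges.
\<close>
locale quad_hypergraph =
  fixes n :: nat and V :: "'e set" and sA sB sC sD :: "nat \<Rightarrow> nat \<Rightarrow> 'e"
    and Q :: "(nat \<times> nat \<times> nat \<times> nat) set"
  assumes injA: "inj_on (case_prod sA) ({..<n} \<times> {..<n})"
    and injB: "inj_on (case_prod sB) ({..<n} \<times> {..<n})"
    and injC: "inj_on (case_prod sC) ({..<n} \<times> {..<n})"
    and injD: "inj_on (case_prod sD) ({..<n} \<times> {..<n})"
    and slots: "\<And>i j. i < n \<Longrightarrow> j < n \<Longrightarrow> sA i j \<in> V \<and> sB i j \<in> V \<and> sC i j \<in> V \<and> sD i j \<in> V"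
    and Q_sub: "Q \<subseteq> {..<n} \<times> {..<n} \<times> {..<n} \<times> {..<n}"
    and Q_card: "\<And>i i' j j'. (i, i', j, j') \<in> Q \<Longrightarrow> card {sA i j, sB i' j, sC i' j', sD i j'} = 4"
begin

definition edge :: "nat \<times> nat \<times> nat \<times> nat \<Rightarrow> 'e set" where
  "edge = (\<lambda>(i, i', j, j'). {sA i j, sB i' j, sC i' j', sD i j'})"

definition H :: "'e set set" where "H = edge ` Q"

lemma finQ: "finite Q"
  using Q_sub by (rule finite_subset) simp

lemma uniform: "uniform_hypergraph 4 V H"
  unfolding uniform_hypergraph_def
proof
  fix e assume "e \<in> H"
  then obtain q where q: "q \<in> Q" "e = edge q" by (auto simp: H_def)
  obtain i i' j j' where ij: "q = (i, i', j, j')" by (cases q) auto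
  hence "i < n" "i' < n" "j < n" "j' < n" using Q_sub q(1) by auto
  thus "e \<subseteq> V \<and> card e = 4" using q ij Q_card slots by (auto simp: edge_def)
qed

abbreviation "matching s t \<equiv> {q \<in> Q. s q = t}"

definition "fA = (\<lambda>(i, i', j, j'). sA i j)"
definition "fB = (\<lambda>(i, i', j, j'). sB i' j)"
definition "fC = (\<lambda>(i, i', j, j'). sC i' j')"
definition "fD = (\<lambda>(i, i', j, j'). sD i j')"

lemmas f_defs = fA_def fB_def fC_def fD_def

lemma edge_eq: "edge q = {fA q, fB q, fC q, fD q}"
  by (auto simp: edge_def f_defs split: prod.splits)

lemma QD: "(i, i', j, j') \<in> Q \<Longrightarrow> i < n \<and> i' < n \<and> j < n \<and> j' < n"
  using Q_sub by auto

lemma inj_slot: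
  assumes "inj_on (case_prod s) ({..<n} \<times> {..<n})" "i < n" "j < n" "k < n" "l < n"
  shows "s i j = s k l \<longleftrightarrow> i = k \<and> j = l"
  using inj_on_eq_iff[OF assms(1), of "(i, j)" "(k, l)"] assms(2-) by simp

lemmas slot_eq_iff = inj_slot[OF injA] inj_slot[OF injB] inj_slot[OF injC] inj_slot[OF injD]

text \<open>Two opposite slots show all four indices, two adjacent slots leave one index free and a
  single slot two: hence 1, n and n^2 here and in the next two lemmas.\<close>

lemma opposite_le:
  "card (matching fA t \<inter> matching fC t') \<le> 1" "card (matching fB t \<inter> matching fD t') \<le> 1"
proof -
  have fin: "finite (matching fA t \<inter> matching fC t')" "finite (matching fB t \<inter> matching fD t')" using finQ by auto
  show "card (matching fA t \<inter> matching fC t') \<le> 1"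
    by (intro card_le_Suc0_iff_eq[OF fin(1), THEN iffD2, unfolded One_nat_def[symmetric]])
       (auto simp: f_defs slot_eq_iff dest!: QD)
  show "card (matching fB t \<inter> matching fD t') \<le> 1"
    by (intro card_le_Suc0_iff_eq[OF fin(2), THEN iffD2, unfolded One_nat_def[symmetric]])
       (auto simp: f_defs slot_eq_iff dest!: QD)
qed

lemma adjacent_le:
  "card (matching fA t \<inter> matching fB t') \<le> n" "card (matching fB t \<inter> matching fC t') \<le> n"
  "card (matching fC t \<inter> matching fD t') \<le> n" "card (matching fA t \<inter> matching fD t') \<le> n"
proof -
  have *: "card S \<le> n" if "inj_on f S" "f ` S \<subseteq> {..<n}"
    for S :: "(nat \<times> nat \<times> nat \<times> nat) set" and f
    using card_inj_on_le[OF that] by simp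
  show "card (matching fA t \<inter> matching fB t') \<le> n"
    by (rule *[of "\<lambda>(i, i', j, j'). j'"])
      (auto simp: f_defs inj_on_def slot_eq_iff dest!: QD)
  show "card (matching fB t \<inter> matching fC t') \<le> n"
    by (rule *[of "\<lambda>(i, i', j, j'). i"])
      (auto simp: f_defs inj_on_def slot_eq_iff dest!: QD)
  show "card (matching fC t \<inter> matching fD t') \<le> n"
    by (rule *[of "\<lambda>(i, i', j, j'). j"])
      (auto simp: f_defs inj_on_def slot_eq_iff dest!: QD)
  show "card (matching fA t \<inter> matching fD t') \<le> n"
    by (rule *[of "\<lambda>(i, i', j, j'). i'"])
      (auto simp: f_defs inj_on_def slot_eq_iff dest!: QD)
qed

lemma single_le: "card (matching fA t) \<le> n\<^sup>2" "card (matching fB t) \<le> n\<^sup>2" "card (matching fC t) \<le> n\<^sup>2" "card (matching fD t) \<le> n\<^sup>2"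
proof -
  have *: "card S \<le> n\<^sup>2" if "inj_on f S" "f ` S \<subseteq> {..<n} \<times> {..<n}"
    for S :: "(nat \<times> nat \<times> nat \<times> nat) set" and f
    using card_inj_on_le[OF that] by (simp add: power2_eq_square)
  show "card (matching fA t) \<le> n\<^sup>2"
    by (rule *[of "\<lambda>(i, i', j, j'). (i', j')"])
      (auto simp: f_defs inj_on_def slot_eq_iff dest!: QD)
  show "card (matching fB t) \<le> n\<^sup>2"
    by (rule *[of "\<lambda>(i, i', j, j'). (i, j')"])
      (auto simp: f_defs inj_on_def slot_eq_iff dest!: QD)
  show "card (matching fC t) \<le> n\<^sup>2"
    by (rule *[of "\<lambda>(i, i', j, j'). (i, j)"])
      (auto simp: f_defs inj_on_def slot_eq_iff dest!: QD)
  show "card (matching fD t) \<le> n\<^sup>2"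
    by (rule *[of "\<lambda>(i, i', j, j'). (i', j)"])
      (auto simp: f_defs inj_on_def slot_eq_iff dest!: QD)
qed

lemma card_UN_le_mult:
  assumes "card U = u" "finite U" "\<And>t. card (g t) \<le> k"
  shows "card (\<Union>t\<in>U. g t) \<le> u * k"
proof -
  have "card (\<Union>t\<in>U. g t) \<le> (\<Sum>t\<in>U. card (g t))" by (rule card_UN_le[OF assms(2)])
  also have "\<dots> \<le> (\<Sum>t\<in>U. k)" by (intro sum_mono assms(3))
  finally show ?thesis using assms(1) by simp
qed

lemma card_UN_pairs:
  assumes "card U = u" "finite U" "\<And>t t'. card (g t t') \<le> k"
  shows "card (\<Union>t\<in>U. \<Union>t'\<in>U. g t t') \<le> u * (u * k)"
  by (intro card_UN_le_mult assms)

lemma card_quads_1: "card {q \<in> Q. t \<in> edge q} \<le> 4 * n\<^sup>2"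
proof -
  have "{q \<in> Q. t \<in> edge q} = matching fA t \<union> (matching fB t \<union> (matching fC t \<union> matching fD t))"
    by (auto simp: edge_eq)
  hence "card {q \<in> Q. t \<in> edge q} =
      card (matching fA t \<union> (matching fB t \<union> (matching fC t \<union> matching fD t)))" by simp
  thus ?thesis
    using card_Un_le[of "matching fA t" "matching fB t \<union> (matching fC t \<union> matching fD t)"]
      card_Un_le[of "matching fB t" "matching fC t \<union> matching fD t"] card_Un_le[of "matching fC t" "matching fD t"]
      single_le[of t] by linarith
qed

definition pairs_at :: "'e set \<Rightarrow> (nat \<times> nat \<times> nat \<times> nat \<Rightarrow> 'e) \<Rightarrow> (nat \<times> nat \<times> nat \<times> nat \<Rightarrow> 'e)
    \<Rightarrow> (nat \<times> nat \<times> nat \<times> nat) set" where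
  "pairs_at U f g = (\<Union>t\<in>U. \<Union>t'\<in>U. matching f t \<inter> matching g t')"

lemma pairs_atI: "q \<in> Q \<Longrightarrow> f q \<in> U \<Longrightarrow> g q \<in> U \<Longrightarrow> q \<in> pairs_at U f g"
  by (auto simp: pairs_at_def)

lemma finite_pairs_at: "finite (pairs_at U f g)"
  by (rule finite_subset[OF _ finQ]) (auto simp: pairs_at_def)

text \<open>Of the six pairs of slots four are adjacent and two opposite, with four assignments
  each: 16 n + 8 \<le> 24 n.\<close>

lemma card_quads_2:
  assumes "t \<noteq> t'" "0 < n"
  shows "card {q \<in> Q. {t, t'} \<subseteq> edge q} \<le> 24 * n"
proof -
  let ?U = "{t, t'}"
  let ?g = "pairs_at ?U"
  have "{q \<in> Q. ?U \<subseteq> edge q} \<subseteq>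
      ?g fA fB \<union> (?g fB fC \<union> (?g fC fD \<union> (?g fA fD \<union> (?g fA fC \<union> ?g fB fD))))"
  proof
    fix q assume q: "q \<in> {q \<in> Q. ?U \<subseteq> edge q}"
    hence "fA q \<in> ?U \<and> fB q \<in> ?U \<or> fB q \<in> ?U \<and> fC q \<in> ?U \<or> fC q \<in> ?U \<and> fD q \<in> ?U \<or>
      fA q \<in> ?U \<and> fD q \<in> ?U \<or> fA q \<in> ?U \<and> fC q \<in> ?U \<or> fB q \<in> ?U \<and> fD q \<in> ?U"
      using assms(1) by (auto simp: edge_eq)
    moreover have "q \<in> ?g f g" if "f q \<in> ?U \<and> g q \<in> ?U" for f g
      using that q by (intro pairs_atI) auto
    ultimately show "q \<in> ?g fA fB \<union> (?g fB fC \<union> (?g fC fD \<union> (?g fA fD \<union> (?g fA fC \<union> ?g fB fD))))"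
      unfolding Un_iff by (elim disjE) fast+
  qed
  hence "card {q \<in> Q. ?U \<subseteq> edge q} \<le>
      card (?g fA fB \<union> (?g fB fC \<union> (?g fC fD \<union> (?g fA fD \<union> (?g fA fC \<union> ?g fB fD)))))"
    by (intro card_mono) (simp_all add: finite_pairs_at)
  also have "\<dots> \<le> card (?g fA fB) + (card (?g fB fC) + (card (?g fC fD) + (card (?g fA fD) +
      (card (?g fA fC) + card (?g fB fD)))))"
    by (intro order_trans[OF card_Un_le] add_left_mono card_Un_le)
  also have "\<dots> \<le> 2 * (2 * n) + (2 * (2 * n) + (2 * (2 * n) + (2 * (2 * n) + (2 * (2 * 1) + 2 * (2 * 1)))))"
    unfolding pairs_at_def using assms(1) by (intro add_mono card_UN_pairs adjacent_le opposite_le) auto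
  also have "\<dots> \<le> 24 * n" using assms(2) by simp
  finally show ?thesis .
qed

text \<open>Three of the four slots always include two opposite ones, which fix the quadruple. Two
  opposite pairs with nine assignments each give 18.\<close>

lemma card_quads_3:
  assumes "distinct [t1, t2, t3]"
  shows "card {q \<in> Q. {t1, t2, t3} \<subseteq> edge q} \<le> 18"
proof -
  let ?U = "{t1, t2, t3}"
  let ?g = "pairs_at ?U"
  have cU: "card ?U = 3" using assms by simp
  have "{q \<in> Q. ?U \<subseteq> edge q} \<subseteq> ?g fA fC \<union> ?g fB fD"
  proof
    fix q assume q: "q \<in> {q \<in> Q. ?U \<subseteq> edge q}"
    hence sub: "?U \<subseteq> {fA q, fB q, fC q, fD q}" by (auto simp: edge_eq)
    have two: False if "?U \<subseteq> {x, y}" for x y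
    proof -
      have "card ?U \<le> card {x, y}" using that by (intro card_mono) auto
      also have "\<dots> \<le> 2" by (simp add: card_insert_if)
      finally show False using cU by simp
    qed
    have "fA q \<in> ?U \<and> fC q \<in> ?U \<or> fB q \<in> ?U \<and> fD q \<in> ?U"
    proof (rule ccontr)
      assume "\<not> ?thesis"
      hence "?U \<subseteq> {fC q, fD q} \<or> ?U \<subseteq> {fC q, fB q} \<or> ?U \<subseteq> {fA q, fD q} \<or> ?U \<subseteq> {fA q, fB q}"
        using sub by blast
      thus False using two by (elim disjE)
    qed
    moreover have "q \<in> ?g f g" if "f q \<in> ?U \<and> g q \<in> ?U" for f g
      using that q by (intro pairs_atI) auto
    ultimately show "q \<in> ?g fA fC \<union> ?g fB fD" unfolding Un_iff by (elim disjE) fast+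
  qed
  hence "card {q \<in> Q. ?U \<subseteq> edge q} \<le> card (?g fA fC \<union> ?g fB fD)"
    by (intro card_mono) (simp_all add: finite_pairs_at)
  also have "\<dots> \<le> card (?g fA fC) + card (?g fB fD)" by (rule card_Un_le)
  also have "\<dots> \<le> 3 * (3 * 1) + 3 * (3 * 1)"
    unfolding pairs_at_def using assms by (intro add_mono card_UN_pairs opposite_le) auto
  finally show ?thesis by simp
qed

lemma card_quads_ge_3:
  assumes "3 \<le> card T"
  shows "card {q \<in> Q. T \<subseteq> edge q} \<le> 18"
proof -
  obtain U where U: "U \<subseteq> T" "card U = 3" "finite U"
    using obtain_subset_with_card_n[OF assms] by blast
  then obtain t1 t2 t3 where t: "U = {t1, t2, t3}" "distinct [t1, t2, t3]"
    by (auto simp: card_3_iff)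
  have "card {q \<in> Q. T \<subseteq> edge q} \<le> card {q \<in> Q. {t1, t2, t3} \<subseteq> edge q}"
    using finQ U(1) t(1) by (intro card_mono) auto
  thus ?thesis using card_quads_3[OF t(2)] by linarith
qed

lemma deg_le: "deg H T \<le> card {q \<in> Q. T \<subseteq> edge q}"
proof -
  have "{e \<in> H. T \<subseteq> e} = edge ` {q \<in> Q. T \<subseteq> edge q}" by (auto simp: H_def)
  thus ?thesis unfolding deg_def using finQ by (simp add: card_image_le)
qed

text \<open>Sets of size 1, 2, 3, 4 have degree at most of order n^2, n, 1, 1, against n^2, n^(4/3),
  n^(2/3), 1 allowed. Size 1 fixes the order of D, and then size 4 fixes the exponent -2/3.\<close>

lemma degrees:
  assumes "0 < n" "finite V"
  shows "degrees_bounded V H (24 * (real n)\<^sup>2) (real n powr (-2/3))"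
  unfolding degrees_bounded_def
proof (intro allI impI)
  fix T assume T: "T \<subseteq> V \<and> T \<noteq> {}"
  have finT: "finite T" using T assms(2) finite_subset by blast
  let ?\<tau> = "real n powr (-2/3)"
  have pw: "(real n)\<^sup>2 * ?\<tau> ^ k = real n powr (2 - 2/3 * real k)" for k
  proof -
    have "(real n)\<^sup>2 = real n powr 2" using assms by simp
    moreover have "?\<tau> ^ k = real n powr (-2/3 * real k)"
      using assms by (simp add: powr_powr flip: powr_realpow)
    ultimately show ?thesis unfolding powr_add[symmetric] by (simp only: powr_add[symmetric]) simp
  qed
  have n1: "1 \<le> real n" using assms by simp
  consider "card T = 1" | "card T = 2" | "card T = 3 \<or> card T = 4" | "card T > 4"
    using T finT by (cases "card T = 0") force+
  thus "real (deg H T) \<le> 24 * (real n)\<^sup>2 * ?\<tau> ^ (card T - 1)"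
  proof cases
    case 1
    then obtain t where "T = {t}" by (auto simp: card_1_singleton_iff)
    hence "deg H T \<le> 4 * n\<^sup>2" using deg_le[of T] card_quads_1[of t] by auto
    hence "real (deg H T) \<le> real (4 * n\<^sup>2)" by (rule of_nat_mono)
    thus ?thesis using 1 by simp
  next
    case 2
    then obtain t t' where "T = {t, t'}" "t \<noteq> t'" by (auto simp: card_2_iff)
    hence "deg H T \<le> 24 * n" using deg_le[of T] card_quads_2[of t t'] assms by auto
    hence "real (deg H T) \<le> real (24 * n)" by (rule of_nat_mono)
    also have "\<dots> = 24 * real n powr 1" using assms by simp
    also have "\<dots> \<le> 24 * real n powr (2 - 2/3 * real 1)"
      using n1 by (intro mult_left_mono powr_mono) auto
    finally show ?thesis using 2 pw[of 1] by simp
  next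
    case 3
    hence "deg H T \<le> 18" using deg_le[of T] card_quads_ge_3[of T] by linarith
    hence "real (deg H T) \<le> 24 * real n powr 0" using assms by simp
    also have "\<dots> \<le> 24 * real n powr (2 - 2/3 * real (card T - 1))"
      using n1 3 by (intro mult_left_mono powr_mono) auto
    finally show ?thesis using pw by (simp add: mult.assoc)
  next
    case 4
    have "{e \<in> H. T \<subseteq> e} = {}"
    proof -
      have "card T \<le> 4" if "e \<in> H" "T \<subseteq> e" for e
        using uniform that card_mono[of e T] assms(2) by (auto simp: uniform_hypergraph_def intro: finite_subset)
      thus ?thesis using 4 by fastforce
    qed
    hence "deg H T = 0" unfolding deg_def by (simp only: card.empty)
    thus ?thesis using pw by simp
  qed
qed

text \<open>Different quadruples may give the same edge, but three of its elements already leave at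
  most 18 of them.\<close>

lemma card_edges_within:
  "card {q \<in> Q. edge q \<subseteq> X} \<le> 18 * card {e \<in> H. e \<subseteq> X}"
proof (rule card_le_fibers[where f = edge])
  fix e assume "e \<in> {e \<in> H. e \<subseteq> X}"
  hence "card e = 4" using uniform by (auto simp: uniform_hypergraph_def)
  hence "card {q \<in> Q. e \<subseteq> edge q} \<le> 18" by (intro card_quads_ge_3) simp
  moreover have "card {q \<in> {q \<in> Q. edge q \<subseteq> X}. edge q = e} \<le> card {q \<in> Q. e \<subseteq> edge q}"
    using finQ by (intro card_mono) auto
  ultimately show "card {q \<in> {q \<in> Q. edge q \<subseteq> X}. edge q = e} \<le> 18" by linarith
qed (use finQ in \<open>auto simp: H_def\<close>)

end

section \<open>Shortcuts of a Hamilton cycle\<close>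

lemma successively_nth:
  "successively P xs \<Longrightarrow> Suc i < length xs \<Longrightarrow> P (xs ! i) (xs ! Suc i)"
proof (induction xs arbitrary: i)
  case (Cons x xs)
  thus ?case by (cases i; cases xs) (auto simp: successively_Cons)
qed simp

lemma has_cycle_of_lengthI:
  assumes "3 \<le> length vs" "distinct vs" "successively (\<lambda>x y. {x, y} \<in> E) vs" "{last vs, hd vs} \<in> E"
  shows "has_cycle_of_length E (length vs)"
proof -
  have "{vs ! i, vs ! (Suc i mod length vs)} \<in> E" if "i < length vs" for i
  proof (cases "Suc i < length vs")
    case True
    thus ?thesis using successively_nth[OF assms(3) True] by simp
  next
    case False
    hence "Suc i = length vs" "i = length vs - 1" using that by auto
    moreover have "vs \<noteq> []" using assms(1) by auto
    ultimately show ?thesis using assms(4) by (simp add: last_conv_nth hd_conv_nth)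
  qed
  thus ?thesis using assms(1,2) by (auto simp: has_cycle_of_length_def is_cycle_def)
qed

lemma has_cycle_of_length_mono: "has_cycle_of_length E k \<Longrightarrow> E \<subseteq> E' \<Longrightarrow> has_cycle_of_length E' k"
  unfolding has_cycle_of_length_def is_cycle_def by blast

lemma inj_on_mod_window: "inj_on (\<lambda>x. x mod n) {c..<c + (n::nat)}"
proof (rule inj_onI)
  have "x = y" if "x \<in> {c..<c + n}" "y \<in> {c..<c + n}" "x mod n = y mod n" "x \<le> y" for x y
  proof -
    have "n dvd y - x" using that(3,4) by (metis mod_eq_dvd_iff_nat)
    moreover have "y - x < n" using that by auto
    ultimately have "y - x = 0" by (metis nat_dvd_not_less neq0_conv)
    thus "x = y" using that(4) by simp
  qed
  thus "x = y" if "x \<in> {c..<c + n}" "y \<in> {c..<c + n}" "x mod n = y mod n" for x y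
    using that by (metis nle_le)
qed

lemma bij_betw_mod_window:
  assumes "0 < (n::nat)"
  shows "bij_betw (\<lambda>x. x mod n) {c..<c + n} {..<n}"
proof -
  have "(\<lambda>x. x mod n) ` {c..<c + n} = {..<n}"
    using assms by (intro card_subset_eq) (auto simp: card_image[OF inj_on_mod_window])
  thus ?thesis using inj_on_mod_window by (auto simp: bij_betw_def)
qed

lemma card_periodic_window:
  assumes "0 < (n::nat)" "\<And>x. P (x mod n) \<longleftrightarrow> P x"
  shows "card {x \<in> {c..<c + n}. P x} = card {x. x < n \<and> P x}"
proof -
  have "bij_betw (\<lambda>x. x mod n) {x \<in> {c..<c + n}. P x} {x \<in> {..<n}. P x}"
    unfolding bij_betw_def
  proof
    show "inj_on (\<lambda>x. x mod n) {x \<in> {c..<c + n}. P x}"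
      by (rule inj_on_subset[OF inj_on_mod_window]) auto
    have "x \<in> (\<lambda>x. x mod n) ` {x \<in> {c..<c + n}. P x}" if "x < n" "P x" for x
    proof -
      have "x \<in> (\<lambda>x. x mod n) ` {c..<c + n}"
        using bij_betw_mod_window[OF assms(1), of c] that by (simp add: bij_betw_def)
      then obtain y where "y \<in> {c..<c + n}" "x = y mod n" by auto
      thus ?thesis using that(2) assms(2)[of y] by (intro image_eqI[of _ _ y]) auto
    qed
    thus "(\<lambda>x. x mod n) ` {x \<in> {c..<c + n}. P x} = {x \<in> {..<n}. P x}"
      using assms by auto
  qed
  from bij_betw_same_card[OF this] show ?thesis by simp
qed

text \<open>The pigeonhole step of Bondy's argument: inclusion-exclusion within one period, where
  \<open>u\<close> bounds what \<open>J\<close> misses of it.\<close>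

lemma card_inter_window:
  fixes n :: nat
  assumes "0 < n" "\<And>x. P (x mod n) \<longleftrightarrow> P x" "\<And>x. Q (x mod n) \<longleftrightarrow> Q x"
    and J: "J \<subseteq> {c..<c + n}" "n \<le> card J + u"
  shows "card {x. x < n \<and> P x} + card {x. x < n \<and> Q x} \<le> card {x \<in> J. P x \<and> Q x} + n + u"
proof -
  let ?W = "{c..<c + n}"
  have finJ: "finite J" using J(1) finite_subset by blast
  have "card {x \<in> ?W. P x} + card {x \<in> ?W. Q x} =
      card ({x \<in> ?W. P x} \<union> {x \<in> ?W. Q x}) + card ({x \<in> ?W. P x} \<inter> {x \<in> ?W. Q x})"
    by (intro card_Un_Int) auto
  moreover have "card ({x \<in> ?W. P x} \<union> {x \<in> ?W. Q x}) \<le> card ?W" by (intro card_mono) auto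
  moreover have "card ({x \<in> ?W. P x} \<inter> {x \<in> ?W. Q x}) \<le> card {x \<in> J. P x \<and> Q x} + card (?W - J)"
    using finJ by (intro order_trans[OF card_mono card_Un_le]) auto
  moreover have "card (?W - J) = n - card J" using J(1) finJ by (simp add: card_Diff_subset)
  ultimately show ?thesis
    using J(2) card_periodic_window[OF assms(1), of P c] card_periodic_window[OF assms(1), of Q c] assms(2,3)
    by simp
qed

definition seg :: "nat \<Rightarrow> nat \<Rightarrow> nat list" where
  "seg a b = [a..<Suc b]"

lemma seg:
  assumes "a \<le> b"
  shows "seg a b \<noteq> []" "hd (seg a b) = a" "last (seg a b) = b" "set (seg a b) = {a..b}"
    "distinct (seg a b)" "length (seg a b) = b - a + 1"
  using assms by (auto simp: seg_def hd_append)

text \<open>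
  A Hamilton cycle of the bipartite graph with its vertices numbered cyclically; the potential
  edges are the pairs \<open>ch a b\<close> of an even and an odd position.
\<close>
locale ham_labelling =
  fixes n :: nat and v :: "nat \<Rightarrow> 'a"
  assumes n2: "2 \<le> n" and v_eq_iff: "\<And>i j. v i = v j \<longleftrightarrow> i mod (2 * n) = j mod (2 * n)"
begin

definition ch :: "nat \<Rightarrow> nat \<Rightarrow> 'a set" where
  "ch a b = {v (2 * a), v (2 * b + 1)}"

text \<open>These are all potential edges of the bipartite graph; the edges of the cycle itself are
  among them.\<close>

definition chords :: "'a set set" where
  "chords = case_prod ch ` ({..<n} \<times> {..<n})"

definition cyc :: "'a set set" where
  "cyc = (\<lambda>i. {v i, v (Suc i)}) ` UNIV"

lemma mod_2n: "(2 * a) mod (2 * n) = 2 * (a mod n)" "(2 * b + 1) mod (2 * n) = 2 * (b mod n) + 1"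
proof -
  show "(2 * a) mod (2 * n) = 2 * (a mod n)" by (rule mult_mod_right[symmetric])
  have "2 * (d * n + m) + 1 = (2 * m + 1) + d * (2 * n)" for d m :: nat
    by (simp add: algebra_simps)
  from this[of "b div n" "b mod n"]
  have "2 * b + 1 = (2 * (b mod n) + 1) + (b div n) * (2 * n)" by (simp only: div_mult_mod_eq)
  hence "(2 * b + 1) mod (2 * n) = (2 * (b mod n) + 1) mod (2 * n)" by (simp only: mod_mult_self1)
  moreover have "2 * (b mod n) + 1 < 2 * n" using mod_less_divisor[of n b] n2 by linarith
  ultimately show "(2 * b + 1) mod (2 * n) = 2 * (b mod n) + 1" by simp
qed

lemma v_even_odd_iff:
  "v (2 * a) = v (2 * a') \<longleftrightarrow> a mod n = a' mod n"
  "v (2 * b + 1) = v (2 * b' + 1) \<longleftrightarrow> b mod n = b' mod n"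
  "v (2 * a) \<noteq> v (2 * b + 1)"
proof -
  have odd: "2 * x \<noteq> 2 * y + 1" for x y :: nat by presburger
  show "v (2 * a) = v (2 * a') \<longleftrightarrow> a mod n = a' mod n" unfolding v_eq_iff mod_2n by simp
  show "v (2 * b + 1) = v (2 * b' + 1) \<longleftrightarrow> b mod n = b' mod n" unfolding v_eq_iff mod_2n by simp
  show "v (2 * a) \<noteq> v (2 * b + 1)" unfolding v_eq_iff mod_2n by (rule odd)
qed

lemma ch_eq_iff: "ch a b = ch a' b' \<longleftrightarrow> a mod n = a' mod n \<and> b mod n = b' mod n"
  unfolding ch_def doubleton_eq_iff using v_even_odd_iff by metis

lemma ch_mod: "ch (a mod n) b = ch a b" "ch a (b mod n) = ch a b"
  by (simp_all add: ch_eq_iff)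

lemma inj_on_ch: "inj_on (case_prod ch) ({..<n} \<times> {..<n})"
  by (auto simp: inj_on_def ch_eq_iff)

lemma ch_chords: "ch a b \<in> chords"
proof -
  have "ch a b = ch (a mod n) (b mod n)" by (simp add: ch_eq_iff)
  thus ?thesis using n2 by (auto simp: chords_def intro!: image_eqI[of _ _ "(a mod n, b mod n)"])
qed

lemma finite_chords: "finite chords" by (simp add: chords_def)

lemma card_chords: "card chords = n\<^sup>2"
  by (simp add: chords_def card_image[OF inj_on_ch] card_cartesian_product power2_eq_square)

lemma cyc_edge: "cyc \<subseteq> E \<Longrightarrow> {v i, v (Suc i)} \<in> E" "cyc \<subseteq> E \<Longrightarrow> {v (Suc i), v i} \<in> E"
  by (auto simp: cyc_def insert_commute)

section \<open>Cycles assembled from segments of the Hamilton cycle and chords\<close>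

lemma walk_seg:
  assumes "cyc \<subseteq> E"
  shows "successively (\<lambda>x y. {v x, v y} \<in> E) (seg a b)" "successively (\<lambda>x y. {v y, v x} \<in> E) (seg a b)"
proof -
  have "successively (\<lambda>x y. y = Suc x) [a..<b]" for b
  proof (induction b)
    case (Suc b)
    thus ?case by (cases "a < b") (auto simp: successively_append_iff le_less)
  qed simp
  note steps = this[of "Suc b"]
  show "successively (\<lambda>x y. {v x, v y} \<in> E) (seg a b)"
    unfolding seg_def by (rule successively_mono[OF steps]) (use cyc_edge[OF assms] in simp)
  show "successively (\<lambda>x y. {v y, v x} \<in> E) (seg a b)"
    unfolding seg_def by (rule successively_mono[OF steps]) (use cyc_edge[OF assms] in simp)
qed

text \<open>Any 2n consecutive positions meet each vertex once. So a cycle can be written in a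
  window starting at a convenient position \<open>c\<close>, and no segment has to be split at the
  base point.\<close>

lemma cycle_positions:
  assumes "3 \<le> length ps" "distinct ps" "set ps \<subseteq> {c..<c + 2 * n}"
    "successively (\<lambda>x y. {v x, v y} \<in> E) ps" "{v (last ps), v (hd ps)} \<in> E"
  shows "has_cycle_of_length E (length ps)"
proof -
  have "inj_on v {c..<c + 2 * n}"
    using inj_on_mod_window[of "2 * n" c] by (auto simp: inj_on_def v_eq_iff)
  hence "distinct (map v ps)" using assms(2,3) by (simp add: distinct_map inj_on_subset)
  moreover have "last (map v ps) = v (last ps)" "hd (map v ps) = v (hd ps)"
    using assms(1) by (cases ps; simp add: last_map)+
  ultimately show ?thesis
    using has_cycle_of_lengthI[of "map v ps" E] assms by (simp add: successively_map)
qed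

text \<open>The segment from J to J' is closed by the path J', x2, y, x1, J of four chords; its
  three inner positions lie outside the segment.\<close>

lemma cycle_shortcut:
  assumes E: "cyc \<subseteq> E" and order: "J \<le> J'" "J' < x1" "J' < x2" "J' < y" "x1 < J + 2 * n" "x2 < J + 2 * n"
    "y < J + 2 * n" "distinct [x1, x2, y]"
    and e: "{v x1, v J} \<in> E" "{v J', v x2} \<in> E" "{v x2, v y} \<in> E" "{v y, v x1} \<in> E"
  shows "has_cycle_of_length E (J' - J + 4)"
proof -
  note e' = e
  let ?ps = "[x1] @ seg J J' @ [x2, y]"
  have "has_cycle_of_length E (length ?ps)"
  proof (rule cycle_positions[where c = J])
    show "3 \<le> length ?ps" using assms by (simp add: seg)
    show "distinct ?ps" using assms by (auto simp: seg)
    show "set ?ps \<subseteq> {J..<J + 2 * n}" using assms by (auto simp: seg)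
    show "successively (\<lambda>x y. {v x, v y} \<in> E) ?ps"
      using order e' walk_seg[OF E]
      by (simp add: seg successively_append_iff successively_Cons hd_append last_append last_rev hd_rev)
    show "{v (last ?ps), v (hd ?ps)} \<in> E"
      using order e' by (simp add: seg hd_append last_append last_rev hd_rev)
  qed
  moreover have "length ?ps = J' - J + 4" using assms(2) by (simp add: seg)
  ultimately show ?thesis by (simp only:)
qed

text \<open>Run from i' to j, jump to i, run backwards to j', jump to i'. What is omitted are the
  positions strictly between i and i' and strictly between j and j'.\<close>

lemma cycle_two_chords_crossing:
  assumes E: "cyc \<subseteq> E" and order: "i < i'" "i' \<le> j" "j < j'" "j' \<le> i + 2 * n"
    and len: "4 \<le> k" "k = (j - i' + 1) + (i + 2 * n - j' + 1)"
    and e: "{v i, v j} \<in> E" "{v i', v j'} \<in> E"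
  shows "has_cycle_of_length E k"
proof -
  note e' = e[unfolded insert_commute[of "v i" "v j"] insert_commute[of "v i'" "v j'"]]
  let ?ps = "seg i' j @ rev (seg j' (i + 2 * n))"
  have vi: "v (i + 2 * n) = v i" by (simp add: v_eq_iff)
  have "has_cycle_of_length E (length ?ps)"
  proof (rule cycle_positions[where c = "Suc i"])
    show "3 \<le> length ?ps" using assms by (simp add: seg)
    show "distinct ?ps" using assms by (auto simp: seg)
    show "set ?ps \<subseteq> {Suc i..<Suc i + 2 * n}" using assms by (auto simp: seg)
    show "successively (\<lambda>x y. {v x, v y} \<in> E) ?ps"
      using order e' walk_seg[OF E] vi
      by (simp add: seg successively_append_iff successively_Cons hd_append last_append last_rev hd_rev)
    show "{v (last ?ps), v (hd ?ps)} \<in> E"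
      using order e' vi by (simp add: seg hd_append last_append last_rev hd_rev)
  qed
  moreover have "length ?ps = k" using assms by (simp add: seg)
  ultimately show ?thesis by (simp only:)
qed

text \<open>The cycle consists of the segments from i to i' and from j' to j, joined by the
  chords.\<close>

lemma cycle_two_chords_parallel:
  assumes E: "cyc \<subseteq> E" and order: "i < i'" "i' < j'" "j' \<le> j" "j < i + 2 * n"
    and len: "4 \<le> k" "k = (i' - i + 1) + (j - j' + 1)"
    and e: "{v i, v j} \<in> E" "{v i', v j'} \<in> E"
  shows "has_cycle_of_length E k"
proof -
  note e' = e[unfolded insert_commute[of "v i" "v j"]]
  let ?ps = "seg i i' @ seg j' j"
  have "has_cycle_of_length E (length ?ps)"
  proof (rule cycle_positions[where c = i])
    show "3 \<le> length ?ps" using assms by (simp add: seg)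
    show "distinct ?ps" using assms by (auto simp: seg)
    show "set ?ps \<subseteq> {i..<i + 2 * n}" using assms by (auto simp: seg)
    show "successively (\<lambda>x y. {v x, v y} \<in> E) ?ps"
      using order e' walk_seg[OF E]
      by (simp add: seg successively_append_iff successively_Cons hd_append last_append last_rev hd_rev)
    show "{v (last ?ps), v (hd ?ps)} \<in> E"
      using order e' by (simp add: seg hd_append last_append last_rev hd_rev)
  qed
  moreover have "length ?ps = k" using assms by (simp add: seg)
  ultimately show ?thesis by (simp only:)
qed

text \<open>The cycle edges from i to i + 1 and from i' to i' + 1 are given up, and the positions
  strictly inside (p, p') and (q, q') are omitted; the four chords join the four remaining segments.
  Only omitted positions shorten the cycle.\<close>

lemma cycle_four_chords_1:
  assumes E: "cyc \<subseteq> E" and order: "i < i'" "i' < p" "p < p'" "p' \<le> q" "q < q'" "q' \<le> i + 2 * n"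
    and len: "4 \<le> k" "k = 2 * n - (p' - p - 1) - (q' - q - 1)"
    and e: "{v i, v p} \<in> E" "{v (Suc i'), v p'} \<in> E" "{v i', v q} \<in> E" "{v (Suc i), v q'} \<in> E"
  shows "has_cycle_of_length E k"
proof -
  note e' = e[unfolded insert_commute[of "v i" "v p"] insert_commute[of "v (Suc i')" "v p'"]
      insert_commute[of "v (Suc i)" "v q'"]]
  let ?ps = "seg (Suc i) i' @ rev (seg p' q) @ seg (Suc i') p @ rev (seg q' (i + 2 * n))"
  have vi: "v (i + 2 * n) = v i" by (simp add: v_eq_iff)
  have "has_cycle_of_length E (length ?ps)"
  proof (rule cycle_positions[where c = "Suc i"])
    show "3 \<le> length ?ps" using assms by (simp add: seg)
    show "distinct ?ps" using assms by (auto simp: seg)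
    show "set ?ps \<subseteq> {Suc i..<Suc i + 2 * n}" using assms by (auto simp: seg)
    show "successively (\<lambda>x y. {v x, v y} \<in> E) ?ps"
      using order e' walk_seg[OF E] vi
      by (simp add: seg successively_append_iff successively_Cons hd_append last_append last_rev hd_rev)
    show "{v (last ?ps), v (hd ?ps)} \<in> E"
      using order e' vi by (simp add: seg hd_append last_append last_rev hd_rev)
  qed
  moreover have "length ?ps = k" using assms by (simp add: seg)
  ultimately show ?thesis by (simp only:)
qed

text \<open>The same four segments, with the roles of (p, p') and (q, q') exchanged in the
  chords.\<close>

lemma cycle_four_chords_2:
  assumes E: "cyc \<subseteq> E" and order: "i < i'" "i' < p" "p < p'" "p' \<le> q" "q < q'" "q' \<le> i + 2 * n"
    and len: "4 \<le> k" "k = 2 * n - (p' - p - 1) - (q' - q - 1)"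
    and e: "{v i', v p} \<in> E" "{v (Suc i), v p'} \<in> E" "{v i, v q} \<in> E" "{v (Suc i'), v q'} \<in> E"
  shows "has_cycle_of_length E k"
proof -
  note e' = e[unfolded insert_commute[of "v (Suc i)" "v p'"]]
  let ?ps = "seg (Suc i) i' @ rev (seg (Suc i') p) @ seg q' (i + 2 * n) @ rev (seg p' q)"
  have vi: "v (i + 2 * n) = v i" by (simp add: v_eq_iff)
  have "has_cycle_of_length E (length ?ps)"
  proof (rule cycle_positions[where c = "Suc i"])
    show "3 \<le> length ?ps" using assms by (simp add: seg)
    show "distinct ?ps" using assms by (auto simp: seg)
    show "set ?ps \<subseteq> {Suc i..<Suc i + 2 * n}" using assms by (auto simp: seg)
    show "successively (\<lambda>x y. {v x, v y} \<in> E) ?ps"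
      using order e' walk_seg[OF E] vi
      by (simp add: seg successively_append_iff successively_Cons hd_append last_append last_rev hd_rev)
    show "{v (last ?ps), v (hd ?ps)} \<in> E"
      using order e' vi by (simp add: seg hd_append last_append last_rev hd_rev)
  qed
  moreover have "length ?ps = k" using assms by (simp add: seg)
  ultimately show ?thesis by (simp only:)
qed

end

lemma mod_add_right_eq_iff: "(b + s) mod n = (b' + s) mod n \<longleftrightarrow> b mod n = b' mod (n::nat)"
  using cong_add_rcancel_nat[of b s b' n] by (simp add: cong_def)

lemma mod_window_eq_iff:
  "x \<in> {c..<c + n} \<Longrightarrow> y \<in> {c..<c + n} \<Longrightarrow> x mod n = y mod n \<longleftrightarrow> x = (y::nat)"
  using inj_on_eq_iff[OF inj_on_mod_window, of x c n y] by blast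

lemma card_le_lines:
  assumes "finite S" "finite B" "card B \<le> N" "f ` S \<subseteq> B"
    "\<And>b. {q \<in> S. f q = b} = g b ` Z b" "\<And>b. inj_on (g b) (Z b)" "\<And>b. card (Z b) \<le> k"
  shows "card S \<le> k * N"
proof -
  have "card {q \<in> S. f q = b} \<le> k" for b
    unfolding assms(5) card_image[OF assms(6)] by (rule assms(7))
  hence "card S \<le> k * card B" by (intro card_le_fibers[OF assms(1,2,4)])
  thus ?thesis using mult_le_mono2[OF assms(3), of k] by linarith
qed

text \<open>Used for bad quadruples: restricting one coordinate to k values once the other three are
  given saves a factor n/k against n^4.\<close>

lemma card_quads_coord:
  fixes S :: "('a \<times> 'a \<times> 'b \<times> 'b) set"
  assumes "finite I" "finite J" "card I \<le> n" "card J \<le> n" "S \<subseteq> I \<times> I \<times> J \<times> J"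
  shows "(\<And>i' j j'. card {i. (i, i', j, j') \<in> S} \<le> k) \<Longrightarrow> card S \<le> k * n ^ 3"
    and "(\<And>i j j'. card {i'. (i, i', j, j') \<in> S} \<le> k) \<Longrightarrow> card S \<le> k * n ^ 3"
    and "(\<And>i i' j. card {j'. (i, i', j, j') \<in> S} \<le> k) \<Longrightarrow> card S \<le> k * n ^ 3"
proof -
  have finS: "finite S" using assms by (meson finite_SigmaI finite_subset)
  have c1: "card (I \<times> J \<times> J) \<le> n ^ 3" and c2: "card (I \<times> I \<times> J) \<le> n ^ 3"
    unfolding card_cartesian_product power3_eq_cube mult.assoc using assms by (intro mult_le_mono; simp)+
  show "card S \<le> k * n ^ 3" if h: "\<And>i' j j'. card {i. (i, i', j, j') \<in> S} \<le> k"
    by (rule card_le_lines[where f = "\<lambda>(i, i', j, j'). (i', j, j')" and g = "\<lambda>(i', j, j') i. (i, i', j, j')"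
          and Z = "\<lambda>(i', j, j'). {i. (i, i', j, j') \<in> S}", OF finS _ c1])
      (use assms h in \<open>auto simp: inj_on_def\<close>)
  show "card S \<le> k * n ^ 3" if h: "\<And>i j j'. card {i'. (i, i', j, j') \<in> S} \<le> k"
    by (rule card_le_lines[where f = "\<lambda>(i, i', j, j'). (i, j, j')" and g = "\<lambda>(i, j, j') i'. (i, i', j, j')"
          and Z = "\<lambda>(i, j, j'). {i'. (i, i', j, j') \<in> S}", OF finS _ c1])
      (use assms h in \<open>auto simp: inj_on_def\<close>)
  show "card S \<le> k * n ^ 3" if h: "\<And>i i' j. card {j'. (i, i', j, j') \<in> S} \<le> k"
    by (rule card_le_lines[where f = "\<lambda>(i, i', j, j'). (i, i', j)" and g = "\<lambda>(i, i', j) j'. (i, i', j, j')"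
          and Z = "\<lambda>(i, i', j). {j'. (i, i', j, j') \<in> S}", OF finS _ c2])
      (use assms h in \<open>auto simp: inj_on_def\<close>)
qed

text \<open>Cauchy-Schwarz supplies index quadruples with all four slots in \<open>X\<close>; the at
  most \<open>b\<close> bad ones are discarded, and 18 accounts for repeated edges. Indices stay in
  a window and are reduced modulo n only at the end, so \<open>I\<close> and \<open>J\<close> keep
  their linear order.\<close>

lemma (in quad_hypergraph) card_edges_window:
  fixes \<kappa> :: real
  assumes periodic: "\<And>i j. sA (i mod n) (j mod n) = sA i j" "\<And>i j. sB (i mod n) (j mod n) = sB i j"
      "\<And>i j. sC (i mod n) (j mod n) = sC i j" "\<And>i j. sD (i mod n) (j mod n) = sD i j"
    and IJ: "I \<subseteq> {c..<c + n}" "J \<subseteq> {c..<c + n}"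
    and \<kappa>: "0 \<le> \<kappa>" "\<kappa> \<le> (\<Sum>i\<in>I. real (card {j \<in> J. sA i j \<in> X \<and> sB i j \<in> X}) *
        card {j \<in> J. sC i j \<in> X \<and> sD i j \<in> X})"
    and bad: "card {(i, i', j, j'). i \<in> I \<and> i' \<in> I \<and> j \<in> J \<and> j' \<in> J \<and>
        (i mod n, i' mod n, j mod n, j' mod n) \<notin> Q} \<le> b"
  shows "\<kappa>\<^sup>2 \<le> (real n)\<^sup>2 * (18 * real (card {e \<in> H. e \<subseteq> X}) + b)"
proof -
  define T where "T = {(i, i', j, j'). i \<in> I \<and> i' \<in> I \<and> j \<in> J \<and> j' \<in> J \<and>
    sA i j \<in> X \<and> sB i' j \<in> X \<and> sC i' j' \<in> X \<and> sD i j' \<in> X}"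
  define Bd where "Bd = {(i, i', j, j'). i \<in> I \<and> i' \<in> I \<and> j \<in> J \<and> j' \<in> J \<and>
        (i mod n, i' mod n, j mod n, j' mod n) \<notin> Q}"
  define g where "g = (\<lambda>(i, i', j, j'). (i mod n, i' mod n, j mod n, j' mod n))"
  have fin: "finite I" "finite J" using IJ finite_subset by auto
  have finB: "finite Bd"
    by (rule finite_subset[of _ "I \<times> I \<times> J \<times> J"]) (use fin in \<open>auto simp: Bd_def\<close>)
  have inj: "inj_on g (I \<times> I \<times> J \<times> J)"
    using inj_on_subset[OF inj_on_mod_window IJ(1)] inj_on_subset[OF inj_on_mod_window IJ(2)]
    by (auto simp: g_def inj_on_def)
  have sub: "T - Bd \<subseteq> I \<times> I \<times> J \<times> J" by (auto simp: T_def)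
  have img: "g ` (T - Bd) \<subseteq> {q \<in> Q. edge q \<subseteq> X}"
    by (auto simp: T_def Bd_def g_def edge_def periodic)
  have finT: "finite T"
    by (rule finite_subset[of _ "I \<times> I \<times> J \<times> J"]) (use fin in \<open>auto simp: T_def\<close>)
  have "card (T - Bd) \<le> card {q \<in> Q. edge q \<subseteq> X}"
    by (rule card_inj_on_le[OF inj_on_subset[OF inj sub] img]) (use finQ in simp)
  moreover have "card T \<le> card ((T - Bd) \<union> Bd)"
    by (rule card_mono) (use finB finT in auto)
  moreover have "card ((T - Bd) \<union> Bd) \<le> card (T - Bd) + card Bd" by (rule card_Un_le)
  moreover have "card Bd \<le> b" using bad by (simp add: Bd_def)
  ultimately have "card T \<le> 18 * card {e \<in> H. e \<subseteq> X} + b" using card_edges_within[of X] by linarith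
  hence T: "real (card T) \<le> 18 * real (card {e \<in> H. e \<subseteq> X}) + real b"
    by (metis of_nat_add of_nat_le_iff of_nat_mult of_nat_numeral)
  have "\<kappa>\<^sup>2 \<le> (\<Sum>i\<in>I. real (card {j \<in> J. sA i j \<in> X \<and> sB i j \<in> X}) *
        card {j \<in> J. sC i j \<in> X \<and> sD i j \<in> X})\<^sup>2"
    using \<kappa> by (intro power_mono) auto
  also have "\<dots> \<le> (real (card J))\<^sup>2 * card T"
    unfolding T_def by (rule count_quadruples[OF fin])
  also have "\<dots> \<le> (real n)\<^sup>2 * card T"
  proof -
    have "card J \<le> n" using card_mono[OF _ IJ(2)] by simp
    thus ?thesis by (intro mult_right_mono power_mono) auto
  qed
  also have "\<dots> \<le> (real n)\<^sup>2 * (18 * real (card {e \<in> H. e \<subseteq> X}) + b)"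
    using T by (intro mult_left_mono) auto
  finally show ?thesis .
qed

section \<open>Rows and columns of a chord set; supersaturation for short cycles\<close>

context ham_labelling
begin

definition row :: "'a set set \<Rightarrow> nat \<Rightarrow> nat" where
  "row X a = card {b. b < n \<and> ch a b \<in> X}"

definition col :: "'a set set \<Rightarrow> nat \<Rightarrow> nat" where
  "col X b = card {a. a < n \<and> ch a b \<in> X}"

lemma card_chord_pairs:
  assumes "X \<subseteq> chords"
  shows "card {(a, b). a < n \<and> b < n \<and> ch a b \<in> X} = card X"
proof -
  let ?P = "{(a, b). a < n \<and> b < n \<and> ch a b \<in> X}"
  have img: "case_prod ch ` ?P = X" using assms by (auto simp: chords_def)
  have "inj_on (case_prod ch) ?P" by (rule inj_on_subset[OF inj_on_ch]) auto
  from card_image[OF this, unfolded img] show ?thesis by (rule sym)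
qed

lemma sum_row: "X \<subseteq> chords \<Longrightarrow> (\<Sum>a<n. row X a) = card X"
proof -
  assume X: "X \<subseteq> chords"
  have "(\<Sum>a<n. row X a) = card (SIGMA a:{..<n}. {b. b < n \<and> ch a b \<in> X})"
    unfolding row_def by (rule card_SigmaI[symmetric]) auto
  also have "(SIGMA a:{..<n}. {b. b < n \<and> ch a b \<in> X}) = {(a, b). a < n \<and> b < n \<and> ch a b \<in> X}" by auto
  finally show ?thesis using card_chord_pairs[OF X] by simp
qed

lemma sum_col: "X \<subseteq> chords \<Longrightarrow> (\<Sum>b<n. col X b) = card X"
proof -
  assume X: "X \<subseteq> chords"
  have "(\<Sum>b<n. col X b) = card (SIGMA b:{..<n}. {a. a < n \<and> ch a b \<in> X})"
    unfolding col_def by (rule card_SigmaI[symmetric]) auto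
  also have "\<dots> = card {(a, b). a < n \<and> b < n \<and> ch a b \<in> X}"
    by (rule bij_betw_same_card[of prod.swap]) (auto simp: bij_betw_def inj_on_def image_iff)
  finally show ?thesis using card_chord_pairs[OF X] by simp
qed

lemma row_le: "row X a \<le> n" and col_le: "col X a \<le> n"
proof -
  have "card {b. b < n \<and> P b} \<le> card {..<n}" for P by (intro card_mono) auto
  thus "row X a \<le> n" "col X a \<le> n" by (simp_all add: row_def col_def)
qed

lemma card_shift:
  assumes "\<And>x. P (x mod n) \<longleftrightarrow> P x"
  shows "card {b. b < n \<and> P (b + s)} = card {b. b < n \<and> P b}"
proof -
  have "card {b. b < n \<and> P (b + s)} = card {x \<in> {s..<s + n}. P x}"
    by (rule bij_betw_same_card[of "\<lambda>b. b + s"], rule bij_betw_byWitness[where f' = "\<lambda>x. x - s"]) auto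
  also have "\<dots> = card {b. b < n \<and> P b}" using n2 by (intro card_periodic_window assms) auto
  finally show ?thesis .
qed

lemma row_shift: "card {b. b < n \<and> ch a (b + s) \<in> X} = row X a"
  unfolding row_def by (rule card_shift) (simp add: ch_mod)

lemma col_shift: "card {b. b < n \<and> ch (b + s) a \<in> X} = col X a"
  unfolding col_def by (rule card_shift) (simp add: ch_mod)

lemma ch_mod_add: "ch a (b mod n + s) = ch a (b + s)" "ch (a mod n + s) b = ch (a + s) b"
  by (simp_all add: ch_eq_iff mod_add_left_eq)

lemma inj_on_ch_shift:
  "inj_on (\<lambda>(i, j). ch i (j + s)) ({..<n} \<times> {..<n})"
  "inj_on (\<lambda>(i, j). ch (j + s) i) ({..<n} \<times> {..<n})"
  by (auto simp: inj_on_def ch_eq_iff mod_add_right_eq_iff)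

text \<open>Quadruples are selected by the property wanted of them, so only exceptions have to be
  counted. Cardinality 4 excludes coinciding chords, which would break uniformity.\<close>

definition cycle_quads :: "nat \<Rightarrow> (nat \<Rightarrow> nat \<Rightarrow> 'a set) \<Rightarrow> (nat \<Rightarrow> nat \<Rightarrow> 'a set) \<Rightarrow>
    (nat \<Rightarrow> nat \<Rightarrow> 'a set) \<Rightarrow> (nat \<Rightarrow> nat \<Rightarrow> 'a set) \<Rightarrow> (nat \<times> nat \<times> nat \<times> nat) set" where
  "cycle_quads k sA sB sC sD = {(i, i', j, j'). i < n \<and> i' < n \<and> j < n \<and> j' < n \<and>
     card {sA i j, sB i' j, sC i' j', sD i j'} = 4 \<and>
     has_cycle_of_length (cyc \<union> {sA i j, sB i' j, sC i' j', sD i j'}) k}"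

text \<open>The interface between chord configurations and containers: every edge of
  \<open>H\<close> closes a k-cycle with the Hamilton cycle, and \<alpha>, \<beta> are the
  parameters of supersaturation.\<close>

definition shortcut_system :: "nat \<Rightarrow> nat \<Rightarrow> real \<Rightarrow> real \<Rightarrow> real \<Rightarrow> real \<Rightarrow> bool" where
  "shortcut_system r k D \<tau> \<beta> \<alpha> \<longleftrightarrow> (\<exists>H. uniform_hypergraph r chords H \<and> degrees_bounded chords H D \<tau> \<and>
     (\<forall>e\<in>H. has_cycle_of_length (cyc \<union> e) k) \<and>
     (\<forall>X\<subseteq>chords. \<alpha> * card chords \<le> card X \<longrightarrow> \<beta> * D * card chords \<le> card {e \<in> H. e \<subseteq> X}))"

text \<open>The segment of odd ends j and j + h - 2 is closed through the even indices i, i' and the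
  odd index j'. Their lifts \<open>x1\<close>, \<open>x2\<close>, \<open>y\<close> must lie behind
  the segment within one period, which explains the three ranges.\<close>

lemma shortcut_quad:
  assumes h: "2 \<le> h" "h < n" and ij: "i < n" "i' < n" "j < n" "j' < n" and "i \<noteq> i'"
    and x1: "x1 \<in> {j + (h - 2) + 1..j + n}" "x1 mod n = i"
    and x2: "x2 \<in> {j + (h - 2) + 1..j + n}" "x2 mod n = i'"
    and y: "y \<in> {j + (h - 2) + 1..<j + n}" "y mod n = j'"
  shows "(i, i', j, j') \<in> cycle_quads (2 * h) ch (\<lambda>i j. ch i (j + (h - 2))) ch ch"
proof -
  define t where "t = h - 2"
  let ?e = "{ch i j, ch i' (j + t), ch i' j', ch i j'}"
  have eqs: "ch i j = {v (2 * x1), v (2 * j + 1)}" "ch i' (j + t) = {v (2 * (j + t) + 1), v (2 * x2)}"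
    "ch i' j' = {v (2 * x2), v (2 * y + 1)}" "ch i j' = {v (2 * y + 1), v (2 * x1)}"
    using ch_mod ij x1(2) x2(2) y(2) unfolding ch_def[of x1, symmetric]
    by (metis ch_def insert_commute ch_eq_iff mod_mod_trivial)+
  have "has_cycle_of_length (cyc \<union> ?e) ((2 * (j + t) + 1) - (2 * j + 1) + 4)"
  proof (rule cycle_shortcut[where ?x1.0 = "2 * x1" and ?x2.0 = "2 * x2" and y = "2 * y + 1"])
    show "distinct [2 * x1, 2 * x2, 2 * y + 1]"
    proof -
      have "2 * x \<noteq> 2 * y + 1" for x :: nat by presburger
      moreover have "x1 \<noteq> x2" using x1(2) x2(2) \<open>i \<noteq> i'\<close> by auto
      ultimately show ?thesis by simp
    qed
  qed (use x1 x2 y eqs in \<open>auto simp: t_def\<close>)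
  moreover have "(2 * (j + t) + 1) - (2 * j + 1) + 4 = 2 * h" using h by (simp add: t_def)
  ultimately have "has_cycle_of_length (cyc \<union> ?e) (2 * h)" by (simp only:)
  moreover have "distinct [ch i j, ch i' (j + t), ch i' j', ch i j']"
  proof -
    have "y mod n \<noteq> j mod n" "y mod n \<noteq> (j + t) mod n"
      using y(1) h by (subst mod_window_eq_iff[of _ j n]; auto simp: t_def)+
    thus ?thesis using \<open>i \<noteq> i'\<close> ij y(2) by (auto simp: ch_eq_iff)
  qed
  hence "card ?e = 4" using distinct_card by fastforce
  ultimately show ?thesis using ij unfolding cycle_quads_def t_def by simp
qed

lemma card_mod_complement:
  assumes "s \<le> n"
  shows "card {x. x < n \<and> x \<notin> (\<lambda>x. x mod n) ` {c + s..<c + n}} \<le> s"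
proof -
  let ?f = "\<lambda>x. x mod n"
  have "{x. x < n \<and> x \<notin> ?f ` {c + s..<c + n}} \<subseteq> ?f ` {c..<c + s}"
  proof
    fix x assume x: "x \<in> {x. x < n \<and> x \<notin> ?f ` {c + s..<c + n}}"
    hence "x \<in> ?f ` {c..<c + n}" using bij_betw_mod_window[of n c] n2 by (auto simp: bij_betw_def)
    then obtain y where "y \<in> {c..<c + n}" "x = y mod n" by auto
    thus "x \<in> ?f ` {c..<c + s}" using x by (cases "y < c + s") auto
  qed
  hence "card {x. x < n \<and> x \<notin> ?f ` {c + s..<c + n}} \<le> card (?f ` {c..<c + s})" by (intro card_mono) auto
  also have "\<dots> \<le> s" using card_image_le[of "{c..<c + s}" ?f] by simp
  finally show ?thesis .
qed

text \<open>Bad are i = i' and, for given j, those i, i', j' that fall into the segment: at most h -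
  2, h - 2 and h - 1 values.\<close>

lemma short_cycle_quads_bad:
  assumes h: "2 \<le> h" "h < n" and I: "I \<subseteq> {..<n}"
  shows "card {(i, i', j, j'). i \<in> I \<and> i' \<in> I \<and> j \<in> {..<n} \<and> j' \<in> {..<n} \<and>
    (i, i', j, j') \<notin> cycle_quads (2 * h) ch (\<lambda>i j. ch i (j + (h - 2))) ch ch} \<le> 3 * h * n ^ 3"
    (is "card ?B \<le> _")
proof -
  define t where "t = h - 2"
  let ?f = "\<lambda>x. x mod n"
  define Z where "Z j = {x. x < n \<and> x \<notin> ?f ` {(j + 1) + t..<(j + 1) + n}}" for j
  define Z' where "Z' j = {x. x < n \<and> x \<notin> ?f ` {j + (t + 1)..<j + n}}" for j
  have cZ: "card (Z j) \<le> t" "card (Z' j) \<le> t + 1" for j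
    unfolding Z_def Z'_def using h by (intro card_mod_complement; simp add: t_def)+
  have finZ: "finite (Z j)" "finite (Z' j)" for j by (auto simp: Z_def Z'_def)
  let ?N = "{..<n}"
  let ?S = "?N \<times> ?N \<times> ?N \<times> ?N"
  define B1 where "B1 = {q \<in> ?S. (\<lambda>(i, i', j, j'). i = i') q}"
  define B2 where "B2 = {q \<in> ?S. (\<lambda>(i, i', j, j'). i \<in> Z j) q}"
  define B3 where "B3 = {q \<in> ?S. (\<lambda>(i, i', j, j'). i' \<in> Z j) q}"
  define B4 where "B4 = {q \<in> ?S. (\<lambda>(i, i', j, j'). j' \<in> Z' j) q}"
  have mem: "(i, i', j, j') \<in> B1 \<union> (B2 \<union> (B3 \<union> B4))"
    if q: "i \<in> I" "i' \<in> I" "j < n" "j' < n"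
      "(i, i', j, j') \<notin> cycle_quads (2 * h) ch (\<lambda>i j. ch i (j + (h - 2))) ch ch" for i i' j j'
  proof (rule ccontr)
    assume no: "(i, i', j, j') \<notin> B1 \<union> (B2 \<union> (B3 \<union> B4))"
    have lt: "i < n" "i' < n" using q I by auto
    have ne: "i \<noteq> i'" and "i \<notin> Z j" "i' \<notin> Z j" "j' \<notin> Z' j"
      using no q lt by (auto simp: B1_def B2_def B3_def B4_def)
    then obtain x1 x2 y where "x1 \<in> {(j + 1) + t..<(j + 1) + n}" "x1 mod n = i"
      "x2 \<in> {(j + 1) + t..<(j + 1) + n}" "x2 mod n = i'" "y \<in> {j + (t + 1)..<j + n}" "y mod n = j'"
      using q lt unfolding Z_def Z'_def by blast
    thus False using shortcut_quad[OF h lt q(3,4) ne, of x1 x2 y] q(5) by (auto simp: t_def)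
  qed
  hence sub: "?B \<subseteq> B1 \<union> (B2 \<union> (B3 \<union> B4))" by blast
  have "card B1 \<le> 1 * n ^ 3"
  proof (rule card_quads_coord(1)[of ?N ?N])
    fix i' j j'
    have "card {i. (i, i', j, j') \<in> B1} \<le> card {i'}" by (intro card_mono) (auto simp: B1_def)
    thus "card {i. (i, i', j, j') \<in> B1} \<le> 1" by simp
  qed (auto simp: B1_def)
  moreover have "card B2 \<le> t * n ^ 3"
  proof (rule card_quads_coord(1)[of ?N ?N])
    fix i' j j'
    have "card {i. (i, i', j, j') \<in> B2} \<le> card (Z j)" using finZ by (intro card_mono) (auto simp: B2_def)
    thus "card {i. (i, i', j, j') \<in> B2} \<le> t" using cZ(1)[of j] by linarith
  qed (auto simp: B2_def)
  moreover have "card B3 \<le> t * n ^ 3"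
  proof (rule card_quads_coord(2)[of ?N ?N])
    fix i j j'
    have "card {i'. (i, i', j, j') \<in> B3} \<le> card (Z j)" using finZ by (intro card_mono) (auto simp: B3_def)
    thus "card {i'. (i, i', j, j') \<in> B3} \<le> t" using cZ(1)[of j] by linarith
  qed (auto simp: B3_def)
  moreover have "card B4 \<le> (t + 1) * n ^ 3"
  proof (rule card_quads_coord(3)[of ?N ?N])
    fix i i' j
    have "card {j'. (i, i', j, j') \<in> B4} \<le> card (Z' j)" using finZ by (intro card_mono) (auto simp: B4_def)
    thus "card {j'. (i, i', j, j') \<in> B4} \<le> t + 1" using cZ(2)[of j] by linarith
  qed (auto simp: B4_def)
  moreover have "card ?B \<le> card B1 + (card B2 + (card B3 + card B4))"
  proof -
    have "finite (B1 \<union> (B2 \<union> (B3 \<union> B4)))" by (simp add: B1_def B2_def B3_def B4_def)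
    from card_mono[OF this sub] show ?thesis
      by (intro order_trans[OF _ order_trans[OF card_Un_le add_left_mono[OF order_trans[OF card_Un_le add_left_mono[OF card_Un_le]]]]])
  qed
  moreover have "n ^ 3 + (t * n ^ 3 + (t * n ^ 3 + (t + 1) * n ^ 3)) = (3 * t + 2) * n ^ 3"
    by (simp add: algebra_simps)
  moreover have "(3 * t + 2) * n ^ 3 \<le> (3 * h) * n ^ 3" using h by (intro mult_right_mono) (auto simp: t_def)
  ultimately show ?thesis by linarith
qed

text \<open>At least d n / 2 rows contain (1/2 + d/2) n chords. In such a row the slots A and B, two
  translates of the row, share d n positions, and C and D, which agree for i' = i, have n/2; so
  \<kappa> = d^2 n^3 / 4. The bound on h keeps the bad quadruples below half of d^4 n^4 / 16, and
  13824 = 18 * 24 * 32.\<close>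

lemma shortcut_system_short:
  fixes d :: real
  assumes d: "0 < d" "d \<le> 1" and h: "2 \<le> h" "h < n" "real h \<le> d ^ 4 * n / 96"
  shows "shortcut_system 4 (2 * h) (24 * (real n)\<^sup>2) (real n powr (-2/3)) (d ^ 4 / 13824) (1/2 + d)"
proof -
  define t where "t = h - 2"
  let ?sB = "\<lambda>i j. ch i (j + (h - 2))"
  define Q where "Q = cycle_quads (2 * h) ch ?sB ch ch"
  interpret quad_hypergraph n chords ch ?sB ch ch Q
    by unfold_locales (auto simp: inj_on_ch inj_on_ch_shift ch_chords Q_def cycle_quads_def)
  have n0: "0 < real n" using n2 by simp
  have "d ^ 4 / 13824 * (24 * (real n)\<^sup>2) * card chords \<le> card {e \<in> H. e \<subseteq> X}"
    if X: "X \<subseteq> chords" "(1/2 + d) * card chords \<le> card X" for X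
  proof -
    define I where "I = {i. i < n \<and> (1/2 + d/2) * n \<le> row X i}"
    have finI: "finite I" "I \<subseteq> {..<n}" by (auto simp: I_def)
    have "(1/2 + d) * (real n)\<^sup>2 \<le> (\<Sum>i<n. real (row X i))"
      using X sum_row[OF X(1)] by (simp add: card_chords flip: of_nat_sum)
    also have "\<dots> \<le> (\<Sum>i<n. (if i \<in> I then real n else 0) + (1/2 + d/2) * n)"
    proof (rule sum_mono)
      fix i assume "i \<in> {..<n}"
      hence i: "i < n" by simp
      have "real (row X i) \<le> n" using row_le[of X i] by simp
      moreover have "0 \<le> (1/2 + d/2) * n" using d by simp
      ultimately show "real (row X i) \<le> (if i \<in> I then real n else 0) + (1/2 + d/2) * n"
        using i unfolding I_def by simp
    qed
    also have "\<dots> = card I * n + (1/2 + d/2) * (real n)\<^sup>2"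
      using finI by (simp add: sum.distrib sum.If_cases Int_absorb1 power2_eq_square)
    finally have "d / 2 * n * n \<le> card I * real n" by (simp add: power2_eq_square algebra_simps)
    hence cI: "d / 2 * n \<le> card I" using n0 by simp
    define \<kappa> where "\<kappa> = d\<^sup>2 / 4 * n ^ 3"
    have "\<kappa> = d / 2 * n * (d * n * (n / 2))" by (simp add: \<kappa>_def power2_eq_square power3_eq_cube)
    also have "\<dots> \<le> card I * (d * n * (n / 2))" using cI d by (intro mult_right_mono) auto
    also have "\<dots> = (\<Sum>i\<in>I. d * n * (n / 2))" by simp
    also have "\<dots> \<le> (\<Sum>i\<in>I. real (card {j \<in> {..<n}. ch i j \<in> X \<and> ?sB i j \<in> X}) *
        card {j \<in> {..<n}. ch i j \<in> X \<and> ch i j \<in> X})"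
    proof (intro sum_mono mult_mono)
      fix i assume i: "i \<in> I"
      have "row X i + row X i \<le> card {j \<in> {..<n}. ch i j \<in> X \<and> ?sB i j \<in> X} + n + 0"
        using card_inter_window[of n "\<lambda>j. ch i j \<in> X" "\<lambda>j. ?sB i j \<in> X" "{..<n}" 0 0] n2
          row_shift[of i "h - 2" X]
        by (simp add: ch_mod row_def[symmetric] atLeast0LessThan ch_mod_add)
      moreover have "(1/2 + d/2) * n \<le> row X i" using i by (simp add: I_def)
      ultimately show "d * n \<le> real (card {j \<in> {..<n}. ch i j \<in> X \<and> ?sB i j \<in> X})"
        by (simp add: algebra_simps)
      have "n / 2 \<le> (1/2 + d/2) * n" using d by (simp add: algebra_simps)
      also have "\<dots> \<le> row X i" using i by (simp add: I_def)
      finally show "n / 2 \<le> real (card {j \<in> {..<n}. ch i j \<in> X \<and> ch i j \<in> X})" by (simp add: row_def)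
    qed (use d in auto)
    finally have \<kappa>: "\<kappa> \<le> (\<Sum>i\<in>I. real (card {j \<in> {..<n}. ch i j \<in> X \<and> ?sB i j \<in> X}) *
        card {j \<in> {..<n}. ch i j \<in> X \<and> ch i j \<in> X})" .
    have "\<kappa>\<^sup>2 \<le> (real n)\<^sup>2 * (18 * real (card {e \<in> H. e \<subseteq> X}) + real (3 * h * n ^ 3))"
    proof (rule card_edges_window[where c = 0])
      have "{(i, i', j, j'). i \<in> I \<and> i' \<in> I \<and> j \<in> {..<n} \<and> j' \<in> {..<n} \<and>
          (i mod n, i' mod n, j mod n, j' mod n) \<notin> Q} =
        {(i, i', j, j'). i \<in> I \<and> i' \<in> I \<and> j \<in> {..<n} \<and> j' \<in> {..<n} \<and> (i, i', j, j') \<notin> Q}"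
        using finI(2) by (auto simp: subset_iff)
      thus "card {(i, i', j, j'). i \<in> I \<and> i' \<in> I \<and> j \<in> {..<n} \<and> j' \<in> {..<n} \<and>
          (i mod n, i' mod n, j mod n, j' mod n) \<notin> Q} \<le> 3 * h * n ^ 3"
        using short_cycle_quads_bad[OF h(1,2) finI(2)] by (simp add: Q_def)
    qed (use \<kappa> finI(2) d in \<open>auto simp: ch_mod ch_mod_add \<kappa>_def\<close>)
    also have "\<dots> \<le> (real n)\<^sup>2 * (18 * real (card {e \<in> H. e \<subseteq> X}) + d ^ 4 * n ^ 4 / 32)"
    proof -
      have "3 * real h * n ^ 3 \<le> 3 * (d ^ 4 * n / 96) * n ^ 3" using h(3) by (intro mult_right_mono mult_left_mono) auto
      also have "\<dots> = d ^ 4 * n ^ 4 / 32" by (simp add: power_eq_if)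
      finally show ?thesis by (intro mult_left_mono add_left_mono) auto
    qed
    finally have "\<kappa>\<^sup>2 \<le> (real n)\<^sup>2 * (18 * real (card {e \<in> H. e \<subseteq> X}) + d ^ 4 * n ^ 4 / 32)" .
    moreover have "\<kappa>\<^sup>2 = (real n)\<^sup>2 * (d ^ 4 * n ^ 4 / 16)"
      by (simp add: \<kappa>_def field_simps eval_nat_numeral)
    ultimately have "(real n)\<^sup>2 * (d ^ 4 * n ^ 4 / 16) \<le> (real n)\<^sup>2 * (18 * real (card {e \<in> H. e \<subseteq> X}) + d ^ 4 * n ^ 4 / 32)"
      by (simp only:)
    hence "d ^ 4 * n ^ 4 / 16 \<le> 18 * real (card {e \<in> H. e \<subseteq> X}) + d ^ 4 * n ^ 4 / 32" using n0 by simp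
    moreover have "(real n)\<^sup>2 * (real n)\<^sup>2 = real n ^ 4" by (simp flip: power_add)
    ultimately show ?thesis by (simp add: card_chords mult.assoc)
  qed
  moreover have "has_cycle_of_length (cyc \<union> e) (2 * h)" if "e \<in> H" for e
  proof -
    from that obtain q where q: "q \<in> Q" "e = edge q" unfolding H_def by blast
    obtain i i' j j' where "q = (i, i', j, j')" by (cases q) auto
    thus ?thesis using q unfolding Q_def cycle_quads_def edge_def by simp
  qed
  ultimately show ?thesis
    unfolding shortcut_system_def using uniform degrees[OF _ finite_chords] n2 by (intro exI[of _ H]) auto
qed

end

section \<open>Supersaturation for cycles of length close to 2n\<close>

context ham_labelling
begin

text \<open>The gap behind b1 is empty (p' = p + 1), and the one behind b2 omits exactly 2 (n - h)
  vertices. The orders of a1, a2 and of b1, b2 decide which form of the four-chord cycle arises;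
  \<open>far\<close> keeps the two gaps disjoint.\<close>

lemma long_quad:
  assumes h: "2 \<le> h" "h < n" and a: "a1 \<in> {c..<c + w}" "a2 \<in> {c..<c + w}" "a1 \<noteq> a2"
    and b: "b1 \<in> {c + w..<c + n - (n - h + 1)}" "b2 \<in> {c + w..<c + n - (n - h + 1)}"
    and far: "b1 + (n - h) < b2 \<or> b2 + (n - h) < b1"
  shows "(a1 mod n, a2 mod n, b1 mod n, b2 mod n) \<in>
    cycle_quads (2 * h) ch (\<lambda>i j. ch (j + 1) i) ch (\<lambda>i j. ch (j + (n - h + 1)) i)"
proof -
  define m where "m = n - h"
  let ?e = "{ch a1 b1, ch (b1 + 1) a2, ch a2 b2, ch (b2 + (m + 1)) a1}"
  have e: "{v (2 * a1), v (2 * b1 + 1)} \<in> cyc \<union> ?e" "{v (Suc (2 * a2)), v (2 * b1 + 2)} \<in> cyc \<union> ?e"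
    "{v (2 * a2), v (2 * b2 + 1)} \<in> cyc \<union> ?e" "{v (Suc (2 * a1)), v (2 * b2 + 2 * m + 2)} \<in> cyc \<union> ?e"
    by (simp_all add: ch_def insert_commute)
  have m: "1 \<le> m" "2 * h = 2 * n - 2 * m" "4 \<le> 2 * h" using h by (auto simp: m_def)
  have b': "c + w \<le> b1" "c + w \<le> b2" "b1 + m + 1 < c + n" "b2 + m + 1 < c + n"
    and a': "c \<le> a1" "c \<le> a2" "a1 < c + w" "a2 < c + w"
    using a b by (auto simp: m_def)
  have far': "b1 + m < b2 \<or> b2 + m < b1" using far by (simp add: m_def)
  have cyc_e: "cyc \<subseteq> cyc \<union> ?e" by auto
  have "has_cycle_of_length (cyc \<union> ?e) (2 * h)"
  proof (cases "a1 < a2")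
    case True
    show ?thesis
    proof (cases "b1 < b2")
      case b: True
      show ?thesis
        by (rule cycle_four_chords_1[OF cyc_e, where i = "2 * a1" and i' = "2 * a2" and p = "2 * b1 + 1"
              and p' = "2 * b1 + 2" and q = "2 * b2 + 1" and q' = "2 * b2 + 2 * m + 2"])
          (use True b far' a' b' m e in auto)
    next
      case b: False
      show ?thesis
        by (rule cycle_four_chords_2[OF cyc_e, where i = "2 * a1" and i' = "2 * a2" and p = "2 * b2 + 1"
              and p' = "2 * b2 + 2 * m + 2" and q = "2 * b1 + 1" and q' = "2 * b1 + 2"])
          (use True b far' a' b' m e in auto)
    qed
  next
    case False
    hence "a2 < a1" using a(3) by simp
    show ?thesis
    proof (cases "b1 < b2")
      case b: True
      show ?thesis
        by (rule cycle_four_chords_2[OF cyc_e, where i = "2 * a2" and i' = "2 * a1" and p = "2 * b1 + 1"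
              and p' = "2 * b1 + 2" and q = "2 * b2 + 1" and q' = "2 * b2 + 2 * m + 2"])
          (use \<open>a2 < a1\<close> b far' a' b' m e in auto)
    next
      case b: False
      show ?thesis
        by (rule cycle_four_chords_1[OF cyc_e, where i = "2 * a2" and i' = "2 * a1" and p = "2 * b2 + 1"
              and p' = "2 * b2 + 2 * m + 2" and q = "2 * b1 + 1" and q' = "2 * b1 + 2"])
          (use \<open>a2 < a1\<close> b far' a' b' m e in auto)
    qed
  qed
  moreover have "distinct [ch a1 b1, ch (b1 + 1) a2, ch a2 b2, ch (b2 + (m + 1)) a1]"
  proof -
    have W: "x mod n = y mod n \<longleftrightarrow> x = y" if "c \<le> x" "x < c + n" "c \<le> y" "y < c + n" for x y
      by (rule mod_window_eq_iff[of x c n y]) (use that in auto)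
    have "a1 mod n \<noteq> (b1 + 1) mod n" "a1 mod n \<noteq> a2 mod n" "a1 mod n \<noteq> (b2 + (m + 1)) mod n"
      "(b1 + 1) mod n \<noteq> a2 mod n" "a2 mod n \<noteq> (b2 + (m + 1)) mod n"
      using a' b' a(3) by (subst W; simp)+
    thus ?thesis by (auto simp: ch_eq_iff)
  qed
  hence "card ?e = 4" using distinct_card by fastforce
  ultimately show ?thesis
    unfolding cycle_quads_def m_def mem_Collect_eq case_prod_conv ch_mod ch_mod_add using n2 by simp
qed

text \<open>Bad are i = i' and those j' within n - h of j, where the two gaps could overlap.\<close>

lemma long_cycle_quads_bad:
  assumes h: "2 \<le> h" "h < n" and I: "I \<subseteq> {c..<c + w}" and J: "J \<subseteq> {c + w..<c + n - (n - h + 1)}"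
    and w: "w \<le> n"
  shows "card {(i, i', j, j'). i \<in> I \<and> i' \<in> I \<and> j \<in> J \<and> j' \<in> J \<and>
    (i mod n, i' mod n, j mod n, j' mod n) \<notin>
      cycle_quads (2 * h) ch (\<lambda>i j. ch (j + 1) i) ch (\<lambda>i j. ch (j + (n - h + 1)) i)}
    \<le> (2 * (n - h) + 2) * n ^ 3"
    (is "card ?B \<le> _")
proof -
  let ?S = "I \<times> I \<times> J \<times> J"
  define B1 where "B1 = {q \<in> ?S. (\<lambda>(i, i', j, j'). i = i') q}"
  define B2 where "B2 = {q \<in> ?S. (\<lambda>(i, i', j, j'). j' \<in> {j - (n - h)..j + (n - h)}) q}"
  have fin: "finite I" "finite J" using I J finite_subset by auto
  have cI: "card I \<le> n" using card_mono[OF _ I] w by simp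
  have cJ: "card J \<le> n" using card_mono[OF _ J] by simp
  have mem: "(i, i', j, j') \<in> B1 \<union> B2"
    if q: "i \<in> I" "i' \<in> I" "j \<in> J" "j' \<in> J"
      "(i mod n, i' mod n, j mod n, j' mod n) \<notin>
        cycle_quads (2 * h) ch (\<lambda>i j. ch (j + 1) i) ch (\<lambda>i j. ch (j + (n - h + 1)) i)" for i i' j j'
  proof (rule ccontr)
    assume no: "(i, i', j, j') \<notin> B1 \<union> B2"
    have ij: "i \<in> {c..<c + w}" "i' \<in> {c..<c + w}" "j \<in> {c + w..<c + n - (n - h + 1)}"
      "j' \<in> {c + w..<c + n - (n - h + 1)}" using q I J by blast+
    have "i \<noteq> i'" "j' \<notin> {j - (n - h)..j + (n - h)}" using no q by (auto simp: B1_def B2_def)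
    moreover from this have "j + (n - h) < j' \<or> j' + (n - h) < j" by auto
    ultimately show False using long_quad[OF h ij(1,2) _ ij(3,4)] q(5) by blast
  qed
  hence sub: "?B \<subseteq> B1 \<union> B2" by blast
  have "card B1 \<le> 1 * n ^ 3"
  proof (rule card_quads_coord(1)[OF fin cI cJ])
    fix i' j j'
    have "card {i. (i, i', j, j') \<in> B1} \<le> card {i'}" by (intro card_mono) (auto simp: B1_def)
    thus "card {i. (i, i', j, j') \<in> B1} \<le> 1" by simp
  qed (auto simp: B1_def)
  moreover have "card B2 \<le> (2 * (n - h) + 1) * n ^ 3"
  proof (rule card_quads_coord(3)[OF fin cI cJ])
    fix i i' j
    have "card {j'. (i, i', j, j') \<in> B2} \<le> card {j - (n - h)..j + (n - h)}"
      by (intro card_mono) (auto simp: B2_def)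
    thus "card {j'. (i, i', j, j') \<in> B2} \<le> 2 * (n - h) + 1" by simp
  qed (auto simp: B2_def)
  moreover have "card ?B \<le> card B1 + card B2"
  proof -
    have "finite (B1 \<union> B2)" using fin by (simp add: B1_def B2_def)
    from card_mono[OF this sub] show ?thesis by (rule order_trans[OF _ card_Un_le])
  qed
  moreover have "1 * n ^ 3 + (2 * (n - h) + 1) * n ^ 3 = (2 * (n - h) + 2) * n ^ 3"
    by (simp add: add_mult_distrib)
  ultimately show ?thesis by linarith
qed

text \<open>Averaging over n consecutive translates of the window: together they cover each residue
  \<open>w\<close> times.\<close>

lemma dense_window:
  assumes per: "\<And>x. P (x mod n) \<longleftrightarrow> P x"
  shows "\<exists>c. w * card {x. x < n \<and> P x} \<le> n * card {x \<in> {c..<c + w}. P x}"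
proof (rule ccontr)
  assume "\<not> ?thesis"
  hence less: "n * card {x \<in> {c..<c + w}. P x} < w * card {x. x < n \<and> P x}" for c by (meson not_le)
  have win: "card {x \<in> {c..<c + w}. P x} = (\<Sum>l<w. if P (l + c) then 1 else 0)" for c
  proof -
    have "card {x \<in> {c..<c + w}. P x} = card {l \<in> {..<w}. P (l + c)}"
      by (rule bij_betw_same_card[of "\<lambda>x. x - c"], rule bij_betw_byWitness[where f' = "\<lambda>l. l + c"]) auto
    thus ?thesis by (simp add: sum.If_cases Int_def)
  qed
  have "(\<Sum>c<n. card {x \<in> {c..<c + w}. P x}) = (\<Sum>l<w. \<Sum>c<n. if P (l + c) then 1 else 0)"
    unfolding win by (rule sum.swap)
  also have "\<dots> = (\<Sum>l<w. card {x. x < n \<and> P x})"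
  proof (rule sum.cong[OF refl])
    fix l
    have "(\<Sum>c<n. if P (l + c) then 1 else 0) = card {c. c < n \<and> P (c + l)}"
      by (simp add: sum.If_cases Int_def add.commute)
    thus "(\<Sum>c<n. if P (l + c) then 1 else 0) = card {x. x < n \<and> P x}" using card_shift[of P l, OF per] by simp
  qed
  finally have "n * (\<Sum>c<n. card {x \<in> {c..<c + w}. P x}) = n * (w * card {x. x < n \<and> P x})" by simp
  moreover have "(\<Sum>c<n. n * card {x \<in> {c..<c + w}. P x}) < (\<Sum>c<n. w * card {x. x < n \<and> P x})"
    using n2 less by (intro sum_strict_mono) (auto simp: lessThan_empty_iff)
  ultimately show False by (simp add: sum_distrib_left)
qed

lemma row_mod: "row X (a mod n) = row X a" and col_mod: "col X (a mod n) = col X a"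
  by (simp_all add: row_def col_def ch_mod)

text \<open>Row and column sizes add up to 2 |X| \<ge> (1 + 2 d) n^2, and a single index contributes
  at most 2 n.\<close>

lemma card_rich:
  fixes d :: real
  assumes d: "0 < d" "d \<le> 1" and X: "X \<subseteq> chords" "(1/2 + d) * card chords \<le> card X"
  shows "d / 2 * n \<le> card {a. a < n \<and> (1 + d) * n \<le> row X a + col X a}"
proof -
  define I where "I = {a. a < n \<and> (1 + d) * n \<le> row X a + col X a}"
  have finI: "finite I" "I \<subseteq> {..<n}" by (auto simp: I_def)
  have n0: "0 < real n" using n2 by simp
  have "(1 + 2 * d) * (real n)\<^sup>2 \<le> 2 * real (card X)" using X by (simp add: card_chords algebra_simps)
  also have "2 * real (card X) = (\<Sum>i<n. real (row X i + col X i))"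
    using sum_row[OF X(1)] sum_col[OF X(1)] by (simp add: sum.distrib flip: of_nat_sum)
  also have "\<dots> \<le> (\<Sum>i<n. (if i \<in> I then 2 * real n else 0) + (1 + d) * n)"
  proof (rule sum_mono)
    fix i assume "i \<in> {..<n}"
    hence i: "i < n" by simp
    have "real (row X i + col X i) \<le> 2 * n" using row_le[of X i] col_le[of X i] by simp
    moreover have "0 \<le> (1 + d) * n" using d by simp
    ultimately show "real (row X i + col X i) \<le> (if i \<in> I then 2 * real n else 0) + (1 + d) * n"
      using i unfolding I_def by auto
  qed
  also have "\<dots> = card I * (2 * n) + (1 + d) * (real n)\<^sup>2"
    using finI by (simp add: sum.distrib sum.If_cases Int_absorb1 power2_eq_square)
  finally have "d / 2 * n * n \<le> card I * real n" by (simp add: power2_eq_square algebra_simps)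
  hence "d / 2 * n \<le> card I" using n0 by simp
  thus ?thesis unfolding I_def .
qed

text \<open>The four-chord cycles need i, i' to precede j, j' cyclically. So \<open>I\<close> takes
  the rich indices of a window of length about d n / 4, and \<open>J\<close> is the rest of the
  period up to a margin for the larger gap. For a rich i, row and column have a surplus d n over n,
  of which window and margin use at most half. Hence \<kappa> = (d^2 n / 16) (d n / 2)^2, and
  3538944 = 18 * 24 * 8192.\<close>

lemma shortcut_system_long:
  fixes d :: real
  assumes d: "0 < d" "d \<le> 1" and h: "2 \<le> h" "h < n" and m: "real (n - h) \<le> d ^ 8 * n / 32768"
    and n: "8 \<le> d * n"
  shows "shortcut_system 4 (2 * h) (24 * (real n)\<^sup>2) (real n powr (-2/3)) (d ^ 8 / 3538944) (1/2 + d)"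
proof -
  define m where "m = n - h"
  let ?sB = "\<lambda>i j. ch (j + 1) i" and ?sD = "\<lambda>i j. ch (j + (n - h + 1)) i"
  define Q where "Q = cycle_quads (2 * h) ch ?sB ch ?sD"
  interpret quad_hypergraph n chords ch ?sB ch ?sD Q
  proof unfold_locales
    show "inj_on (\<lambda>(i, j). ?sB i j) ({..<n} \<times> {..<n})" by (rule inj_on_ch_shift(2))
    show "inj_on (\<lambda>(i, j). ?sD i j) ({..<n} \<times> {..<n})" by (rule inj_on_ch_shift(2))
  qed (auto simp: inj_on_ch ch_chords Q_def cycle_quads_def)
  have n0: "0 < real n" using n2 by simp
  \<comment> \<open>d n / 4 is at least 2, so rounding down loses at most half.\<close>
  define w where "w = nat \<lfloor>d * n / 4\<rfloor>"
  have w: "d * n / 8 \<le> w" "w \<le> d * n / 4"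
    using n d unfolding w_def by linarith+
  have m1: "1 \<le> m" using h by (simp add: m_def)
  have m_le: "real m + 1 \<le> d * n / 4"
  proof -
    have "d ^ 8 \<le> d ^ 1" using d by (intro power_decreasing) auto
    hence "d ^ 8 * n \<le> d * n" by (intro mult_right_mono) auto
    hence "real m \<le> d * n / 32768" using m by (simp add: m_def)
    thus ?thesis using n m1 by linarith
  qed
  have dn: "d * n \<le> n" using d n0 by simp
  have wm: "w + (m + 1) \<le> n"
  proof -
    have "real (w + (m + 1)) = real w + (real m + 1)" by simp
    hence "real (w + (m + 1)) \<le> n" using w(2) m_le dn n0 by linarith
    thus ?thesis by (simp only: of_nat_le_iff)
  qed
  have "d ^ 8 / 3538944 * (24 * (real n)\<^sup>2) * card chords \<le> card {e \<in> H. e \<subseteq> X}"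
    if X: "X \<subseteq> chords" "(1/2 + d) * card chords \<le> card X" for X
  proof -
    let ?P = "\<lambda>a. (1 + d) * n \<le> row X a + col X a"
    obtain c where c: "w * card {a. a < n \<and> ?P a} \<le> n * card {a \<in> {c..<c + w}. ?P a}"
      using dense_window[of ?P w] by (auto simp: row_mod col_mod)
    define I where "I = {a \<in> {c..<c + w}. ?P a}"
    define J where "J = {c + w..<c + n - (n - h + 1)}"
    have cJ: "n \<le> card J + (w + (m + 1))" using wm by (simp add: J_def m_def)
    have "d / 2 * w * n \<le> w * real (card {a. a < n \<and> ?P a})"
      using mult_left_mono[OF card_rich[OF d X], of "real w"] by (simp add: mult_ac)
    also have "\<dots> = real (w * card {a. a < n \<and> ?P a})" by (simp only: of_nat_mult)
    also have "\<dots> \<le> real (n * card I)" using c unfolding I_def by (rule of_nat_mono)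
    also have "\<dots> = real n * real (card I)" by (simp only: of_nat_mult)
    finally have "d / 2 * w \<le> card I" using n0 by (simp add: mult.commute)
    moreover have "d / 2 * (d * n / 8) \<le> d / 2 * w" using w(1) d by (intro mult_left_mono) auto
    ultimately have cI: "d\<^sup>2 * n / 16 \<le> card I" by (simp add: power2_eq_square)
    have count: "d * n / 2 \<le> card {j \<in> J. ch i j \<in> X \<and> ch (j + s) i \<in> X}" if i: "i \<in> I" for i s
    proof -
      have "card {x. x < n \<and> ch i x \<in> X} + card {x. x < n \<and> ch (x + s) i \<in> X} \<le>
          card {j \<in> J. ch i j \<in> X \<and> ch (j + s) i \<in> X} + n + (w + (m + 1))"
      proof (rule card_inter_window[where c = c])
        show "n \<le> card J + (w + (m + 1))" by (rule cJ)
      qed (use n2 in \<open>auto simp: ch_mod ch_mod_add J_def\<close>)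
      hence "row X i + col X i \<le> card {j \<in> J. ch i j \<in> X \<and> ch (j + s) i \<in> X} + n + (w + (m + 1))"
        unfolding row_def col_shift .
      hence "real (row X i + col X i) \<le> real (card {j \<in> J. ch i j \<in> X \<and> ch (j + s) i \<in> X} + n + (w + (m + 1)))"
        by (simp only: of_nat_le_iff)
      moreover have "(1 + d) * n \<le> real (row X i + col X i)" using i by (simp add: I_def)
      ultimately show ?thesis using w(2) m_le by (simp add: algebra_simps)
    qed
    define \<kappa> where "\<kappa> = d ^ 4 * n ^ 3 / 64"
    have "\<kappa> = d\<^sup>2 * n / 16 * (d * n / 2 * (d * n / 2))" by (simp add: \<kappa>_def eval_nat_numeral)
    also have "\<dots> \<le> card I * (d * n / 2 * (d * n / 2))" using cI d by (intro mult_right_mono) auto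
    also have "\<dots> = (\<Sum>i\<in>I. d * n / 2 * (d * n / 2))" by simp
    also have "\<dots> \<le> (\<Sum>i\<in>I. real (card {j \<in> J. ch i j \<in> X \<and> ?sB i j \<in> X}) *
        card {j \<in> J. ch i j \<in> X \<and> ?sD i j \<in> X})"
      using d by (intro sum_mono mult_mono count) auto
    finally have \<kappa>: "\<kappa> \<le> (\<Sum>i\<in>I. real (card {j \<in> J. ch i j \<in> X \<and> ?sB i j \<in> X}) *
        card {j \<in> J. ch i j \<in> X \<and> ?sD i j \<in> X})" .
    have "\<kappa>\<^sup>2 \<le> (real n)\<^sup>2 * (18 * real (card {e \<in> H. e \<subseteq> X}) + real ((2 * (n - h) + 2) * n ^ 3))"
    proof (rule card_edges_window[where c = c and I = I and J = J])
      show "card {(i, i', j, j'). i \<in> I \<and> i' \<in> I \<and> j \<in> J \<and> j' \<in> J \<and>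
          (i mod n, i' mod n, j mod n, j' mod n) \<notin> Q} \<le> (2 * (n - h) + 2) * n ^ 3"
        unfolding Q_def by (rule long_cycle_quads_bad[OF h, where w = w]) (use wm in \<open>auto simp: I_def J_def\<close>)
      show "I \<subseteq> {c..<c + n}" "J \<subseteq> {c..<c + n}" using wm by (auto simp: I_def J_def)
      show "0 \<le> \<kappa>" using d by (simp add: \<kappa>_def)
    qed (use \<kappa> in \<open>simp_all only: ch_mod ch_mod_add\<close>)
    also have "\<dots> \<le> (real n)\<^sup>2 * (18 * real (card {e \<in> H. e \<subseteq> X}) + d ^ 8 * n ^ 4 / 8192)"
    proof -
      have "real (2 * (n - h) + 2) \<le> 4 * real (n - h)" using m1 by (simp add: m_def)
      also have "\<dots> \<le> d ^ 8 * n / 8192" using m by simp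
      finally have le: "real (2 * (n - h) + 2) \<le> d ^ 8 * n / 8192" .
      have "real ((2 * (n - h) + 2) * n ^ 3) = real (2 * (n - h) + 2) * real n ^ 3"
        by (simp only: of_nat_mult of_nat_power)
      also have "\<dots> \<le> d ^ 8 * n / 8192 * real n ^ 3" using le by (intro mult_right_mono) auto
      also have "\<dots> = d ^ 8 * n ^ 4 / 8192" by (simp add: power_eq_if)
      finally show ?thesis by (intro mult_left_mono add_left_mono) auto
    qed
    finally have "\<kappa>\<^sup>2 \<le> (real n)\<^sup>2 * (18 * real (card {e \<in> H. e \<subseteq> X}) + d ^ 8 * n ^ 4 / 8192)" .
    moreover have "\<kappa>\<^sup>2 = (real n)\<^sup>2 * (d ^ 8 * n ^ 4 / 4096)"
      by (simp add: \<kappa>_def field_simps eval_nat_numeral)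
    ultimately have "(real n)\<^sup>2 * (d ^ 8 * n ^ 4 / 4096) \<le> (real n)\<^sup>2 * (18 * real (card {e \<in> H. e \<subseteq> X}) + d ^ 8 * n ^ 4 / 8192)"
      by (simp only:)
    hence "d ^ 8 * n ^ 4 / 4096 \<le> 18 * real (card {e \<in> H. e \<subseteq> X}) + d ^ 8 * n ^ 4 / 8192" using n0 by simp
    moreover have "d ^ 8 / 3538944 * (24 * (real n)\<^sup>2) * card chords = d ^ 8 * n ^ 4 / 147456"
      by (simp add: card_chords eval_nat_numeral)
    ultimately show ?thesis by linarith
  qed
  moreover have "has_cycle_of_length (cyc \<union> e) (2 * h)" if "e \<in> H" for e
  proof -
    from that obtain q where q: "q \<in> Q" "e = edge q" unfolding H_def by blast
    obtain i i' j j' where "q = (i, i', j, j')" by (cases q) auto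
    thus ?thesis using q unfolding Q_def cycle_quads_def edge_def by simp
  qed
  ultimately show ?thesis
    unfolding shortcut_system_def using uniform degrees[OF _ finite_chords] n2 by (intro exI[of _ H]) auto
qed

end

text \<open>
  The index of the partner of the chord \<open>(a, a + u)\<close>: for \<open>u \<le> h - 2\<close> the two chords cross and the
  cycle omits two gaps, otherwise they are parallel and the cycle uses two segments. The resulting
  map is a rotation of the interval \<open>{y + 1..n - 1 - y}\<close>.
\<close>
definition partner :: "nat \<Rightarrow> nat \<Rightarrow> nat \<Rightarrow> nat \<Rightarrow> nat" where
  "partner n h y u = (if u + 2 \<le> h then u + 1 + (n - h) - y else u + 2 + y - h)"

text \<open>The part of the interval up to h - 2 is shifted up and the part from h - 1 on is shifted
  down, with disjoint images inside the interval; an injective self-map of a finite set is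
  onto.\<close>

lemma bij_betw_partner:
  assumes "h < n" "y \<le> n - h" "y + 2 \<le> h"
  shows "bij_betw (partner n h y) {y + 1..n - 1 - y} {y + 1..n - 1 - y}"
proof -
  have "inj_on (partner n h y) {y + 1..n - 1 - y}"
    using assms by (auto simp: inj_on_def partner_def split: if_splits)
  moreover have "partner n h y ` {y + 1..n - 1 - y} \<subseteq> {y + 1..n - 1 - y}"
    using assms by (auto simp: partner_def split: if_splits)
  ultimately show ?thesis by (simp add: bij_betw_def endo_inj_surj)
qed

section \<open>Pairs of chords for intermediate lengths\<close>

context ham_labelling
begin

text \<open>With p = \<open>partner n h y u\<close>, the cycle length is 2 (u - y + 1 + n - p) for
  crossing and 2 (y + u + 2 - p) for parallel chords; \<open>partner\<close> solves both for length
  2 h.\<close>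

lemma two_chord_cycle:
  assumes h: "h < n" and y: "y \<le> n - h" "y + 2 \<le> h" and u: "u \<in> {y + 1..n - 1 - y}"
    and E: "cyc \<subseteq> E" "ch a (a + u) \<in> E" "ch (a + partner n h y u) (a + y) \<in> E"
  shows "has_cycle_of_length E (2 * h)"
proof -
  have e: "{v (2 * a), v (2 * (a + u) + 1)} \<in> E"
    "{v (2 * (a + y) + 1), v (2 * (a + partner n h y u))} \<in> E"
    using E(2,3) by (simp_all add: ch_def insert_commute)
  show ?thesis
  proof (cases "u + 2 \<le> h")
    case True
    hence p: "partner n h y u = u + 1 + (n - h) - y" by (simp add: partner_def)
    show ?thesis
      by (rule cycle_two_chords_crossing[OF E(1) _ _ _ _ _ _ e]) (use True p h y u in auto)
  next
    case False
    hence p: "partner n h y u = u + 2 + y - h" by (simp add: partner_def)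
    show ?thesis
      by (rule cycle_two_chords_parallel[OF E(1) _ _ _ _ _ _ e]) (use False p h y u in auto)
  qed
qed

text \<open>The shift \<open>y\<close> leads from the even end of the first chord to the odd end of
  the second. Without this third parameter there would be only about n^2 pairs.\<close>

definition pair_index :: "nat \<Rightarrow> (nat \<times> nat \<times> nat) set" where
  "pair_index Y = {(a, u, y). a < n \<and> y < Y \<and> u \<in> {y + 1..n - 1 - y}}"

definition chord1 :: "nat \<times> nat \<times> nat \<Rightarrow> 'a set" where
  "chord1 = (\<lambda>(a, u, y). ch a (a + u))"

definition chord2 :: "nat \<Rightarrow> nat \<times> nat \<times> nat \<Rightarrow> 'a set" where
  "chord2 h = (\<lambda>(a, u, y). ch (a + partner n h y u) (a + y))"

context
  fixes h Y :: nat
  assumes h: "h < n" and Y: "Y \<le> n - h" "Y + 2 \<le> h"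
begin

lemma finite_pair_index: "finite (pair_index Y)"
  by (rule finite_subset[of _ "{..<n} \<times> {..<n} \<times> {..<Y}"]) (auto simp: pair_index_def)

lemma add_mod_eq_iff: "x < n \<Longrightarrow> y < n \<Longrightarrow> (a + x) mod n = (a + y) mod n \<longleftrightarrow> x = y"
  using mod_add_right_eq_iff[of x a n y] by (simp add: add.commute)

lemma partner_range: "y < Y \<Longrightarrow> u \<in> {y + 1..n - 1 - y} \<Longrightarrow> partner n h y u \<in> {y + 1..n - 1 - y}"
  using bij_betw_partner[OF h, of y] Y by (auto simp: bij_betw_def)

lemma partner_eq_iff:
  "y < Y \<Longrightarrow> u \<in> {y + 1..n - 1 - y} \<Longrightarrow> u' \<in> {y + 1..n - 1 - y} \<Longrightarrow>
    partner n h y u = partner n h y u' \<longleftrightarrow> u = u'"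
  using bij_betw_partner[OF h, of y] Y by (auto simp: bij_betw_def inj_on_def)

lemma chord1_eqD:
  assumes "(a, u, y) \<in> pair_index Y" "(a', u', y') \<in> pair_index Y" "chord1 (a, u, y) = chord1 (a', u', y')"
  shows "a = a' \<and> u = u'"
proof -
  have lt: "a < n" "a' < n" "u < n" "u' < n" using assms(1,2) by (auto simp: pair_index_def)
  have "a mod n = a' mod n" "(a + u) mod n = (a' + u') mod n"
    using assms(3) by (auto simp: chord1_def ch_eq_iff)
  thus ?thesis using lt add_mod_eq_iff by auto
qed

lemma chord2_eqD:
  assumes "(a, u, y) \<in> pair_index Y" "(a', u', y) \<in> pair_index Y"
    "chord2 h (a, u, y) = chord2 h (a', u', y)"
  shows "a = a' \<and> u = u'"
proof -
  have lt: "a < n" "a' < n" "y < Y" and u: "u \<in> {y + 1..n - 1 - y}" "u' \<in> {y + 1..n - 1 - y}"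
    using assms(1,2) by (auto simp: pair_index_def)
  have p: "partner n h y u < n" "partner n h y u' < n"
    using partner_range[OF lt(3) u(1)] partner_range[OF lt(3) u(2)] n2 by auto
  have "(y + a) mod n = (y + a') mod n" "(a + partner n h y u) mod n = (a' + partner n h y u') mod n"
    using assms(3) by (auto simp: chord2_def ch_eq_iff add.commute)
  hence "a = a'" "partner n h y u = partner n h y u'"
    using lt p add_mod_eq_iff by auto
  thus ?thesis using partner_eq_iff[OF lt(3) u] by simp
qed

lemma chord12_eqD:
  assumes "(a, u, y) \<in> pair_index Y" "(a, u, y') \<in> pair_index Y"
    "chord2 h (a, u, y) = chord2 h (a, u, y')"
  shows "y = y'"
proof -
  have "y < n" "y' < n" using assms(1,2) Y h by (auto simp: pair_index_def)
  moreover have "(a + y) mod n = (a + y') mod n" using assms(3) by (auto simp: chord2_def ch_eq_iff)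
  ultimately show ?thesis using add_mod_eq_iff by auto
qed

lemma chord1_neq_chord2:
  assumes "q \<in> pair_index Y"
  shows "chord1 q \<noteq> chord2 h q"
proof -
  obtain a u y where q: "q = (a, u, y)" by (cases q) auto
  have "u < n" "y < n" "u \<noteq> y" using assms q Y h by (auto simp: pair_index_def)
  thus ?thesis using add_mod_eq_iff[of u y a] by (auto simp: q chord1_def chord2_def ch_eq_iff)
qed

definition pair_hypergraph :: "'a set set set" where
  "pair_hypergraph = (\<lambda>q. {chord1 q, chord2 h q}) ` pair_index Y"

lemma pair_uniform: "uniform_hypergraph 2 chords pair_hypergraph"
  unfolding uniform_hypergraph_def pair_hypergraph_def
proof
  fix e assume "e \<in> (\<lambda>q. {chord1 q, chord2 h q}) ` pair_index Y"
  then obtain q where q: "q \<in> pair_index Y" "e = {chord1 q, chord2 h q}" by blast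
  have "card e = 2" unfolding q(2) using chord1_neq_chord2[OF q(1)] by simp
  moreover have "e \<subseteq> chords" unfolding q(2)
    by (cases q) (simp add: chord1_def chord2_def ch_chords)
  ultimately show "e \<subseteq> chords \<and> card e = 2" by simp
qed

lemma finite_pair_hypergraph: "finite pair_hypergraph"
  by (simp add: pair_hypergraph_def finite_pair_index)

text \<open>A chord, its role as first or second chord, and \<open>y\<close> determine the triple:
  at most 2 Y \<le> 2 n. A pair of chords has degree at most 1, below D \<tau> = 2.\<close>

lemma pair_degrees: "degrees_bounded chords pair_hypergraph (2 * real n) (1 / real n)"
  unfolding degrees_bounded_def
proof (intro allI impI)
  fix T assume T: "T \<subseteq> chords \<and> T \<noteq> {}"
  have finT: "finite T" using T finite_chords finite_subset by blast
  have n0: "0 < real n" using n2 by simp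
  have cardE: "card e = 2" if "e \<in> pair_hypergraph" for e
    using pair_uniform that by (simp add: uniform_hypergraph_def)
  consider "card T = 1" | "card T = 2" | "card T > 2"
    using T finT by (cases "card T = 0") force+
  thus "real (deg pair_hypergraph T) \<le> 2 * real n * (1 / real n) ^ (card T - 1)"
  proof cases
    case 1
    then obtain t where t: "T = {t}" by (auto simp: card_1_singleton_iff)
    define P1 where "P1 = {q \<in> pair_index Y. chord1 q = t}"
    define P2 where "P2 = {q \<in> pair_index Y. chord2 h q = t}"
    have fin: "finite (P1 \<union> P2)" using finite_pair_index by (simp add: P1_def P2_def)
    have "inj_on (\<lambda>q. snd (snd q)) P1"
    proof (rule inj_onI)
      fix q q' assume qq: "q \<in> P1" "q' \<in> P1" "snd (snd q) = snd (snd q')"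
      obtain a u y where q: "q = (a, u, y)" by (cases q) auto
      obtain a' u' y' where q': "q' = (a', u', y')" by (cases q') auto
      show "q = q'" using qq chord1_eqD[of a u y a' u' y'] by (auto simp: P1_def q q')
    qed
    hence "card P1 \<le> card {..<Y}" by (rule card_inj_on_le) (auto simp: P1_def pair_index_def)
    moreover have "inj_on (\<lambda>q. snd (snd q)) P2"
    proof (rule inj_onI)
      fix q q' assume qq: "q \<in> P2" "q' \<in> P2" "snd (snd q) = snd (snd q')"
      obtain a u y where q: "q = (a, u, y)" by (cases q) auto
      obtain a' u' y' where q': "q' = (a', u', y')" by (cases q') auto
      show "q = q'" using qq chord2_eqD[of a u y a' u'] by (auto simp: P2_def q q')
    qed
    hence "card P2 \<le> card {..<Y}" by (rule card_inj_on_le) (auto simp: P2_def pair_index_def)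
    moreover have "deg pair_hypergraph T \<le> card P1 + card P2"
    proof -
      have "{e \<in> pair_hypergraph. T \<subseteq> e} \<subseteq> (\<lambda>q. {chord1 q, chord2 h q}) ` (P1 \<union> P2)"
        by (auto simp: pair_hypergraph_def t P1_def P2_def)
      hence "deg pair_hypergraph T \<le> card (P1 \<union> P2)"
        unfolding deg_def using surj_card_le[OF fin] by blast
      thus ?thesis using card_Un_le[of P1 P2] by linarith
    qed
    ultimately have "deg pair_hypergraph T \<le> 2 * n" using Y h by simp
    hence "real (deg pair_hypergraph T) \<le> real (2 * n)" by (rule of_nat_mono)
    thus ?thesis using 1 by simp
  next
    case 2
    have "e = T" if "e \<in> pair_hypergraph" "T \<subseteq> e" for e
    proof -
      have "finite e" using cardE[OF that(1)] by (metis card.infinite zero_neq_numeral)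
      thus ?thesis using card_subset_eq[of e T] that 2 cardE by simp
    qed
    hence "{e \<in> pair_hypergraph. T \<subseteq> e} \<subseteq> {T}" by blast
    hence "deg pair_hypergraph T \<le> card {T}" unfolding deg_def by (intro card_mono) auto
    thus ?thesis using 2 n0 by simp
  next
    case 3
    have "\<not> T \<subseteq> e" if "e \<in> pair_hypergraph" for e
    proof
      assume "T \<subseteq> e"
      moreover have "finite e" using cardE[OF that] by (metis card.infinite zero_neq_numeral)
      ultimately show False using card_mono[of e T] cardE[OF that] 3 by simp
    qed
    hence "{e \<in> pair_hypergraph. T \<subseteq> e} = {}" by blast
    hence "deg pair_hypergraph T = 0" unfolding deg_def by (simp only: card.empty)
    thus ?thesis using n0 by simp
  qed
qed

lemma pair_cycles: "e \<in> pair_hypergraph \<Longrightarrow> has_cycle_of_length (cyc \<union> e) (2 * h)"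
proof -
  assume "e \<in> pair_hypergraph"
  then obtain q where q: "q \<in> pair_index Y" "e = {chord1 q, chord2 h q}"
    by (auto simp: pair_hypergraph_def)
  obtain a u y where q': "q = (a, u, y)" by (cases q) auto
  show ?thesis
    by (rule two_chord_cycle[OF h, of y u _ a])
      (use q Y in \<open>auto simp: q' pair_index_def chord1_def chord2_def\<close>)
qed

text \<open>Once it is settled which chord of the edge is the first, it shows a and u, and the
  second then shows y.\<close>

lemma card_pairs_within:
  "card {q \<in> pair_index Y. chord1 q \<in> X \<and> chord2 h q \<in> X} \<le> 2 * card {e \<in> pair_hypergraph. e \<subseteq> X}"
proof (rule card_le_fibers[where f = "\<lambda>q. {chord1 q, chord2 h q}"])
  fix e assume "e \<in> {e \<in> pair_hypergraph. e \<subseteq> X}"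
  hence "card e = 2" using pair_uniform by (simp add: uniform_hypergraph_def)
  then obtain s t where st: "e = {s, t}" "s \<noteq> t" by (auto simp: card_2_iff)
  define P where "P s t = {q \<in> pair_index Y. chord1 q = s \<and> chord2 h q = t}" for s t
  have finP: "finite (P s t)" for s t using finite_pair_index by (simp add: P_def)
  have "card (P s t) \<le> 1" for s t
  proof -
    have "q = q'" if qq: "q \<in> P s t" "q' \<in> P s t" for q q'
    proof -
      obtain a u y where q: "q = (a, u, y)" by (cases q) auto
      obtain a' u' y' where q': "q' = (a', u', y')" by (cases q') auto
      have *: "a = a' \<and> u = u'"
        using qq chord1_eqD[of a u y a' u' y'] by (simp add: P_def q q')
      hence "y = y'" using qq chord12_eqD[of a u y y'] by (simp add: P_def q q')
      thus ?thesis using * by (simp add: q q')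
    qed
    thus ?thesis using card_le_Suc0_iff_eq[OF finP[of s t]] by auto
  qed
  hence "card (P s t) + card (P t s) \<le> 2" by (metis add_mono one_add_one)
  moreover have "{q \<in> {q \<in> pair_index Y. chord1 q \<in> X \<and> chord2 h q \<in> X}. {chord1 q, chord2 h q} = e} \<subseteq> P s t \<union> P t s"
    by (auto simp: P_def st doubleton_eq_iff)
  hence "card {q \<in> {q \<in> pair_index Y. chord1 q \<in> X \<and> chord2 h q \<in> X}. {chord1 q, chord2 h q} = e} \<le> card (P s t \<union> P t s)"
    by (intro card_mono) (simp_all add: finP)
  ultimately show "card {q \<in> {q \<in> pair_index Y. chord1 q \<in> X \<and> chord2 h q \<in> X}. {chord1 q, chord2 h q} = e} \<le> 2"
    using card_Un_le[of "P s t" "P t s"] by linarith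
qed (use finite_pair_index finite_pair_hypergraph in \<open>auto simp: pair_hypergraph_def\<close>)

text \<open>As u runs through the interval, so does its partner; hence Bondy's pigeonhole applies to
  the row of a and the column of a + y. The 2 y + 1 indices outside the interval are lost in row and
  column, but regained once, as the pigeonhole works in the shorter interval.\<close>

lemma card_pairs_at:
  assumes y: "y < Y"
  shows "row X a + col X (a + y) \<le>
    card {u \<in> {y + 1..n - 1 - y}. ch a (a + u) \<in> X \<and> ch (a + partner n h y u) (a + y) \<in> X} + n + (2 * y + 1)"
proof -
  let ?U = "{y + 1..n - 1 - y}"
  define P where "P = {u \<in> ?U. ch a (a + u) \<in> X}"
  define R where "R = {u \<in> ?U. ch (a + partner n h y u) (a + y) \<in> X}"
  define W where "W = {w \<in> ?U. ch (a + w) (a + y) \<in> X}"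
  have cU: "card ?U + (2 * y + 1) = n" using y Y h by simp
  have "?U \<subseteq> {..<n}" using n2 by auto
  hence "card ({..<n} - ?U) = n - card ?U" by (simp add: card_Diff_subset)
  hence cD: "card ({..<n} - ?U) = 2 * y + 1" using cU by simp
  have out: "card {x. x < n \<and> S x} \<le> card {x \<in> ?U. S x} + (2 * y + 1)" for S
  proof -
    have "card {x. x < n \<and> S x} \<le> card ({x \<in> ?U. S x} \<union> ({..<n} - ?U))" by (intro card_mono) auto
    also have "\<dots> \<le> card {x \<in> ?U. S x} + card ({..<n} - ?U)" by (rule card_Un_le)
    finally show ?thesis using cD by simp
  qed
  have "row X a \<le> card P + (2 * y + 1)"
    using out[of "\<lambda>u. ch a (a + u) \<in> X"] row_shift[of a a X] by (simp add: P_def add.commute)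
  moreover have "col X (a + y) \<le> card W + (2 * y + 1)"
    using out[of "\<lambda>w. ch (a + w) (a + y) \<in> X"] col_shift[of a "a + y" X] by (simp add: W_def add.commute)
  moreover have "card W = card R"
  proof -
    have bij: "bij_betw (partner n h y) ?U ?U" using bij_betw_partner[OF h, of y] Y y by simp
    have "bij_betw (partner n h y) R W"
      unfolding bij_betw_def
    proof
      show "inj_on (partner n h y) R"
        using bij by (auto simp: bij_betw_def R_def intro: inj_on_subset)
      have img: "partner n h y ` ?U = ?U" using bij by (simp add: bij_betw_def)
      show "partner n h y ` R = W"
      proof
        show "partner n h y ` R \<subseteq> W"
        proof
          fix w assume "w \<in> partner n h y ` R"
          then obtain u where u: "u \<in> ?U" "ch (a + partner n h y u) (a + y) \<in> X" "w = partner n h y u"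
            unfolding R_def by blast
          hence "w \<in> ?U" using img by blast
          thus "w \<in> W" using u(2,3) unfolding W_def by blast
        qed
        show "W \<subseteq> partner n h y ` R"
        proof
          fix w assume w: "w \<in> W"
          hence "w \<in> partner n h y ` ?U" unfolding img W_def by blast
          then obtain u where "u \<in> ?U" "w = partner n h y u" by blast
          thus "w \<in> partner n h y ` R" using w unfolding W_def R_def by blast
        qed
      qed
    qed
    thus ?thesis by (simp add: bij_betw_same_card)
  qed
  moreover have "card P + card R = card (P \<union> R) + card (P \<inter> R)"
    by (rule card_Un_Int) (simp_all add: P_def R_def)
  moreover have "card (P \<union> R) \<le> card ?U" by (intro card_mono) (auto simp: P_def R_def)
  moreover have "P \<inter> R = {u \<in> ?U. ch a (a + u) \<in> X \<and> ch (a + partner n h y u) (a + y) \<in> X}"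
    by (auto simp: P_def R_def)
  ultimately show ?thesis using cU by (simp only:)
qed

lemma sum_col_shift:
  assumes "X \<subseteq> chords"
  shows "(\<Sum>a<n. col X (a + y)) = card X"
proof -
  have "(\<Sum>a<n. col X (a + y)) = (\<Sum>x\<in>{y..<y + n}. col X x)"
    by (rule sum.reindex_bij_witness[of _ "\<lambda>x. x - y" "\<lambda>a. a + y"]) auto
  also have "\<dots> = (\<Sum>x\<in>{y..<y + n}. col X (x mod n))" by (simp add: col_mod)
  also have "\<dots> = (\<Sum>b<n. col X b)"
    using n2 by (intro sum.reindex_bij_betw bij_betw_mod_window) auto
  finally show ?thesis using sum_col[OF assms] by simp
qed

text \<open>Summed over a, rows and columns give 2 |X| \<ge> n^2 + 2 d n^2, and the loss n (2 y + 1)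
  \<le> 2 n Y uses at most d n^2 of the surplus.\<close>

lemma card_pairs_ge:
  fixes d :: real
  assumes X: "X \<subseteq> chords" "(1/2 + d) * card chords \<le> card X" and d: "2 * real Y \<le> d * n"
  shows "Y * (d * (real n)\<^sup>2) \<le> card {q \<in> pair_index Y. chord1 q \<in> X \<and> chord2 h q \<in> X}"
proof -
  let ?C = "\<lambda>y a. {u \<in> {y + 1..n - 1 - y}. ch a (a + u) \<in> X \<and> ch (a + partner n h y u) (a + y) \<in> X}"
  define c where "c = (\<lambda>y a. card (?C y a))"
  have "card {q \<in> pair_index Y. chord1 q \<in> X \<and> chord2 h q \<in> X} = card (SIGMA y:{..<Y}. SIGMA a:{..<n}. ?C y a)"
    by (rule bij_betw_same_card[of "\<lambda>(a, u, y). (y, a, u)"],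
        rule bij_betw_byWitness[where f' = "\<lambda>(y, a, u). (a, u, y)"])
      (auto simp: pair_index_def chord1_def chord2_def)
  also have "\<dots> = (\<Sum>y<Y. \<Sum>a<n. c y a)" by (simp add: card_SigmaI c_def)
  finally have eq: "card {q \<in> pair_index Y. chord1 q \<in> X \<and> chord2 h q \<in> X} = (\<Sum>y<Y. \<Sum>a<n. c y a)" .
  have "d * (real n)\<^sup>2 \<le> (\<Sum>a<n. real (c y a))" if y: "y < Y" for y
  proof -
    have "(\<Sum>a<n. row X a + col X (a + y)) \<le> (\<Sum>a<n. c y a + n + (2 * y + 1))"
      unfolding c_def by (intro sum_mono card_pairs_at[OF y])
    also have "\<dots> = (\<Sum>a<n. c y a) + n * n + n * (2 * y + 1)"
      unfolding sum.distrib by simp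
    also have "(\<Sum>a<n. row X a + col X (a + y)) = 2 * card X"
      using sum_row[OF X(1)] sum_col_shift[OF X(1), of y] by (simp add: sum.distrib)
    finally have "real (2 * card X) \<le> real ((\<Sum>a<n. c y a) + n * n + n * (2 * y + 1))"
      by (rule of_nat_mono)
    also have "\<dots> = (\<Sum>a<n. real (c y a)) + (real n)\<^sup>2 + n * (2 * real y + 1)"
      by (simp add: power2_eq_square algebra_simps)
    finally have "2 * real (card X) \<le> (\<Sum>a<n. real (c y a)) + (real n)\<^sup>2 + n * (2 * real y + 1)" by simp
    moreover have "real n * (2 * real y + 1) \<le> real n * (d * n)"
    proof (rule mult_left_mono)
      have "2 * y + 1 \<le> 2 * Y" using y by simp
      hence "real (2 * y + 1) \<le> real (2 * Y)" by (rule of_nat_mono)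
      thus "2 * real y + 1 \<le> d * n" using d by simp
    qed simp
    moreover have "real n * (d * n) = d * (real n)\<^sup>2" by (simp add: power2_eq_square)
    moreover have "(1/2 + d) * (real n)\<^sup>2 \<le> card X" using X(2) by (simp add: card_chords)
    hence "(real n)\<^sup>2 / 2 + d * (real n)\<^sup>2 \<le> card X" by (simp add: algebra_simps)
    ultimately show ?thesis by linarith
  qed
  hence "(\<Sum>y<Y. d * (real n)\<^sup>2) \<le> (\<Sum>y<Y. \<Sum>a<n. real (c y a))" by (intro sum_mono) auto
  thus ?thesis unfolding eq by simp
qed

lemma shortcut_system_pairs:
  fixes d c :: real
  assumes d: "2 * real Y \<le> d * n" "0 < d" and c: "c * n \<le> Y"
  shows "shortcut_system 2 (2 * h) (2 * real n) (1 / real n) (c * d / 4) (1/2 + d)"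
  unfolding shortcut_system_def
proof (intro exI[of _ pair_hypergraph] conjI ballI allI impI)
  fix X assume X: "X \<subseteq> chords" "(1/2 + d) * card chords \<le> card X"
  have "c * n * (d * (real n)\<^sup>2) \<le> Y * (d * (real n)\<^sup>2)" using c d by (intro mult_right_mono) auto
  also have "\<dots> \<le> card {q \<in> pair_index Y. chord1 q \<in> X \<and> chord2 h q \<in> X}"
    by (rule card_pairs_ge[OF X d(1)])
  also have "\<dots> \<le> real (2 * card {e \<in> pair_hypergraph. e \<subseteq> X})"
    using card_pairs_within by (rule of_nat_mono)
  finally show "c * d / 4 * (2 * real n) * card chords \<le> card {e \<in> pair_hypergraph. e \<subseteq> X}"
    by (simp add: card_chords power2_eq_square mult_ac)
qed (use pair_uniform pair_degrees pair_cycles in auto)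

end

end

section \<open>Subgraphs of the random bipartite graph\<close>

lemma (in ham_labelling) shortcut_system_mono:
  assumes "shortcut_system r k D \<tau> \<beta> \<alpha>" "\<beta>' \<le> \<beta>" "0 \<le> D"
  shows "shortcut_system r k D \<tau> \<beta>' \<alpha>"
proof -
  have "\<beta>' * D * card chords \<le> \<beta> * D * card chords" using assms by (intro mult_right_mono) auto
  thus ?thesis using assms(1) unfolding shortcut_system_def by (meson order_trans)
qed

text \<open>\<open>\<eta>\<close> is small enough that quadruples handle h \<le> \<eta> n and n - h
  \<le> \<eta> n. Otherwise about \<eta> n / 2 shifts are available for pairs, and \<eta> n \<ge> 4
  pays for rounding and for Y + 2 \<le> h.\<close>

lemma (in ham_labelling) shortcut_system_cases:
  fixes d :: real
  defines "\<eta> \<equiv> d ^ 8 / 32768"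
  assumes d: "0 < d" "d \<le> 1" and h: "2 \<le> h" "h < n" and n: "8 \<le> d * n" "4 \<le> \<eta> * n"
  shows "shortcut_system 4 (2 * h) (24 * (real n)\<^sup>2) (real n powr (-2/3)) (d ^ 8 / 3538944) (1/2 + d) \<or>
    shortcut_system 2 (2 * h) (2 * real n) (1 / real n) (\<eta> * d / 16) (1/2 + d)"
proof -
  have \<eta>d: "\<eta> \<le> d ^ 4 / 96" "\<eta> \<le> d"
  proof -
    have "d ^ 8 \<le> d ^ 4" "d ^ 8 \<le> d ^ 1" using d by (intro power_decreasing; simp)+
    moreover have "0 \<le> d ^ 4" using d by simp
    moreover have "d ^ 1 = d" by simp
    ultimately show "\<eta> \<le> d ^ 4 / 96" "\<eta> \<le> d" using d(1) unfolding \<eta>_def by linarith+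
  qed
  consider "real h \<le> d ^ 4 * n / 96" | "real (n - h) \<le> d ^ 8 * n / 32768"
    | "\<eta> * n < h" "\<eta> * n < real (n - h)"
  proof -
    have 1: "\<eta> * n \<le> d ^ 4 * n / 96" using mult_right_mono[OF \<eta>d(1), of "real n"] by simp
    have 2: "\<eta> * n = d ^ 8 * n / 32768" by (simp add: \<eta>_def)
    show ?thesis
    proof (cases "real h \<le> d ^ 4 * n / 96")
      case False
      show ?thesis
      proof (cases "real (n - h) \<le> d ^ 8 * n / 32768")
        case le: False
        show ?thesis by (rule that(3)) (use 1 2 False le in linarith)+
      qed (rule that(2))
    qed (rule that(1))
  qed
  thus ?thesis
  proof cases
    case 1
    have "d ^ 8 \<le> d ^ 4" using d by (intro power_decreasing) auto
    moreover have "0 \<le> d ^ 4" using d by simp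
    ultimately have "d ^ 8 / 3538944 \<le> d ^ 4 / 13824" by linarith
    thus ?thesis using shortcut_system_mono[OF shortcut_system_short[OF d h 1]] by simp
  next
    case 2
    thus ?thesis using shortcut_system_long[OF d h 2 n(1)] by simp
  next
    case 3
    define Y where "Y = nat \<lfloor>\<eta> * n / 2\<rfloor>"
    have Y: "\<eta> / 4 * n \<le> Y" "Y \<le> \<eta> * n / 2" using n unfolding Y_def by linarith+
    have Y': "Y \<le> n - h" "Y + 2 \<le> h"
    proof -
      have "real Y \<le> real (n - h)" "real (Y + 2) \<le> real h" using 3 Y(2) n(2) by simp_all
      thus "Y \<le> n - h" "Y + 2 \<le> h" by linarith+
    qed
    have "\<eta> * n \<le> d * n" using \<eta>d(2) by (intro mult_right_mono) auto
    hence "2 * real Y \<le> d * n" using Y(2) by simp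
    from shortcut_system_pairs[OF h(2) Y' this d(1) Y(1)]
    show ?thesis by simp
  qed
qed

text \<open>An edge of the shortcut hypergraph inside a set that contains the Hamilton cycle would
  create a k-cycle there; so the sets in question are independent.\<close>

lemma (in ham_labelling) containers_of_shortcuts:
  assumes sys: "shortcut_system r k D \<tau> \<beta> \<alpha>"
    and cont: "\<And>H. uniform_hypergraph r chords H \<Longrightarrow> degrees_bounded chords H D \<tau> \<Longrightarrow>
      (\<And>X. X \<subseteq> chords \<Longrightarrow> \<alpha> * card chords \<le> card X \<Longrightarrow> \<beta> * D * card chords \<le> card {e \<in> H. e \<subseteq> X}) \<Longrightarrow>
      has_containers chords (independent H) s a"
    and le: "s \<le> s'"
  shows "has_containers chords (\<lambda>I. cyc \<subseteq> I \<and> \<not> has_cycle_of_length I k) s' a"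
proof -
  from sys obtain H where H: "uniform_hypergraph r chords H \<and> degrees_bounded chords H D \<tau> \<and>
      (\<forall>e\<in>H. has_cycle_of_length (cyc \<union> e) k) \<and>
      (\<forall>X\<subseteq>chords. \<alpha> * card chords \<le> card X \<longrightarrow> \<beta> * D * card chords \<le> card {e \<in> H. e \<subseteq> X})"
    unfolding shortcut_system_def ..
  have c: "has_containers chords (independent H) s a" using H by (intro cont) simp_all
  have indep: "independent H I" if I: "cyc \<subseteq> I \<and> \<not> has_cycle_of_length I k" for I
    unfolding independent_def
  proof (intro ballI notI)
    fix e assume "e \<in> H" "e \<subseteq> I"
    hence "has_cycle_of_length (cyc \<union> e) k" "cyc \<union> e \<subseteq> I" using H I by simp_all
    thus False using has_cycle_of_length_mono I by blast
  qed
  show ?thesis by (rule has_containers_mono[OF c indep le])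
qed

text \<open>\<open>K\<close> and \<open>n0\<close> depend on d only: for all cycles and lengths
  together just two choices of r, \<beta> and B occur, so the container theorem is invoked twice.
  The sizes \<tau> n^2 are n^(4/3) and n.\<close>

lemma cycle_containers:
  fixes d :: real
  assumes d: "0 < d" "d \<le> 1"
  obtains K n0 where "0 < K" "\<And>n (v :: nat \<Rightarrow> 'a) h. ham_labelling n v \<Longrightarrow> n0 \<le> n \<Longrightarrow> 2 \<le> h \<Longrightarrow> h < n \<Longrightarrow>
    has_containers (ham_labelling.chords n v)
      (\<lambda>I. ham_labelling.cyc v \<subseteq> I \<and> \<not> has_cycle_of_length I (2 * h))
      (K * real n powr (4/3)) ((1/2 + d) * (real n)\<^sup>2)"
proof -
  define \<eta> where "\<eta> = d ^ 8 / 32768"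
  have \<eta>0: "0 < \<eta>" using d by (simp add: \<eta>_def)
  obtain K4 \<tau>4 :: real where K4: "0 < K4" "0 < \<tau>4"
    "\<And>(V :: 'a set set) H (D :: real) (\<tau> :: real) (\<alpha> :: real). finite V \<Longrightarrow> uniform_hypergraph 4 V H \<Longrightarrow>
      degrees_bounded V H D \<tau> \<Longrightarrow> 0 < D \<Longrightarrow> 0 < \<tau> \<Longrightarrow> \<tau> \<le> \<tau>4 \<Longrightarrow> 1 \<le> \<tau> * card V \<Longrightarrow> D * \<tau> ^ (4 - 1) \<le> 24 \<Longrightarrow>
      (\<And>X. X \<subseteq> V \<Longrightarrow> \<alpha> * card V \<le> card X \<Longrightarrow> d ^ 8 / 3538944 * D * card V \<le> card {e \<in> H. e \<subseteq> X}) \<Longrightarrow>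
      has_containers V (independent H) (K4 * \<tau> * card V) (\<alpha> * card V)"
    by (rule hypergraph_container[of 4 "d ^ 8 / 3538944" 24]) (use d in auto)
  obtain K2 \<tau>2 :: real where K2: "0 < K2" "0 < \<tau>2"
    "\<And>(V :: 'a set set) H (D :: real) (\<tau> :: real) (\<alpha> :: real). finite V \<Longrightarrow> uniform_hypergraph 2 V H \<Longrightarrow>
      degrees_bounded V H D \<tau> \<Longrightarrow> 0 < D \<Longrightarrow> 0 < \<tau> \<Longrightarrow> \<tau> \<le> \<tau>2 \<Longrightarrow> 1 \<le> \<tau> * card V \<Longrightarrow> D * \<tau> ^ (2 - 1) \<le> 2 \<Longrightarrow>
      (\<And>X. X \<subseteq> V \<Longrightarrow> \<alpha> * card V \<le> card X \<Longrightarrow> \<eta> * d / 16 * D * card V \<le> card {e \<in> H. e \<subseteq> X}) \<Longrightarrow>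
      has_containers V (independent H) (K2 * \<tau> * card V) (\<alpha> * card V)"
    by (rule hypergraph_container[of 2 "\<eta> * d / 16" 2]) (use d \<eta>0 in auto)
  have "\<forall>\<^sub>F n in sequentially. real n powr (-2/3) \<le> \<tau>4"
    using K4(2) by real_asymp
  moreover have "\<forall>\<^sub>F n in sequentially. 1 / real n \<le> \<tau>2" using K2(2) by real_asymp
  moreover have "\<forall>\<^sub>F n in sequentially. 8 \<le> d * real n" using d(1) by real_asymp
  moreover have "\<forall>\<^sub>F n in sequentially. 4 \<le> \<eta> * real n" using \<eta>0 by real_asymp
  ultimately have "\<forall>\<^sub>F n in sequentially. real n powr (-2/3) \<le> \<tau>4 \<and> 1 / real n \<le> \<tau>2 \<and> 8 \<le> d * real n \<and> 4 \<le> \<eta> * real n"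
    by eventually_elim auto
  then obtain n0 where n0: "\<And>n. n0 \<le> n \<Longrightarrow>
      real n powr (-2/3) \<le> \<tau>4 \<and> 1 / real n \<le> \<tau>2 \<and> 8 \<le> d * real n \<and> 4 \<le> \<eta> * real n"
    by (auto simp: eventually_sequentially)
  have "has_containers (ham_labelling.chords n v)
      (\<lambda>I. ham_labelling.cyc v \<subseteq> I \<and> \<not> has_cycle_of_length I (2 * h))
      (max K2 K4 * real n powr (4/3)) ((1/2 + d) * (real n)\<^sup>2)"
    if lab: "ham_labelling n v" and n: "n0 \<le> n" and h: "2 \<le> h" "h < n" for n h and v :: "nat \<Rightarrow> 'a"
  proof -
    interpret ham_labelling n v by (rule lab)
    have npos: "0 < real n" "1 \<le> real n" using h by auto
    have pw: "real n powr (-2/3) * (real n)\<^sup>2 = real n powr (4/3)"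
    proof -
      have "real n powr (-2/3) * real n powr 2 = real n powr (4/3)" unfolding powr_add[symmetric] by simp
      thus ?thesis using npos by simp
    qed
    have n43: "1 \<le> real n powr (4/3)" using npos by (simp add: ge_one_powr_ge_zero)
    have n_le: "real n \<le> real n powr (4/3)" using powr_mono[of 1 "4/3" "real n"] npos by simp
    have cN: "real (card chords) = (real n)\<^sup>2" by (simp add: card_chords)
    have nn: "real n powr (-2/3) \<le> \<tau>4" "1 / real n \<le> \<tau>2" "8 \<le> d * real n" "4 \<le> \<eta> * real n"
      using n0[OF n] by blast+
    consider "shortcut_system 4 (2 * h) (24 * (real n)\<^sup>2) (real n powr (-2/3)) (d ^ 8 / 3538944) (1/2 + d)"
      | "shortcut_system 2 (2 * h) (2 * real n) (1 / real n) (\<eta> * d / 16) (1/2 + d)"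
      using shortcut_system_cases[OF d h nn(3), folded \<eta>_def, OF nn(4)] by blast
    thus ?thesis
    proof cases
      case 1
      have cube: "24 * (real n)\<^sup>2 * (real n powr (-2/3)) ^ (4 - 1) \<le> 24"
      proof -
        have "(real n powr (-2/3)) ^ (4 - 1) = real n powr (-2)"
          using npos by (simp add: powr_powr flip: powr_realpow)
        hence "(real n)\<^sup>2 * (real n powr (-2/3)) ^ (4 - 1) = 1"
          using npos by (simp add: powr_minus)
        thus ?thesis by simp
      qed
      have p: "0 < 24 * (real n)\<^sup>2" "0 < real n powr (-2/3)" "1 \<le> real n powr (-2/3) * card chords"
        using npos pw n43 by (simp_all add: cN)
      have le: "K4 * real n powr (-2/3) * card chords \<le> max K2 K4 * real n powr (4/3)"
        using pw by (simp add: cN mult.assoc mult_right_mono)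
      show ?thesis
        using containers_of_shortcuts[OF 1 K4(3)[OF finite_chords _ _ p(1,2) nn(1) p(3) cube] le]
        unfolding cN .
    next
      case 2
      have N: "1 / real n * card chords = n" using npos by (simp add: cN power2_eq_square)
      have one: "2 * real n * (1 / real n) ^ (2 - 1) \<le> 2" using npos by simp
      have p: "0 < 2 * real n" "0 < 1 / real n" "1 \<le> 1 / real n * card chords"
        using npos unfolding N by simp_all
      have le: "K2 * (1 / real n) * card chords \<le> max K2 K4 * real n powr (4/3)"
        unfolding mult.assoc N using n_le K2(1) npos by (intro mult_mono) auto
      show ?thesis
        using containers_of_shortcuts[OF 2 K2(3)[OF finite_chords _ _ p(1,2) nn(2) p(3) one] le]
        unfolding cN .
    qed
  qed
  thus ?thesis using that[of "max K2 K4" n0] K2(1) by simp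
qed

section \<open>Transfer to the random graph and the final union bound\<close>

lemma finite_complete_bip_edges: "finite (complete_bip_edges m n)"
proof -
  have "complete_bip_edges m n = (\<lambda>(i, j). {Inl i, Inr j}) ` ({..<m} \<times> {..<n})"
    by (auto simp: complete_bip_edges_def)
  thus ?thesis by simp
qed

lemma card_complete_bip_edges: "card (complete_bip_edges m n) = m * n"
proof -
  have "complete_bip_edges m n = (\<lambda>(i, j). {Inl i, Inr j}) ` ({..<m} \<times> {..<n})"
    by (auto simp: complete_bip_edges_def)
  moreover have "inj_on (\<lambda>(i, j). {Inl i :: nat + nat, Inr j}) ({..<m} \<times> {..<n})"
    by (auto simp: inj_on_def doubleton_eq_iff)
  ultimately show ?thesis by (simp add: card_image card_cartesian_product)
qed

lemma card_bip_vertices: "card (bip_vertices m n) = m + n"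
  by (simp add: bip_vertices_def card_Plus)

lemma bipartite_subset:
  assumes "E \<subseteq> complete_bip_edges m n"
  shows "bipartite (bip_vertices m n) E"
  unfolding bipartite_def
proof (rule exI[of _ "Inl ` {..<m}"], rule exI[of _ "Inr ` {..<n}"], intro conjI ballI)
  fix e assume "e \<in> E"
  then obtain i j where "e = {Inl i, Inr j}" "i < m" "j < n"
    using assms unfolding complete_bip_edges_def by blast
  thus "\<exists>a\<in>Inl ` {..<m}. \<exists>b\<in>Inr ` {..<n}. e = {a, b}" by blast
qed (auto simp: bip_vertices_def Plus_def)

text \<open>The two classes alternate along the cycle, so every chord is a potential edge, and both
  sets have n^2 elements. The even positions may form either class, hence the case distinction on
  \<open>v 0\<close>.\<close>

lemma ham_cycle_labelling:
  assumes c: "is_cycle E vs" "length vs = 2 * n" and E: "E \<subseteq> complete_bip_edges n n" and n: "2 \<le> n"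
  defines "v \<equiv> \<lambda>i. vs ! (i mod (2 * n))"
  shows "ham_labelling n v" "ham_labelling.cyc v \<subseteq> E" "ham_labelling.chords n v = complete_bip_edges n n"
    "set vs \<subseteq> bip_vertices n n"
proof -
  have dist: "distinct vs" and edge: "\<And>i. i < 2 * n \<Longrightarrow> {vs ! i, vs ! (Suc i mod (2 * n))} \<in> E"
    using c by (auto simp: is_cycle_def)
  show lab: "ham_labelling n v"
  proof
    fix i j show "v i = v j \<longleftrightarrow> i mod (2 * n) = j mod (2 * n)"
      unfolding v_def using dist c(2) n by (subst nth_eq_iff_index_eq) auto
  qed (rule n)
  then interpret ham_labelling n v .
  have vE: "{v i, v (Suc i)} \<in> E" for i
    using edge[of "i mod (2 * n)"] n by (simp add: v_def mod_Suc_eq)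
  thus "cyc \<subseteq> E" by (auto simp: cyc_def)
  have side: "isl (v (Suc i)) \<longleftrightarrow> \<not> isl (v i)" and vert: "v i \<in> bip_vertices n n" for i
    using subsetD[OF E vE[of i]]
    by (auto simp: complete_bip_edges_def bip_vertices_def doubleton_eq_iff Plus_def)
  have even_side: "isl (v (2 * a)) \<longleftrightarrow> isl (v 0)" for a
    by (induction a) (simp_all add: side)
  have odd_side: "isl (v (2 * b + 1)) \<longleftrightarrow> \<not> isl (v 0)" for b
    using side[of "2 * b"] even_side[of b] by simp
  have "ch a b \<in> complete_bip_edges n n" for a b
    using vert[of "2 * a"] vert[of "2 * b + 1"] even_side[of a] odd_side[of b]
    by (cases "isl (v 0)"; auto simp: ch_def complete_bip_edges_def bip_vertices_def Plus_def insert_commute; blast)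
  hence "chords \<subseteq> complete_bip_edges n n" by (auto simp: chords_def)
  thus "chords = complete_bip_edges n n"
    by (intro card_subset_eq finite_complete_bip_edges)
      (auto simp: card_chords card_complete_bip_edges power2_eq_square)
  show "set vs \<subseteq> bip_vertices n n"
  proof
    fix x assume "x \<in> set vs"
    then obtain i where "i < 2 * n" "x = vs ! i" using c(2) by (auto simp: in_set_conv_nth)
    thus "x \<in> bip_vertices n n" using vert[of i] by (simp add: v_def)
  qed
qed

lemma random_bip_graph_eq: "random_bip_graph n n q = random_subset (complete_bip_edges n n) q"
  by (simp add: random_bip_graph_def random_subset_def)

definition bipancyclic_event :: "real \<Rightarrow> nat \<Rightarrow> real \<Rightarrow> (nat + nat) set set \<Rightarrow> bool" where
  "bipancyclic_event q n e G \<longleftrightarrow> (\<forall>G' \<subseteq> G. hamiltonian (bip_vertices n n) G' \<and>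
      real (card G') > (1 + e) * (real n)\<^sup>2 * q / 2 \<longrightarrow> bipancyclic (bip_vertices n n) G')"

text \<open>\<open>K\<close> and \<open>n0\<close> must be independent of q, since q = p n varies
  with n. Taking d = e/4 leaves a gap of order e between the container size and the edge threshold
  divided by q, for Chernoff's bound to exploit.\<close>

lemma bipancyclic_event_failure:
  fixes e :: real
  assumes e: "0 < e" "e \<le> 1"
  shows "\<exists>K n0. \<forall>n\<ge>n0. \<forall>q. 0 \<le> q \<and> q \<le> 1 \<longrightarrow>
    measure_pmf.prob (random_bip_graph n n q) {G. \<not> bipancyclic_event q n e G}
      \<le> real ((2 * n) ^ (2 * n) * (2 * n)) * exp (K * real n powr (4/3) - e\<^sup>2 / 128 * q * (real n)\<^sup>2)"
proof -
  obtain K n0 where K: "0 < K" and cont: "\<And>n (v :: nat \<Rightarrow> nat + nat) h. ham_labelling n v \<Longrightarrow> n0 \<le> n \<Longrightarrow>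
      2 \<le> h \<Longrightarrow> h < n \<Longrightarrow>
    has_containers (ham_labelling.chords n v)
      (\<lambda>I. ham_labelling.cyc v \<subseteq> I \<and> \<not> has_cycle_of_length I (2 * h))
      (K * real n powr (4/3)) ((1/2 + e / 4) * (real n)\<^sup>2)"
    by (rule cycle_containers[of "e / 4"]) (use e in auto)
  define K' where "K' = K * (ln (128 / e\<^sup>2) + 1)"
  have main: "measure_pmf.prob (random_bip_graph n n q) {G. \<not> bipancyclic_event q n e G}
      \<le> real ((2 * n) ^ (2 * n) * (2 * n)) * exp (K' * real n powr (4/3) - e\<^sup>2 / 128 * q * (real n)\<^sup>2)"
    if n: "max n0 2 \<le> n" and q: "0 \<le> q" "q \<le> 1" for n q
  proof -
    let ?E = "complete_bip_edges n n"
    let ?M = "random_bip_graph n n q"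
    define s where "s = K * real n powr (4/3)"
    define t where "t = (1 + e) * (real n)\<^sup>2 * q / 2"
    define lab where "lab vs = (\<lambda>i. vs ! (i mod (2 * n)))" for vs :: "(nat + nat) list"
    define cont_fun where "cont_fun vs h F \<longleftrightarrow> (\<forall>I\<subseteq>?E. ham_labelling.cyc (lab vs) \<subseteq> I \<and> \<not> has_cycle_of_length I (2 * h) \<longrightarrow>
      (\<exists>S\<subseteq>I. card S \<le> s \<and> I \<subseteq> F S \<and> F S \<subseteq> ?E \<and> card (F S) \<le> (1/2 + e / 4) * card ?E))" for vs h F
    \<comment> \<open>For a list that is no Hamilton cycle this may be an arbitrary function.
      \<open>Bad\<close> states its size conditions itself, so its probability bound holds for every
      \<open>F\<close>.\<close>
    define F where "F vs h = (SOME F. cont_fun vs h F)" for vs h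
    define Bad where "Bad vs h = {G. \<exists>S\<subseteq>G. card S \<le> s \<and> F vs h S \<subseteq> ?E \<and>
      card (F vs h S) \<le> (1/2 + e / 4) * card ?E \<and> t \<le> card (G \<inter> F vs h S)}" for vs h
    \<comment> \<open>All lists of 2n vertices instead of the Hamilton cycles only; (2n)^(2n) is
      still small enough.\<close>
    define L where "L = {vs. set vs \<subseteq> bip_vertices n n \<and> length vs = 2 * n}"
    have cE: "real (card ?E) = (real n)\<^sup>2" by (simp add: card_complete_bip_edges power2_eq_square)
    have finL: "finite L" and cardL: "card L = (2 * n) ^ (2 * n)"
      using finite_lists_length_eq[of "bip_vertices n n" "2 * n"] card_lists_length_eq[of "bip_vertices n n" "2 * n"]
      by (simp_all add: L_def bip_vertices_def card_Plus mult_2)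
    have supp: "set_pmf ?M \<subseteq> Pow ?E" by (auto simp: random_bip_graph_def)
    have covered: "\<exists>vs\<in>L. \<exists>h<n. G \<in> Bad vs h" if G: "G \<subseteq> ?E" "\<not> bipancyclic_event q n e G" for G
    proof -
      from G(2) obtain G' where G': "G' \<subseteq> G" "hamiltonian (bip_vertices n n) G'" "t < card G'"
        "\<not> bipancyclic (bip_vertices n n) G'"
        unfolding bipancyclic_event_def t_def by blast
      have G'E: "G' \<subseteq> ?E" using G' G by blast
      obtain k where k: "even k" "4 \<le> k" "k \<le> 2 * n" "\<not> has_cycle_of_length G' k"
        using G'(4) bipartite_subset[OF G'E] unfolding bipancyclic_def card_bip_vertices by auto
      have ham: "has_cycle_of_length G' (2 * n)"
        using G'(2) by (simp add: hamiltonian_def card_bip_vertices mult_2)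
      define h where "h = k div 2"
      have "k \<noteq> 2 * n" using k(4) ham by blast
      hence h: "2 * h = k" "2 \<le> h" "h < n" using k by (auto simp: h_def)
      obtain vs where vs: "is_cycle G' vs" "length vs = 2 * n"
        using ham by (auto simp: has_cycle_of_length_def)
      note lab = ham_cycle_labelling[OF vs G'E, folded lab_def]
      have n2: "2 \<le> n" using n by simp
      have "n0 \<le> n" using n by simp
      from cont[OF lab(1)[OF n2] this h(2,3)] have "\<exists>F. cont_fun vs h F"
        unfolding lab(3)[OF n2] cE s_def has_containers_def cont_fun_def .
      hence Fp: "cont_fun vs h (F vs h)" unfolding F_def by (rule someI_ex)
      have "\<not> has_cycle_of_length G' (2 * h)" using k(4) h(1) by simp
      from Fp[unfolded cont_fun_def, rule_format, OF G'E conjI[OF lab(2)[OF n2] this]] obtain S where S': "S \<subseteq> G' \<and> card S \<le> s \<and>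
        G' \<subseteq> F vs h S \<and> F vs h S \<subseteq> ?E \<and> card (F vs h S) \<le> (1/2 + e / 4) * card ?E" ..
      have S: "S \<subseteq> G'" "card S \<le> s" "G' \<subseteq> F vs h S" "F vs h S \<subseteq> ?E"
        "card (F vs h S) \<le> (1/2 + e / 4) * card ?E" using S' by simp_all
      \<comment> \<open>Replacing \<open>G'\<close> by all of \<open>G\<close> within the container
        removes the free choice of \<open>G'\<close>: the remaining event concerns \<open>G\<close>
        and \<open>S\<close> only.\<close>
      have "card G' \<le> card (G \<inter> F vs h S)"
      proof (rule card_mono)
        show "finite (G \<inter> F vs h S)" using finite_subset[OF G(1) finite_complete_bip_edges] by simp
        show "G' \<subseteq> G \<inter> F vs h S" using S(3) G'(1) by simp
      qed
      hence "t \<le> card (G \<inter> F vs h S)" using G'(3) by linarith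
      moreover have "S \<subseteq> G" using S(1) G'(1) by simp
      ultimately have "G \<in> Bad vs h" unfolding Bad_def mem_Collect_eq using S(2,4,5) by (intro exI[of _ S]) simp
      moreover have "vs \<in> L" using lab(4)[OF n2] vs(2) by (simp add: L_def)
      ultimately show ?thesis using h(3) by blast
    qed
    have sub: "{G. \<not> bipancyclic_event q n e G} \<inter> set_pmf ?M \<subseteq> (\<Union>x\<in>L \<times> {..<n}. Bad (fst x) (snd x))"
    proof
      fix G assume "G \<in> {G. \<not> bipancyclic_event q n e G} \<inter> set_pmf ?M"
      hence "G \<subseteq> ?E" "\<not> bipancyclic_event q n e G" using supp by auto
      from covered[OF this] obtain vs h where "vs \<in> L" "h < n" "G \<in> Bad vs h" by blast
      thus "G \<in> (\<Union>x\<in>L \<times> {..<n}. Bad (fst x) (snd x))" by (intro UN_I[of "(vs, h)"]) simp_all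
    qed
    define b where "b = exp (K' * real n powr (4/3) - e\<^sup>2 / 128 * q * (real n)\<^sup>2)"
    have bad: "measure_pmf.prob ?M (Bad vs h) \<le> b" for vs h
    proof -
      have s0: "0 \<le> s" using K by (simp add: s_def)
      have "e\<^sup>2 \<le> 1" using e by (simp add: power_le_one)
      hence x: "0 < e\<^sup>2 / 128" "e\<^sup>2 / 128 \<le> 1" using e by auto
      have "measure_pmf.prob ?M (Bad vs h) \<le>
          exp (s * ln (1 / (e\<^sup>2 / 128)) + e\<^sup>2 / 128 * q * card ?E + q * (exp (e / 8) - 1) * (1/2 + e / 4) * card ?E - e / 8 * (t - s))"
        unfolding Bad_def random_bip_graph_eq
        by (rule random_subset_containers[OF finite_complete_bip_edges q _ x]) (use e in simp)
      also have "\<dots> \<le> exp (s * (ln (128 / e\<^sup>2) + 1) - e\<^sup>2 / 128 * q * (real n)\<^sup>2)"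
        using union_bound_exponent[OF e q(1) _ s0, of "(real n)\<^sup>2"] by (simp only: cE t_def exp_le_cancel_iff zero_le_power2)
      also have "s * (ln (128 / e\<^sup>2) + 1) = K' * real n powr (4/3)" by (simp add: s_def K'_def mult_ac)
      finally show ?thesis by (simp only: b_def)
    qed
    have "measure_pmf.prob ?M {G. \<not> bipancyclic_event q n e G} =
        measure_pmf.prob ?M ({G. \<not> bipancyclic_event q n e G} \<inter> set_pmf ?M)"
      by (simp add: measure_Int_set_pmf)
    also have "\<dots> \<le> measure_pmf.prob ?M (\<Union>x\<in>L \<times> {..<n}. Bad (fst x) (snd x))"
      using sub by (intro measure_pmf.finite_measure_mono) auto
    also have "\<dots> \<le> (\<Sum>x\<in>L \<times> {..<n}. measure_pmf.prob ?M (Bad (fst x) (snd x)))"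
      using finL by (intro measure_pmf.finite_measure_subadditive_finite) auto
    also have "\<dots> \<le> (\<Sum>x\<in>L \<times> {..<n}. b)" by (intro sum_mono bad)
    also have "\<dots> = real ((2 * n) ^ (2 * n) * n) * b" by (simp add: card_cartesian_product cardL)
    also have "\<dots> \<le> real ((2 * n) ^ (2 * n) * (2 * n)) * b"
      by (intro mult_right_mono of_nat_mono mult_le_mono2) (auto simp: b_def)
    finally show ?thesis by (simp only: b_def)
  qed
  thus ?thesis by (rule_tac exI[of _ K'], rule_tac exI[of _ "max n0 2"]) blast
qed

theorem theorem2:
  fixes p :: "nat \<Rightarrow> real"
  assumes "\<And>n. 0 \<le> p n \<and> p n \<le> 1"
    and "filterlim (\<lambda>n. p n * real n powr (2/3)) at_top sequentially"
  shows "\<exists>\<epsilon> :: nat \<Rightarrow> real. (\<forall>n. \<epsilon> n > 0) \<and> \<epsilon> \<longlonglongrightarrow> 0 \<and>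
    aas (\<lambda>n. random_bip_graph n n (p n))
      (\<lambda>n G. \<forall>G' \<subseteq> G. hamiltonian (bip_vertices n n) G' \<and>
         real (card G') > (1 + \<epsilon> n) * (real n)\<^sup>2 * p n / 2 \<longrightarrow>
         bipancyclic (bip_vertices n n) G')"
proof -
  define P where "P n e = measure_pmf.prob (random_bip_graph n n (p n)) {G. bipancyclic_event (p n) n e G}" for n e
  have "(\<lambda>n. P n e) \<longlonglongrightarrow> 1" if e: "0 < e" "e \<le> 1" for e
  proof -
    from bipancyclic_event_failure[OF e] obtain K n0 where Kn0: "\<forall>n\<ge>n0. \<forall>q. 0 \<le> q \<and> q \<le> 1 \<longrightarrow>
      measure_pmf.prob (random_bip_graph n n q) {G. \<not> bipancyclic_event q n e G}
        \<le> real ((2 * n) ^ (2 * n) * (2 * n)) * exp (K * real n powr (4/3) - e\<^sup>2 / 128 * q * (real n)\<^sup>2)"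
      by metis
    let ?b = "\<lambda>n. real ((2 * n) ^ (2 * n) * (2 * n)) * exp (K * real n powr (4/3) - e\<^sup>2 / 128 * p n * (real n)\<^sup>2)"
    have b0: "?b \<longlonglongrightarrow> 0" using e by (intro union_bound_tendsto_0[OF assms(2)]) simp
    have compl: "P n e = 1 - measure_pmf.prob (random_bip_graph n n (p n)) {G. \<not> bipancyclic_event (p n) n e G}" for n
    proof -
      have "{G. bipancyclic_event (p n) n e G} = space (measure_pmf (random_bip_graph n n (p n))) - {G. \<not> bipancyclic_event (p n) n e G}"
        by auto
      thus ?thesis unfolding P_def by (simp only: measure_pmf.prob_compl sets_measure_pmf UNIV_I)
    qed
    show ?thesis
    proof (rule tendsto_sandwich[of "\<lambda>n. 1 - ?b n" _ _ "\<lambda>_. 1"])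
      show "\<forall>\<^sub>F n in sequentially. 1 - ?b n \<le> P n e"
        using eventually_ge_at_top[of n0]
      proof eventually_elim
        case (elim n)
        thus ?case using Kn0[rule_format, of n "p n"] assms(1)[of n] unfolding compl by linarith
      qed
      show "(\<lambda>n. 1 - ?b n) \<longlonglongrightarrow> 1" using tendsto_diff[OF tendsto_const b0, of 1] by simp
    qed (auto simp: P_def)
  qed
  from diagonal_null_sequence[of P, OF this]
  obtain \<epsilon> where "\<forall>n. 0 < \<epsilon> n" "\<epsilon> \<longlonglongrightarrow> 0" "(\<lambda>n. P n (\<epsilon> n)) \<longlonglongrightarrow> 1"
    by (auto simp: P_def)
  thus ?thesis unfolding aas_def P_def bipancyclic_event_def by blast
qed

end
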